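(* Let $(t_1,t_2,t_3,t_4:A\otimes A\to A\otimes A,\ e:A\to I)$ be a regular multiplier bimonoid in a braided monoidal category $\mathcal C$, with multiplication $m:=(e\otimes 1)t_1=(1\otimes e)t_2$. Assume that $e$ and the equal morphisms $$\big(A^{\otimes 3}\xrightarrow{1\otimes t_1}A^{\otimes 3}\xrightarrow{b^{-1}\otimes 1}A^{\otimes 3}\xrightarrow{m\otimes 1}A^{\otimes 2}\big)=\big(A^{\otimes 3}\xrightarrow{t_4\otimes 1}A^{\otimes 3}\xrightarrow{1\otimes m}A^{\otimes 2}\big)$$ are split epimorphisms. Then the category of modules over the regular multiplier bimonoid is monoidal in such a way that the forgetful functor to $\mathcal C$, $(Q,q_1,q_4)\mapsto Q$, is strict monoidal.
   Context: Conventions: $\otimes$ is the monoidal product, $I$ the unit, $b_{X,Y}:X\otimes Y\to Y\otimes X$ the braiding ($b=b_{A,A}$ where no subscript is given); composition is juxtaposition, $1$ denotes identities, associativity and unit isomorphisms are suppressed. $\overline{\mathcal C}$ is the same monoidal category with the inverse braiding $(b_{Y,X})^{-1}:X\otimes Y\to Y\otimes X$. $\mathcal C^{\mathsf{rev}}$ is the same category with the opposite monoidal product $(X,Y)\mapsto Y\otimes X$, the same unit, and the braiding $b_{Y,X}:Y\otimes X\to X\otimes Y$. In any braided monoidal category: a *fusion morphism* is a morphism $t:A\otimes A\to A\otimes A$ with $(t\otimes 1)(b^{-1}\otimes 1)(1\otimes t)(b\otimes 1)(1\otimes t)=(1\otimes t)(t\otimes 1)$; a *counit* for it is a morphism $e:A\to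 I$ with $(1\otimes e)t=1\otimes e$. A *multiplier bimonoid* $(t_1,t_2,e)$ in $\mathcal C$ consists of a fusion morphism $t_1:A\otimes A\to A\otimes A$ in $\mathcal C$ and a fusion morphism $t_2:A\otimes A\to A\otimes A$ in $\mathcal C^{\mathsf{rev}}$ (i.e. $(1\otimes t_2)(1\otimes b^{-1})(t_2\otimes 1)(1\otimes b)(t_2\otimes 1)=(t_2\otimes 1)(1\otimes t_2)$) with a common counit $e:A\to I$ (i.e. $(1\otimes e)t_1=1\otimes e$ and $(e\otimes 1)t_2=e\otimes 1$), such that $(1\otimes t_1)(t_2\otimes 1)=(t_2\otimes 1)(1\otimes t_1)$ and $(e\otimes 1)t_1=(1\otimes e)t_2$. A *regular multiplier bimonoid* $(t_1,t_2,t_3,t_4,e)$ in $\mathcal C$ consists of a multiplier bimonoid $(t_1,t_2,e)$ in $\mathcal C$, with multiplication $m:=(e\otimes 1)t_1=(1\otimes e)t_2$, and a multiplier bimonoid $(t_3,t_4,e)$ in $\overline{\mathcal C}$ with a common counit $e:A\to I$, such that - (A) $(1\otimes m)(t_3\otimes 1)(b\otimes 1)=(1\otimes m)(b\otimes 1)(1\otimes t_1)$; - (B) $(t_4\otimes 1)(1\otimes t_1)=(1\otimes t_1)(t_4\otimes 1)$; - (A$^{\mathsf{rev}}$) $(m\otimes 1)(1\otimes t_4)(1\otimes b)=(m\otimes 1)(1\otimes b)(t_2\otimes 1)$; - (B$^{\mathsf{rev}}$) $(1\otimes t_3)(t_2\otimes 1)=(t_2\otimes 1)(1\otimes t_3)$;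 - (C) $(e\otimes 1)t_3=(e\otimes 1)t_1b^{-1}$. (The two composites displayed in the claim are equal, by composing (B) with $1\otimes e\otimes 1$.) A *module* over this regular multiplier bimonoid is an object $Q$ with morphisms $q_1:A\otimes Q\to A\otimes Q$ and $q_4:Q\otimes A\to Q\otimes A$ such that - $q_1$ is a module over the counital fusion morphism $(t_1,e)$ in $\mathcal C$: $(t_1\otimes 1)(b^{-1}\otimes 1)(1\otimes q_1)(b\otimes 1)(1\otimes q_1)=(1\otimes q_1)(t_1\otimes 1)$ on $A\otimes A\otimes Q$, and $(e\otimes 1)q_1:A\otimes Q\to Q$ is a split epimorphism; - $q_4$ is a module over the counital fusion morphism $(t_4,e)$ in $\overline{\mathcal C}^{\mathsf{rev}}$: $(1\otimes t_4)(1\otimes b)(q_4\otimes 1)(1\otimes b^{-1})(q_4\otimes 1)=(q_4\otimes 1)(1\otimes t_4)$ on $Q\otimes A\otimes A$, and $(1\otimes e)q_4:Q\otimes A\to Q$ is a split epimorphism; - $(t_4\otimes 1)(1\otimes q_1)=(1\otimes q_1)(t_4\otimes 1)$ on $A\otimes A\otimes Q$; - $(1\otimes t_1)(q_4\otimes 1)=(q_4\otimes 1)(1\otimes t_1)$ on $Q\otimes A\otimes A$; - $(e\otimes 1)q_1=(1\otimes e)q_4\,b_{A,Q}:A\otimes Q\to Q$. A *morphism* of modules $(Q,q_1,q_4)\to(P,p_1,p_4)$ is a morphism $f:Q\to P$ in $\mathcal C$ such that $(1\otimes f)q_1=p_1(1\otimes f)$ and $(f\otimes 1)q_4=p_4(f\otimes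 1)$. *)

theory Defs
  imports Main
begin

section \<open>Categories and braided monoidal categories\<close>

text \<open>
  A category is a set of objects with a family of hom-sets. The hom-sets need not be disjoint, so
  arrows do not determine their domain and codomain; every category whose hom-sets are disjoint is
  of this form. This makes a category of objects with extra structure, such as the category of
  modules below, have the same type of arrows as the underlying category.

  Monoidal categories are not assumed strict: the associativity and unit isomorphisms are part of
  the data and are written out in all formulas.
\<close>

record ('o, 'm) category_data =
  Obj :: "'o set"
  Hom :: "'o \<Rightarrow> 'o \<Rightarrow> 'm set"
  Idt :: "'o \<Rightarrow> 'm"
  Comp :: "'m \<Rightarrow> 'm \<Rightarrow> 'm" (infixr "\<cdot>\<index>" 55)

record ('o, 'm) monoidal_data = "('o, 'm) category_data" +
  Tensor :: "'o \<Rightarrow> 'o \<Rightarrow> 'o" (infixl "\<otimes>\<index>" 70)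
  TensorArr :: "'m \<Rightarrow> 'm \<Rightarrow> 'm" (infixl "\<boxtimes>\<index>" 70)
  Unit :: "'o"
  Assoc :: "'o \<Rightarrow> 'o \<Rightarrow> 'o \<Rightarrow> 'm"
  LUnit :: "'o \<Rightarrow> 'm"
  RUnit :: "'o \<Rightarrow> 'm"

record ('o, 'm) braided_data = "('o, 'm) monoidal_data" +
  Braid :: "'o \<Rightarrow> 'o \<Rightarrow> 'm"

definition inverse_arrows ::
    "('o, 'm, 'z) category_data_scheme \<Rightarrow> 'o \<Rightarrow> 'o \<Rightarrow> 'm \<Rightarrow> 'm \<Rightarrow> bool" where
  "inverse_arrows C X Y f g \<longleftrightarrow> f \<in> Hom C X Y \<and> g \<in> Hom C Y X \<and>
     g \<cdot>\<^bsub>C\<^esub> f = Idt C X \<and> f \<cdot>\<^bsub>C\<^esub> g = Idt C Y"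

definition iso_arr :: "('o, 'm, 'z) category_data_scheme \<Rightarrow> 'o \<Rightarrow> 'o \<Rightarrow> 'm \<Rightarrow> bool" where
  "iso_arr C X Y f \<longleftrightarrow> (\<exists>g. inverse_arrows C X Y f g)"

definition Inv :: "('o, 'm, 'z) category_data_scheme \<Rightarrow> 'o \<Rightarrow> 'o \<Rightarrow> 'm \<Rightarrow> 'm" where
  "Inv C X Y f = (THE g. inverse_arrows C X Y f g)"

definition split_epi :: "('o, 'm, 'z) category_data_scheme \<Rightarrow> 'o \<Rightarrow> 'o \<Rightarrow> 'm \<Rightarrow> bool" where
  "split_epi C X Y f \<longleftrightarrow> f \<in> Hom C X Y \<and> (\<exists>s \<in> Hom C Y X. f \<cdot>\<^bsub>C\<^esub> s = Idt C Y)"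

locale category =
  fixes C :: "('o, 'm, 'z) category_data_scheme" (structure)
  assumes Id_in_Hom: "X \<in> Obj C \<Longrightarrow> Idt C X \<in> Hom C X X"
    and Comp_in_Hom: "\<lbrakk>X \<in> Obj C; Y \<in> Obj C; Z \<in> Obj C; f \<in> Hom C X Y; g \<in> Hom C Y Z\<rbrakk>
      \<Longrightarrow> g \<cdot> f \<in> Hom C X Z"
    and Id_Comp: "\<lbrakk>X \<in> Obj C; Y \<in> Obj C; f \<in> Hom C X Y\<rbrakk> \<Longrightarrow> Idt C Y \<cdot> f = f"
    and Comp_Id: "\<lbrakk>X \<in> Obj C; Y \<in> Obj C; f \<in> Hom C X Y\<rbrakk> \<Longrightarrow> f \<cdot> Idt C X = f"
    and Comp_assoc: "\<lbrakk>W \<in> Obj C; X \<in> Obj C; Y \<in> Obj C; Z \<in> Obj C;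
        f \<in> Hom C W X; g \<in> Hom C X Y; h \<in> Hom C Y Z\<rbrakk>
      \<Longrightarrow> (h \<cdot> g) \<cdot> f = h \<cdot> (g \<cdot> f)"

locale monoidal_category = category C
  for C :: "('o, 'm, 'z) monoidal_data_scheme" (structure) +
  assumes Tensor_Obj: "\<lbrakk>X \<in> Obj C; Y \<in> Obj C\<rbrakk> \<Longrightarrow> X \<otimes> Y \<in> Obj C"
    and Unit_Obj: "Unit C \<in> Obj C"
    and TensorArr_in_Hom: "\<lbrakk>X \<in> Obj C; X' \<in> Obj C; Y \<in> Obj C; Y' \<in> Obj C;
        f \<in> Hom C X X'; g \<in> Hom C Y Y'\<rbrakk>
      \<Longrightarrow> f \<boxtimes> g \<in> Hom C (X \<otimes> Y) (X' \<otimes> Y')"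
    and TensorArr_Id: "\<lbrakk>X \<in> Obj C; Y \<in> Obj C\<rbrakk> \<Longrightarrow> Idt C X \<boxtimes> Idt C Y = Idt C (X \<otimes> Y)"
    and TensorArr_Comp: "\<lbrakk>X \<in> Obj C; X' \<in> Obj C; X'' \<in> Obj C; Y \<in> Obj C; Y' \<in> Obj C; Y'' \<in> Obj C;
        f \<in> Hom C X X'; f' \<in> Hom C X' X''; g \<in> Hom C Y Y'; g' \<in> Hom C Y' Y''\<rbrakk>
      \<Longrightarrow> (f' \<cdot> f) \<boxtimes> (g' \<cdot> g) = (f' \<boxtimes> g') \<cdot> (f \<boxtimes> g)"
    and Assoc_iso: "\<lbrakk>X \<in> Obj C; Y \<in> Obj C; Z \<in> Obj C\<rbrakk>
      \<Longrightarrow> iso_arr C ((X \<otimes> Y) \<otimes> Z) (X \<otimes> (Y \<otimes> Z)) (Assoc C X Y Z)"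
    and LUnit_iso: "X \<in> Obj C \<Longrightarrow> iso_arr C (Unit C \<otimes> X) X (LUnit C X)"
    and RUnit_iso: "X \<in> Obj C \<Longrightarrow> iso_arr C (X \<otimes> Unit C) X (RUnit C X)"
    and Assoc_natural: "\<lbrakk>X \<in> Obj C; X' \<in> Obj C; Y \<in> Obj C; Y' \<in> Obj C; Z \<in> Obj C; Z' \<in> Obj C;
        f \<in> Hom C X X'; g \<in> Hom C Y Y'; h \<in> Hom C Z Z'\<rbrakk>
      \<Longrightarrow> Assoc C X' Y' Z' \<cdot> ((f \<boxtimes> g) \<boxtimes> h) = (f \<boxtimes> (g \<boxtimes> h)) \<cdot> Assoc C X Y Z"
    and LUnit_natural: "\<lbrakk>X \<in> Obj C; Y \<in> Obj C; f \<in> Hom C X Y\<rbrakk>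
      \<Longrightarrow> LUnit C Y \<cdot> (Idt C (Unit C) \<boxtimes> f) = f \<cdot> LUnit C X"
    and RUnit_natural: "\<lbrakk>X \<in> Obj C; Y \<in> Obj C; f \<in> Hom C X Y\<rbrakk>
      \<Longrightarrow> RUnit C Y \<cdot> (f \<boxtimes> Idt C (Unit C)) = f \<cdot> RUnit C X"
    and pentagon: "\<lbrakk>W \<in> Obj C; X \<in> Obj C; Y \<in> Obj C; Z \<in> Obj C\<rbrakk>
      \<Longrightarrow> Assoc C W X (Y \<otimes> Z) \<cdot> Assoc C (W \<otimes> X) Y Z =
        (Idt C W \<boxtimes> Assoc C X Y Z) \<cdot> Assoc C W (X \<otimes> Y) Z \<cdot> (Assoc C W X Y \<boxtimes> Idt C Z)"
    and triangle: "\<lbrakk>X \<in> Obj C; Y \<in> Obj C\<rbrakk>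
      \<Longrightarrow> (Idt C X \<boxtimes> LUnit C Y) \<cdot> Assoc C X (Unit C) Y = RUnit C X \<boxtimes> Idt C Y"

definition AssocInv :: "('o, 'm, 'z) monoidal_data_scheme \<Rightarrow> 'o \<Rightarrow> 'o \<Rightarrow> 'o \<Rightarrow> 'm" where
  "AssocInv C X Y Z =
     Inv C ((X \<otimes>\<^bsub>C\<^esub> Y) \<otimes>\<^bsub>C\<^esub> Z) (X \<otimes>\<^bsub>C\<^esub> (Y \<otimes>\<^bsub>C\<^esub> Z)) (Assoc C X Y Z)"

locale braided_monoidal_category = monoidal_category C
  for C :: "('o, 'm, 'z) braided_data_scheme" (structure) +
  assumes Braid_iso: "\<lbrakk>X \<in> Obj C; Y \<in> Obj C\<rbrakk> \<Longrightarrow> iso_arr C (X \<otimes> Y) (Y \<otimes> X) (Braid C X Y)"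
    and Braid_natural: "\<lbrakk>X \<in> Obj C; X' \<in> Obj C; Y \<in> Obj C; Y' \<in> Obj C;
        f \<in> Hom C X X'; g \<in> Hom C Y Y'\<rbrakk>
      \<Longrightarrow> Braid C X' Y' \<cdot> (f \<boxtimes> g) = (g \<boxtimes> f) \<cdot> Braid C X Y"
    and hexagon1: "\<lbrakk>X \<in> Obj C; Y \<in> Obj C; Z \<in> Obj C\<rbrakk>
      \<Longrightarrow> Assoc C Y Z X \<cdot> Braid C X (Y \<otimes> Z) \<cdot> Assoc C X Y Z =
        (Idt C Y \<boxtimes> Braid C X Z) \<cdot> Assoc C Y X Z \<cdot> (Braid C X Y \<boxtimes> Idt C Z)"
    and hexagon2: "\<lbrakk>X \<in> Obj C; Y \<in> Obj C; Z \<in> Obj C\<rbrakk>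
      \<Longrightarrow> AssocInv C Z X Y \<cdot> Braid C (X \<otimes> Y) Z \<cdot> AssocInv C X Y Z =
        (Braid C X Z \<boxtimes> Idt C Y) \<cdot> AssocInv C X Z Y \<cdot> (Idt C X \<boxtimes> Braid C Y Z)"

definition BraidInv :: "('o, 'm, 'z) braided_data_scheme \<Rightarrow> 'o \<Rightarrow> 'o \<Rightarrow> 'm" where
  "BraidInv C X Y = Inv C (X \<otimes>\<^bsub>C\<^esub> Y) (Y \<otimes>\<^bsub>C\<^esub> X) (Braid C X Y)"

text \<open>
  \<open>bar C\<close> carries the inverse braiding, \<open>reverse C\<close> the opposite monoidal product. An equation
  below that is instantiated at \<open>reverse C\<close> reads as its mirror image in \<open>C\<close>.
\<close>

definition bar :: "('o, 'm) braided_data \<Rightarrow> ('o, 'm) braided_data" where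
  "bar C = C\<lparr>Braid := \<lambda>X Y. BraidInv C Y X\<rparr>"

definition reverse :: "('o, 'm) braided_data \<Rightarrow> ('o, 'm) braided_data" where
  "reverse C = C\<lparr>
     Tensor := \<lambda>X Y. Y \<otimes>\<^bsub>C\<^esub> X,
     TensorArr := \<lambda>f g. g \<boxtimes>\<^bsub>C\<^esub> f,
     Assoc := \<lambda>X Y Z. AssocInv C Z Y X,
     LUnit := RUnit C,
     RUnit := LUnit C,
     Braid := \<lambda>X Y. Braid C Y X\<rparr>"

text \<open>
  The action of a functor on arrows depends on the hom-set, since arrows do not determine it.
\<close>

locale strict_monoidal_functor =
  source: monoidal_category D + target: monoidal_category C
  for D :: "('a, 'b, 'y) monoidal_data_scheme"
    and C :: "('o, 'm, 'z) monoidal_data_scheme" +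
  fixes F0 :: "'a \<Rightarrow> 'o" and F1 :: "'a \<Rightarrow> 'a \<Rightarrow> 'b \<Rightarrow> 'm"
  assumes F_Obj: "X \<in> Obj D \<Longrightarrow> F0 X \<in> Obj C"
    and F_Hom: "\<lbrakk>X \<in> Obj D; Y \<in> Obj D; f \<in> Hom D X Y\<rbrakk> \<Longrightarrow> F1 X Y f \<in> Hom C (F0 X) (F0 Y)"
    and F_Idt: "X \<in> Obj D \<Longrightarrow> F1 X X (Idt D X) = Idt C (F0 X)"
    and F_Comp: "\<lbrakk>X \<in> Obj D; Y \<in> Obj D; Z \<in> Obj D; f \<in> Hom D X Y; g \<in> Hom D Y Z\<rbrakk>
      \<Longrightarrow> F1 X Z (g \<cdot>\<^bsub>D\<^esub> f) = F1 Y Z g \<cdot>\<^bsub>C\<^esub> F1 X Y f"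
    and F_Tensor: "\<lbrakk>X \<in> Obj D; Y \<in> Obj D\<rbrakk> \<Longrightarrow> F0 (X \<otimes>\<^bsub>D\<^esub> Y) = F0 X \<otimes>\<^bsub>C\<^esub> F0 Y"
    and F_Unit: "F0 (Unit D) = Unit C"
    and F_TensorArr: "\<lbrakk>X \<in> Obj D; X' \<in> Obj D; Y \<in> Obj D; Y' \<in> Obj D;
        f \<in> Hom D X X'; g \<in> Hom D Y Y'\<rbrakk>
      \<Longrightarrow> F1 (X \<otimes>\<^bsub>D\<^esub> Y) (X' \<otimes>\<^bsub>D\<^esub> Y') (f \<boxtimes>\<^bsub>D\<^esub> g) = F1 X X' f \<boxtimes>\<^bsub>C\<^esub> F1 Y Y' g"
    and F_Assoc: "\<lbrakk>X \<in> Obj D; Y \<in> Obj D; Z \<in> Obj D\<rbrakk>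
      \<Longrightarrow> F1 ((X \<otimes>\<^bsub>D\<^esub> Y) \<otimes>\<^bsub>D\<^esub> Z) (X \<otimes>\<^bsub>D\<^esub> (Y \<otimes>\<^bsub>D\<^esub> Z)) (Assoc D X Y Z) =
        Assoc C (F0 X) (F0 Y) (F0 Z)"
    and F_LUnit: "X \<in> Obj D \<Longrightarrow> F1 (Unit D \<otimes>\<^bsub>D\<^esub> X) X (LUnit D X) = LUnit C (F0 X)"
    and F_RUnit: "X \<in> Obj D \<Longrightarrow> F1 (X \<otimes>\<^bsub>D\<^esub> Unit D) X (RUnit D X) = RUnit C (F0 X)"


section \<open>Multiplier bimonoids\<close>

text \<open>
  Equations between morphisms out of a triple product are stated on the bracketing
  \<open>(X \<otimes> Y) \<otimes> Z\<close>; there \<open>f \<otimes> 1\<close> is \<open>f \<boxtimes> Idt C Z\<close>, and \<open>1 \<otimes> g\<close>, for an endomorphism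
  \<open>g\<close> of \<open>Y \<otimes> Z\<close>, is the following conjugate by the associativity isomorphism.
\<close>

definition whisker ::
    "('o, 'm, 'z) monoidal_data_scheme \<Rightarrow> 'o \<Rightarrow> 'o \<Rightarrow> 'o \<Rightarrow> 'm \<Rightarrow> 'm" where
  "whisker C X Y Z g =
     AssocInv C X Y Z \<cdot>\<^bsub>C\<^esub> (Idt C X \<boxtimes>\<^bsub>C\<^esub> g) \<cdot>\<^bsub>C\<^esub> Assoc C X Y Z"

locale fusion_morphism =
  fixes C :: "('o, 'm) braided_data" (structure) and A :: 'o and t :: 'm
  assumes carrier: "A \<in> Obj C"
    and in_Hom: "t \<in> Hom C (A \<otimes> A) (A \<otimes> A)"
    and fusion: "(t \<boxtimes> Idt C A) \<cdot> (BraidInv C A A \<boxtimes> Idt C A) \<cdot> whisker C A A A t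
        \<cdot> (Braid C A A \<boxtimes> Idt C A) \<cdot> whisker C A A A t
      = whisker C A A A t \<cdot> (t \<boxtimes> Idt C A)"

locale counital_fusion_morphism = fusion_morphism C A t
  for C :: "('o, 'm) braided_data" (structure) and A :: 'o and t :: 'm +
  fixes e :: 'm
  assumes counit_in_Hom: "e \<in> Hom C A (Unit C)"
    and counit: "(Idt C A \<boxtimes> e) \<cdot> t = Idt C A \<boxtimes> e"

definition mult :: "('o, 'm) braided_data \<Rightarrow> 'o \<Rightarrow> 'm \<Rightarrow> 'm \<Rightarrow> 'm" where
  "mult C A t1 e = LUnit C A \<cdot>\<^bsub>C\<^esub> (e \<boxtimes>\<^bsub>C\<^esub> Idt C A) \<cdot>\<^bsub>C\<^esub> t1"

locale multiplier_bimonoid =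
  fixes C :: "('o, 'm) braided_data" (structure) and A :: 'o and t1 t2 e :: 'm
  assumes t1: "counital_fusion_morphism C A t1 e"
    and t2: "counital_fusion_morphism (reverse C) A t2 e"
    and t1_t2: "whisker C A A A t1 \<cdot> (t2 \<boxtimes> Idt C A) = (t2 \<boxtimes> Idt C A) \<cdot> whisker C A A A t1"
    and mult_eq: "mult C A t1 e = RUnit C A \<cdot> (Idt C A \<boxtimes> e) \<cdot> t2"

locale regular_multiplier_bimonoid =
  fixes C :: "('o, 'm) braided_data" (structure) and A :: 'o and t1 t2 t3 t4 e :: 'm
  assumes t12: "multiplier_bimonoid C A t1 t2 e"
    and t34: "multiplier_bimonoid (bar C) A t3 t4 e"
    and ax_A: "(Idt C A \<boxtimes> mult C A t1 e) \<cdot> Assoc C A A A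
        \<cdot> (t3 \<boxtimes> Idt C A) \<cdot> (Braid C A A \<boxtimes> Idt C A)
      = (Idt C A \<boxtimes> mult C A t1 e) \<cdot> Assoc C A A A
        \<cdot> (Braid C A A \<boxtimes> Idt C A) \<cdot> whisker C A A A t1"
    and ax_B: "(t4 \<boxtimes> Idt C A) \<cdot> whisker C A A A t1 = whisker C A A A t1 \<cdot> (t4 \<boxtimes> Idt C A)"
    and ax_A_rev: "(mult C A t1 e \<boxtimes> Idt C A) \<cdot> whisker C A A A t4 \<cdot> whisker C A A A (Braid C A A)
      = (mult C A t1 e \<boxtimes> Idt C A) \<cdot> whisker C A A A (Braid C A A) \<cdot> (t2 \<boxtimes> Idt C A)"
    and ax_B_rev: "whisker C A A A t3 \<cdot> (t2 \<boxtimes> Idt C A) = (t2 \<boxtimes> Idt C A) \<cdot> whisker C A A A t3"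
    and ax_C: "(e \<boxtimes> Idt C A) \<cdot> t3 = (e \<boxtimes> Idt C A) \<cdot> t1 \<cdot> BraidInv C A A"


section \<open>Modules\<close>

locale fusion_module =
  fixes C :: "('o, 'm) braided_data" (structure) and A :: 'o and t e :: 'm
    and Q :: 'o and q :: 'm
  assumes carrier: "Q \<in> Obj C"
    and in_Hom: "q \<in> Hom C (A \<otimes> Q) (A \<otimes> Q)"
    and fusion: "(t \<boxtimes> Idt C Q) \<cdot> (BraidInv C A A \<boxtimes> Idt C Q) \<cdot> whisker C A A Q q
        \<cdot> (Braid C A A \<boxtimes> Idt C Q) \<cdot> whisker C A A Q q
      = whisker C A A Q q \<cdot> (t \<boxtimes> Idt C Q)"
    and action_split_epi: "split_epi C (A \<otimes> Q) Q (LUnit C Q \<cdot> (e \<boxtimes> Idt C Q) \<cdot> q)"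

text \<open>The notion of module does not involve \<open>t2\<close> and \<open>t3\<close>.\<close>

locale regular_module =
  fixes C :: "('o, 'm) braided_data" (structure) and A :: 'o and t1 t4 e :: 'm
    and Q :: 'o and q1 q4 :: 'm
  assumes q1: "fusion_module C A t1 e Q q1"
    and q4: "fusion_module (reverse (bar C)) A t4 e Q q4"
    and t4_q1: "(t4 \<boxtimes> Idt C Q) \<cdot> whisker C A A Q q1 = whisker C A A Q q1 \<cdot> (t4 \<boxtimes> Idt C Q)"
    and t1_q4: "whisker C Q A A t1 \<cdot> (q4 \<boxtimes> Idt C A) = (q4 \<boxtimes> Idt C A) \<cdot> whisker C Q A A t1"
    and actions_eq: "LUnit C Q \<cdot> (e \<boxtimes> Idt C Q) \<cdot> q1
      = RUnit C Q \<cdot> (Idt C Q \<boxtimes> e) \<cdot> q4 \<cdot> Braid C A Q"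

definition module_category ::
    "('o, 'm) braided_data \<Rightarrow> 'o \<Rightarrow> 'm \<Rightarrow> 'm \<Rightarrow> 'm \<Rightarrow> ('o \<times> 'm \<times> 'm, 'm) category_data" where
  "module_category C A t1 t4 e =
     \<lparr>Obj = {(Q, q1, q4). regular_module C A t1 t4 e Q q1 q4},
      Hom = \<lambda>(Q, q1, q4) (P, p1, p4). {f \<in> Hom C Q P.
        (Idt C A \<boxtimes>\<^bsub>C\<^esub> f) \<cdot>\<^bsub>C\<^esub> q1 = p1 \<cdot>\<^bsub>C\<^esub> (Idt C A \<boxtimes>\<^bsub>C\<^esub> f) \<and>
        (f \<boxtimes>\<^bsub>C\<^esub> Idt C A) \<cdot>\<^bsub>C\<^esub> q4 = p4 \<cdot>\<^bsub>C\<^esub> (f \<boxtimes>\<^bsub>C\<^esub> Idt C A)},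
      Idt = \<lambda>(Q, q1, q4). Idt C Q,
      Comp = Comp C\<rparr>"

end

theory Submission
  imports Defs
begin

text \<open>
  Read \<open>t1 (a \<otimes> b) = a1 \<otimes> a2 b\<close> and \<open>t4 (a \<otimes> b) = b1 a \<otimes> b2\<close>, with an implicit sum over a formal
  coproduct \<open>a1 \<otimes> a2\<close> that need not exist on its own. A module then has \<open>q1 (a \<otimes> x) = a1 \<otimes> a2 x\<close>
  and \<open>q4 (x \<otimes> a) = a1 x \<otimes> a2\<close>, and the diagonal action on \<open>Q \<otimes> P\<close> is \<open>a \<otimes> x \<otimes> y \<mapsto> a1 \<otimes> a2 x \<otimes> a3
  y\<close>: apply \<open>p1\<close> with \<open>A\<close> braided past \<open>Q\<close>, then \<open>q1\<close>. The structure on the other side is the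
  mirror image. Fusion equations and the commutation conditions are inherited by naturality of the
  braiding (\<open>fusion_tens\<close>, \<open>comm_tens\<close>). Two points need an idea.

  The two structures must induce the same action on \<open>Q \<otimes> P\<close>. One gives \<open>a1 x \<otimes> a2 y\<close> by means of
  the action on \<open>Q\<close> and \<open>p1\<close>, the other by means of \<open>q4\<close> and the action on \<open>P\<close>. They agree when
  \<open>y\<close> is itself of the form \<open>b z\<close>, because \<open>t1\<close> and \<open>q4\<close> commute, and the action on \<open>P\<close> is an
  epimorphism (\<open>mixed_actions\<close>). The action on \<open>Q \<otimes> P\<close> must be a split epimorphism. It is one
  after composition with a further action on each of \<open>Q\<close> and \<open>P\<close>, since \<open>a1 b x \<otimes> a2 c y\<close> is \<open>a1 b
  \<otimes> a2 c\<close> acting on \<open>x \<otimes> y\<close>, and \<open>a \<otimes> b \<otimes> c \<mapsto> a1 b \<otimes> a2 c\<close> is, up to the braiding, the map assumed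
  to be a split epimorphism (\<open>act_tens_splits\<close>). For the unit object, whose action is \<open>e\<close>,
  splitness is the assumption on \<open>e\<close>.

  The algebra takes place in an axiomatic strict setting, and strictness is obtained from \<open>C\<close> by
  passing to words: an arrow between lists of objects is an arrow of \<open>C\<close> between their
  left-bracketed products. Coherence enters through the associativity of the isomorphisms that
  concatenate bracketed products (\<open>glue_assoc\<close>), which follows from the pentagon and Kelly's unit
  laws. Since \<open>[Q, P]\<close> is isomorphic to the one-letter word of \<open>Q \<otimes> P\<close>, a module structure on a
  word can be transported to an object of \<open>C\<close>, and tensor products of word modules are strictly
  associative, so that the structure isomorphisms of \<open>C\<close> become module morphisms.
\<close>

section \<open>Strict braided monoidal categories\<close>

text \<open>
  The word \<open>W\<close> acts on arrows by whiskering, \<open>W \<lhd> f = 1 \<otimes> f\<close> and \<open>f \<rhd> W = f \<otimes> 1\<close>. Composition is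
  total, ill-typed composites being junk, and functoriality is required without typing conditions:
  an equation can then be rewritten modulo \<open>comp_assoc\<close> with no side conditions. This is
  consistent since words can be cancelled, so that whiskering does not make arrows composable. The
  inverse braiding is a parameter so that the axioms are invariant under mirroring.
\<close>

locale strict_braided =
  fixes cat :: "'w \<Rightarrow> 'w \<Rightarrow> 'w" (infixl "\<odot>" 70)
    and emp :: 'w
    and Ob :: "'w set"
    and H :: "'w \<Rightarrow> 'w \<Rightarrow> 'f set"
    and Id :: "'w \<Rightarrow> 'f"
    and comp :: "'f \<Rightarrow> 'f \<Rightarrow> 'f" (infixr "\<bullet>" 55)
    and lw :: "'w \<Rightarrow> 'f \<Rightarrow> 'f" (infixr "\<lhd>" 75)
    and rw :: "'f \<Rightarrow> 'w \<Rightarrow> 'f" (infixl "\<rhd>" 75)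
    and B Bi :: "'w \<Rightarrow> 'w \<Rightarrow> 'f"
  assumes cat_assoc: "(X \<odot> Y) \<odot> Z = X \<odot> (Y \<odot> Z)"
    and emp_cat: "emp \<odot> X = X"
    and cat_emp: "X \<odot> emp = X"
    and emp_Ob: "emp \<in> Ob"
    and cat_Ob: "X \<in> Ob \<Longrightarrow> Y \<in> Ob \<Longrightarrow> X \<odot> Y \<in> Ob"
    and H_Ob: "f \<in> H X Y \<Longrightarrow> X \<in> Ob \<and> Y \<in> Ob"
    and Id_in: "X \<in> Ob \<Longrightarrow> Id X \<in> H X X"
    and comp_in: "f \<in> H X Y \<Longrightarrow> g \<in> H Y Z \<Longrightarrow> g \<bullet> f \<in> H X Z"
    and comp_assoc: "(h \<bullet> g) \<bullet> f = h \<bullet> (g \<bullet> f)"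
    and Id_comp: "f \<in> H X Y \<Longrightarrow> Id Y \<bullet> f = f"
    and comp_Id: "f \<in> H X Y \<Longrightarrow> f \<bullet> Id X = f"
    and lw_in: "f \<in> H X Y \<Longrightarrow> W \<in> Ob \<Longrightarrow> W \<lhd> f \<in> H (W \<odot> X) (W \<odot> Y)"
    and rw_in: "f \<in> H X Y \<Longrightarrow> W \<in> Ob \<Longrightarrow> f \<rhd> W \<in> H (X \<odot> W) (Y \<odot> W)"
    and lw_Id: "W \<in> Ob \<Longrightarrow> X \<in> Ob \<Longrightarrow> W \<lhd> Id X = Id (W \<odot> X)"
    and rw_Id: "W \<in> Ob \<Longrightarrow> X \<in> Ob \<Longrightarrow> Id X \<rhd> W = Id (X \<odot> W)"
    and lw_comp: "W \<lhd> (g \<bullet> f) = (W \<lhd> g) \<bullet> (W \<lhd> f)"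
    and rw_comp: "(g \<bullet> f) \<rhd> W = (g \<rhd> W) \<bullet> (f \<rhd> W)"
    and lw_lw: "V \<lhd> (W \<lhd> f) = (V \<odot> W) \<lhd> f"
    and rw_rw: "(f \<rhd> V) \<rhd> W = f \<rhd> (V \<odot> W)"
    and lw_rw: "V \<lhd> (f \<rhd> W) = (V \<lhd> f) \<rhd> W"
    and emp_lw: "f \<in> H X Y \<Longrightarrow> emp \<lhd> f = f"
    and rw_emp: "f \<in> H X Y \<Longrightarrow> f \<rhd> emp = f"
    and interchange: "f \<in> H X Y \<Longrightarrow> g \<in> H U V \<Longrightarrow>
      (f \<rhd> V) \<bullet> (X \<lhd> g) = (Y \<lhd> g) \<bullet> (f \<rhd> U)"
    and B_in: "X \<in> Ob \<Longrightarrow> Y \<in> Ob \<Longrightarrow> B X Y \<in> H (X \<odot> Y) (Y \<odot> X)"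
    and Bi_in: "X \<in> Ob \<Longrightarrow> Y \<in> Ob \<Longrightarrow> Bi X Y \<in> H (Y \<odot> X) (X \<odot> Y)"
    and B_Bi: "X \<in> Ob \<Longrightarrow> Y \<in> Ob \<Longrightarrow> B X Y \<bullet> Bi X Y = Id (Y \<odot> X)"
    and Bi_B: "X \<in> Ob \<Longrightarrow> Y \<in> Ob \<Longrightarrow> Bi X Y \<bullet> B X Y = Id (X \<odot> Y)"
    and B_nat_l: "f \<in> H X Y \<Longrightarrow> Z \<in> Ob \<Longrightarrow> B Y Z \<bullet> (f \<rhd> Z) = (Z \<lhd> f) \<bullet> B X Z"
    and B_nat_r: "f \<in> H X Y \<Longrightarrow> Z \<in> Ob \<Longrightarrow> B Z Y \<bullet> (Z \<lhd> f) = (f \<rhd> Z) \<bullet> B Z X"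
    and B_cat_r: "X \<in> Ob \<Longrightarrow> Y \<in> Ob \<Longrightarrow> Z \<in> Ob \<Longrightarrow>
      B X (Y \<odot> Z) = (Y \<lhd> B X Z) \<bullet> (B X Y \<rhd> Z)"
    and B_cat_l: "X \<in> Ob \<Longrightarrow> Y \<in> Ob \<Longrightarrow> Z \<in> Ob \<Longrightarrow>
      B (X \<odot> Y) Z = (B X Z \<rhd> Y) \<bullet> (X \<lhd> B Y Z)"
begin

lemma cancel: "g \<bullet> h = Id Y \<Longrightarrow> f \<in> H X Y \<Longrightarrow> g \<bullet> h \<bullet> f = f"
  by (metis comp_assoc Id_comp)

lemma inverse_unique:
  assumes "g \<in> H Y X" "f \<in> H X Y" "h \<in> H Y X" "g \<bullet> f = Id X" "f \<bullet> h = Id Y"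
  shows "g = h"
  using assms by (metis comp_assoc Id_comp comp_Id)

lemma inverse_comp:
  assumes f: "f \<in> H X Y" "f' \<in> H Y X" "f' \<bullet> f = Id X" "f \<bullet> f' = Id Y"
    and g: "g \<in> H Y Z" "g' \<in> H Z Y" "g \<bullet> g' = Id Z"
    and h: "h \<in> H Z X" "h \<bullet> (g \<bullet> f) = Id X"
  shows "h = f' \<bullet> g'"
proof (rule inverse_unique[OF h(1) comp_in[OF f(1) g(1)] comp_in[OF g(2) f(2)] h(2)])
  show "(g \<bullet> f) \<bullet> f' \<bullet> g' = Id Z"
    using cancel[OF f(4) g(2)] g(3) by (simp add: comp_assoc)
qed

lemma whiskered_B:
  assumes "X \<in> Ob" "Y \<in> Ob" "Z \<in> Ob"
  shows "B X Y \<rhd> Z \<in> H (X \<odot> Y \<odot> Z) (Y \<odot> X \<odot> Z)" "Bi X Y \<rhd> Z \<in> H (Y \<odot> X \<odot> Z) (X \<odot> Y \<odot> Z)"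
    "(Bi X Y \<rhd> Z) \<bullet> (B X Y \<rhd> Z) = Id (X \<odot> Y \<odot> Z)" "(B X Y \<rhd> Z) \<bullet> (Bi X Y \<rhd> Z) = Id (Y \<odot> X \<odot> Z)"
    "Z \<lhd> B X Y \<in> H (Z \<odot> X \<odot> Y) (Z \<odot> Y \<odot> X)" "Z \<lhd> Bi X Y \<in> H (Z \<odot> Y \<odot> X) (Z \<odot> X \<odot> Y)"
    "(Z \<lhd> Bi X Y) \<bullet> (Z \<lhd> B X Y) = Id (Z \<odot> X \<odot> Y)" "(Z \<lhd> B X Y) \<bullet> (Z \<lhd> Bi X Y) = Id (Z \<odot> Y \<odot> X)"
  using assms rw_in[OF B_in, of X Y Z] rw_in[OF Bi_in, of X Y Z] lw_in[OF B_in, of X Y Z]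
    lw_in[OF Bi_in, of X Y Z]
  by (simp_all add: rw_comp[symmetric] lw_comp[symmetric] B_Bi Bi_B rw_Id lw_Id cat_Ob cat_assoc)

lemma Bi_cat_r:
  assumes o: "X \<in> Ob" "Y \<in> Ob" "Z \<in> Ob"
  shows "Bi X (Y \<odot> Z) = (Bi X Y \<rhd> Z) \<bullet> (Y \<lhd> Bi X Z)"
  using inverse_comp[OF whiskered_B(1-4)[OF o] whiskered_B(5,6,8)[OF o(1,3,2)], of "Bi X (Y \<odot> Z)"]
    Bi_in[OF o(1) cat_Ob[OF o(2,3)]] Bi_B[OF o(1) cat_Ob[OF o(2,3)]] B_cat_r[OF o]
  by (simp add: cat_assoc)

lemma Bi_cat_l:
  assumes o: "X \<in> Ob" "Y \<in> Ob" "Z \<in> Ob"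
  shows "Bi (X \<odot> Y) Z = (X \<lhd> Bi Y Z) \<bullet> (Bi X Z \<rhd> Y)"
  using inverse_comp[OF whiskered_B(5-8)[OF o(2,3,1)] whiskered_B(1,2,4)[OF o(1,3,2)], of "Bi (X \<odot>
    Y) Z"]
    Bi_in[OF cat_Ob[OF o(1,2)] o(3)] Bi_B[OF cat_Ob[OF o(1,2)] o(3)] B_cat_l[OF o]
  by (simp add: cat_assoc)

lemma conjugate:
  assumes "g \<bullet> f = k \<bullet> h" "f \<in> H X Y" "g \<in> H Y Y'" "h \<in> H X X'" "k \<in> H X' Y'"
    and "i \<bullet> k = Id X'" "f \<bullet> j = Id Y" "j \<in> H Y X" "i \<in> H Y' X'"
  shows "i \<bullet> g = h \<bullet> j"
  by (metis assms comp_assoc Id_comp comp_Id comp_in)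

lemma Bi_nat_l:
  assumes "f \<in> H X Y" "Z \<in> Ob"
  shows "Bi Y Z \<bullet> (Z \<lhd> f) = (f \<rhd> Z) \<bullet> Bi X Z"
proof -
  have o: "X \<in> Ob" "Y \<in> Ob" using H_Ob assms by auto
  note B_nat_l[OF assms, symmetric]
  from conjugate[OF this B_in lw_in rw_in B_in Bi_B B_Bi Bi_in Bi_in] o assms
  show ?thesis by blast
qed

lemma Bi_nat_r:
  assumes "f \<in> H X Y" "Z \<in> Ob"
  shows "Bi Z Y \<bullet> (f \<rhd> Z) = (Z \<lhd> f) \<bullet> Bi Z X"
proof -
  have o: "X \<in> Ob" "Y \<in> Ob" using H_Ob assms by auto
  note B_nat_r[OF assms, symmetric]
  from conjugate[OF this B_in rw_in lw_in B_in Bi_B B_Bi Bi_in Bi_in] o assms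
  show ?thesis by blast
qed

text \<open>
  The hexagon makes \<open>B X emp\<close> idempotent, and it is invertible.
\<close>

lemma B_emp_r: assumes "X \<in> Ob" shows "B X emp = Id X"
proof -
  have b: "B X emp \<in> H X X" "Bi X emp \<in> H X X"
    using B_in[OF assms emp_Ob] Bi_in[OF assms emp_Ob] by (simp_all add: emp_cat cat_emp)
  have i: "B X emp \<bullet> B X emp = B X emp"
    using B_cat_r[OF assms emp_Ob emp_Ob] b by (simp add: emp_cat emp_lw rw_emp)
  have j: "Bi X emp \<bullet> B X emp = Id X"
    using Bi_B[OF assms emp_Ob] by (simp add: cat_emp)
  show ?thesis using cancel[OF j b(1)] i j by simp
qed

lemma Bi_emp_r: "X \<in> Ob \<Longrightarrow> Bi X emp = Id X"
  using Bi_B[OF _ emp_Ob, of X] B_emp_r[of X] Bi_in[OF _ emp_Ob, of X]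
  by (simp add: emp_cat cat_emp comp_Id)

section \<open>Fusion equations and tensor products of actions\<close>

text \<open>
  The arrow \<open>f\<close> acting on \<open>a\<close> and \<open>v\<close> becomes an arrow on \<open>a\<close>, \<open>u\<close> and \<open>v\<close>, with \<open>a\<close> braided past
  \<open>u\<close> and back.
\<close>

definition slide :: "'w \<Rightarrow> 'w \<Rightarrow> 'w \<Rightarrow> 'f \<Rightarrow> 'f" where
  "slide a u v f = (Bi a u \<rhd> v) \<bullet> (u \<lhd> f) \<bullet> (B a u \<rhd> v)"

lemma slide_in:
  assumes "a \<in> Ob" "u \<in> Ob" "v \<in> Ob" "f \<in> H (a \<odot> v) (a \<odot> v)"
  shows "slide a u v f \<in> H (a \<odot> (u \<odot> v)) (a \<odot> (u \<odot> v))"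
proof -
  have "B a u \<rhd> v \<in> H (a \<odot> (u \<odot> v)) (u \<odot> (a \<odot> v))"
     "Bi a u \<rhd> v \<in> H (u \<odot> (a \<odot> v)) (a \<odot> (u \<odot> v))"
    using assms rw_in[OF B_in, of a u v] rw_in[OF Bi_in, of a u v] by (simp_all add: cat_assoc)
  thus ?thesis unfolding slide_def using lw_in[OF assms(4), of u] assms comp_in by blast
qed

lemma slide_rw: "slide a u (v \<odot> x) (f \<rhd> x) = slide a u v f \<rhd> x"
  by (simp add: slide_def rw_comp lw_rw rw_rw)

lemma slide_cat:
  assumes "a \<in> Ob" "u \<in> Ob" "u' \<in> Ob"
  shows "slide a (u \<odot> u') v f = slide a u (u' \<odot> v) (slide a u' v f)"
  using assms
  by (simp add: slide_def B_cat_r Bi_cat_r rw_comp lw_comp comp_assoc lw_rw rw_rw lw_lw)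

lemma slide_emp:
  assumes "a \<in> Ob" "v \<in> Ob" "f \<in> H (a \<odot> v) (a \<odot> v)"
  shows "slide a emp v f = f"
  using assms by (simp add: slide_def B_emp_r Bi_emp_r rw_Id emp_lw[OF assms(3)] Id_comp comp_Id)

lemma slide_comp:
  assumes "a \<in> Ob" "u \<in> Ob" "v \<in> Ob" "f \<in> H (a \<odot> v) (a \<odot> v)" "g \<in> H (a \<odot> v) (a \<odot> v)"
  shows "slide a u v (g \<bullet> f) = slide a u v g \<bullet> slide a u v f"
proof -
  have c: "(B a u \<rhd> v) \<bullet> (Bi a u \<rhd> v) = Id (u \<odot> (a \<odot> v))"
    using assms by (simp add: rw_comp[symmetric] B_Bi rw_Id cat_Ob cat_assoc)
  have "B a u \<rhd> v \<in> H (a \<odot> (u \<odot> v)) (u \<odot> (a \<odot> v))"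
    using assms rw_in[OF B_in, of a u v] by (simp_all add: cat_assoc)
  hence "(u \<lhd> f) \<bullet> (B a u \<rhd> v) \<in> H (a \<odot> (u \<odot> v)) (u \<odot> (a \<odot> v))"
    using lw_in[OF assms(4), of u] assms comp_in by blast
  from cancel[OF c this] show ?thesis by (simp add: slide_def lw_comp comp_assoc)
qed

lemma slide_nat:
  assumes "a \<in> Ob" "v \<in> Ob" "g \<in> H u u'" "f \<in> H (a \<odot> v) (a \<odot> v)"
  shows "((a \<lhd> g) \<rhd> v) \<bullet> slide a u v f = slide a u' v f \<bullet> ((a \<lhd> g) \<rhd> v)"
proof -
  have o: "u \<in> Ob" "u' \<in> Ob" using H_Ob assms by auto
  have "((a \<lhd> g) \<rhd> v) \<bullet> (Bi a u \<rhd> v) = (Bi a u' \<rhd> v) \<bullet> (g \<rhd> (a \<odot> v))"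
    using Bi_nat_r[OF assms(3) assms(1)] by (metis rw_comp rw_rw)
  moreover have "(B a u' \<rhd> v) \<bullet> ((a \<lhd> g) \<rhd> v) = (g \<rhd> (a \<odot> v)) \<bullet> (B a u \<rhd> v)"
    using B_nat_r[OF assms(3) assms(1)] by (metis rw_comp rw_rw)
  moreover note interchange[OF assms(3,4)]
  ultimately show ?thesis unfolding slide_def by (metis comp_assoc)
qed

lemma slide_mor:
  assumes "a \<in> Ob" "u \<in> Ob" "g \<in> H v v'" "(a \<lhd> g) \<bullet> f = f' \<bullet> (a \<lhd> g)"
  shows "((a \<odot> u) \<lhd> g) \<bullet> slide a u v f = slide a u v' f' \<bullet> ((a \<odot> u) \<lhd> g)"
proof -
  have "((a \<odot> u) \<lhd> g) \<bullet> (Bi a u \<rhd> v) = (Bi a u \<rhd> v') \<bullet> ((u \<odot> a) \<lhd> g)"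
    using interchange[OF Bi_in assms(3)] assms by simp
  moreover have "(B a u \<rhd> v') \<bullet> ((a \<odot> u) \<lhd> g) = ((u \<odot> a) \<lhd> g) \<bullet> (B a u \<rhd> v)"
    using interchange[OF B_in assms(3)] assms by simp
  moreover have "((u \<odot> a) \<lhd> g) \<bullet> (u \<lhd> f) = (u \<lhd> f') \<bullet> ((u \<odot> a) \<lhd> g)"
    using assms(4) by (metis lw_comp lw_lw)
  ultimately show ?thesis unfolding slide_def by (metis comp_assoc)
qed

text \<open>
  Sliding only \<open>a\<close> past \<open>u\<close> is the same as sliding both \<open>x\<close> and \<open>a\<close> past \<open>u\<close>, as \<open>f\<close> leaves \<open>x\<close>
  alone. In this form, arrows on \<open>x \<odot> a\<close> pass through by naturality.
\<close>

lemma lw_slide: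
  assumes "x \<in> Ob" "a \<in> Ob" "u \<in> Ob" "v \<in> Ob" "f \<in> H (a \<odot> v) (a \<odot> v)"
  shows "x \<lhd> slide a u v f = (Bi (x \<odot> a) u \<rhd> v) \<bullet> ((u \<odot> x) \<lhd> f) \<bullet> (B (x \<odot> a) u \<rhd> v)"
proof -
  have c: "(Bi x u \<rhd> (a \<odot> v)) \<bullet> (B x u \<rhd> (a \<odot> v)) = Id (x \<odot> u \<odot> (a \<odot> v))"
    using assms by (simp add: rw_comp[symmetric] Bi_B rw_Id cat_Ob)
  have i: "((u \<odot> x) \<lhd> f) \<bullet> (B x u \<rhd> (a \<odot> v)) = (B x u \<rhd> (a \<odot> v)) \<bullet> ((x \<odot> u) \<lhd> f)"
    using interchange[OF B_in assms(5)] assms by simp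
  have "(x \<odot> u) \<lhd> f \<in> H (x \<odot> u \<odot> (a \<odot> v)) (x \<odot> u \<odot> (a \<odot> v))"
    using lw_in[OF assms(5) cat_Ob[OF assms(1,3)]] .
  moreover have "(x \<lhd> B a u) \<rhd> v \<in> H (x \<odot> a \<odot> (u \<odot> v)) (x \<odot> u \<odot> (a \<odot> v))"
    using rw_in[OF lw_in[OF B_in], of a u x v] assms by (simp add: cat_assoc)
  ultimately have "((x \<odot> u) \<lhd> f) \<bullet> ((x \<lhd> B a u) \<rhd> v)
      \<in> H (x \<odot> a \<odot> (u \<odot> v)) (x \<odot> u \<odot> (a \<odot> v))" using comp_in by blast
  note d = cancel[OF c this]
  have "(Bi (x \<odot> a) u \<rhd> v) \<bullet> ((u \<odot> x) \<lhd> f) \<bullet> (B (x \<odot> a) u \<rhd> v)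
     = ((x \<lhd> Bi a u) \<rhd> v) \<bullet> (Bi x u \<rhd> (a \<odot> v)) \<bullet> (((u \<odot> x) \<lhd> f) \<bullet> (B x u \<rhd> (a \<odot> v)))
         \<bullet> ((x \<lhd> B a u) \<rhd> v)"
    using assms by (simp add: B_cat_l Bi_cat_l rw_comp rw_rw comp_assoc)
  also have "\<dots> = ((x \<lhd> Bi a u) \<rhd> v) \<bullet> ((x \<odot> u) \<lhd> f) \<bullet> ((x \<lhd> B a u) \<rhd> v)"
    unfolding i using d by (simp add: comp_assoc)
  also have "\<dots> = x \<lhd> slide a u v f"
    by (simp add: slide_def lw_comp lw_rw lw_lw)
  finally show ?thesis by simp
qed

text \<open>
  The equation of a module over the fusion morphism \<open>t\<close>, whose left hand side conjugates by the
  braiding of \<open>a\<close> with itself, that is, slides one copy of \<open>a\<close> past the other.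
\<close>

definition fusion_law :: "'w \<Rightarrow> 'f \<Rightarrow> 'w \<Rightarrow> 'f \<Rightarrow> bool" where
  "fusion_law a t v q \<longleftrightarrow> (t \<rhd> v) \<bullet> slide a a v q \<bullet> (a \<lhd> q) = (a \<lhd> q) \<bullet> (t \<rhd> v)"

lemma conj_comp:
  assumes "x \<in> Ob" "u \<in> Ob" "v \<in> Ob" "g \<in> H Y (u \<odot> x \<odot> v)"
  shows "(B x u \<rhd> v) \<bullet> (Bi x u \<rhd> v) \<bullet> g = g"
proof -
  have c: "(B x u \<rhd> v) \<bullet> (Bi x u \<rhd> v) = Id (u \<odot> x \<odot> v)"
    using assms by (simp add: rw_comp[symmetric] B_Bi rw_Id cat_Ob)
  from cancel[OF c assms(4)] show ?thesis by simp
qed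

lemma conj_nat:
  assumes "u \<in> Ob" "v \<in> Ob" "s \<in> H x y"
  shows "(s \<rhd> (u \<odot> v)) \<bullet> (Bi x u \<rhd> v) = (Bi y u \<rhd> v) \<bullet> ((u \<lhd> s) \<rhd> v)"
    and "(B y u \<rhd> v) \<bullet> (s \<rhd> (u \<odot> v)) = ((u \<lhd> s) \<rhd> v) \<bullet> (B x u \<rhd> v)"
  using Bi_nat_l[OF assms(3,1)] B_nat_l[OF assms(3,1)] by (metis rw_comp rw_rw)+

lemma comm_slide:
  assumes "a \<in> Ob" "u \<in> Ob" "v \<in> Ob" "f \<in> H (a \<odot> v) (a \<odot> v)" "s \<in> H (a \<odot> a) (a \<odot> a)"
    and comm: "(s \<rhd> v) \<bullet> (a \<lhd> f) = (a \<lhd> f) \<bullet> (s \<rhd> v)"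
  shows "(s \<rhd> (u \<odot> v)) \<bullet> (a \<lhd> slide a u v f) = (a \<lhd> slide a u v f) \<bullet> (s \<rhd> (u \<odot> v))"
proof -
  have "((u \<lhd> s) \<rhd> v) \<bullet> ((u \<odot> a) \<lhd> f) = ((u \<odot> a) \<lhd> f) \<bullet> ((u \<lhd> s) \<rhd> v)"
    using comm by (metis lw_comp lw_lw lw_rw)
  then show ?thesis
    unfolding lw_slide[OF assms(1,1,2,3,4)] using conj_nat[OF assms(2,3,5)] by (metis comp_assoc)
qed

text \<open>
  All three factors of the fusion equation for \<open>slide a u v f\<close> are conjugates by the braiding of
  \<open>a \<odot> a\<close> past \<open>u\<close> of the factors for \<open>f\<close>.
\<close>

lemma fusion_slide:
  assumes o: "a \<in> Ob" "u \<in> Ob" "v \<in> Ob" and f: "f \<in> H (a \<odot> v) (a \<odot> v)"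
    and t: "t \<in> H (a \<odot> a) (a \<odot> a)" and fusion_law: "fusion_law a t v f"
  shows "fusion_law a t (u \<odot> v) (slide a u v f)"
proof -
  let ?b = "B (a \<odot> a) u \<rhd> v" and ?bi = "Bi (a \<odot> a) u \<rhd> v"
  let ?S = "slide a a (u \<odot> v) (slide a u v f)"
  note l = lw_slide[OF o(1) o f]
  have Bn: "?b \<bullet> (B a a \<rhd> (u \<odot> v)) = ((u \<lhd> B a a) \<rhd> v) \<bullet> ?b"
    using conj_nat(2)[OF o(2,3) B_in[OF o(1,1)]] .
  have Bin: "(Bi a a \<rhd> (u \<odot> v)) \<bullet> ?bi = ?bi \<bullet> ((u \<lhd> Bi a a) \<rhd> v)"
    using conj_nat(1)[OF o(2,3) Bi_in[OF o(1,1)]] .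
  have "?S = ((Bi a a \<rhd> (u \<odot> v)) \<bullet> ?bi) \<bullet> ((u \<odot> a) \<lhd> f) \<bullet> ?b \<bullet> (B a a \<rhd> (u \<odot> v))"
    unfolding slide_def[of a a] l by (simp only: comp_assoc)
  also have "\<dots> = ?bi \<bullet> ((u \<lhd> Bi a a) \<rhd> v) \<bullet> ((u \<odot> a) \<lhd> f) \<bullet> ((u \<lhd> B a a) \<rhd> v) \<bullet> ?b"
    unfolding Bn Bin by (simp only: comp_assoc)
  also have "\<dots> = ?bi \<bullet> (u \<lhd> slide a a v f) \<bullet> ?b"
    by (simp add: slide_def lw_comp lw_rw lw_lw comp_assoc)
  finally have S: "?S = ?bi \<bullet> (u \<lhd> slide a a v f) \<bullet> ?b" .
  have T: "(t \<rhd> (u \<odot> v)) \<bullet> ?bi = ?bi \<bullet> ((u \<lhd> t) \<rhd> v)"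
     "?b \<bullet> (t \<rhd> (u \<odot> v)) = ((u \<lhd> t) \<rhd> v) \<bullet> ?b"
    using conj_nat[OF o(2,3) t] .
  have b: "?b \<in> H (a \<odot> a \<odot> u \<odot> v) (u \<odot> (a \<odot> a) \<odot> v)"
    using rw_in[OF B_in[OF cat_Ob[OF o(1,1)] o(2)] o(3)] .
  have "(u \<odot> a) \<lhd> f \<in> H (u \<odot> (a \<odot> a) \<odot> v) (u \<odot> (a \<odot> a) \<odot> v)"
    using lw_in[OF f, of "u \<odot> a"] o by (simp add: cat_Ob cat_assoc)
  from comp_in[OF b this]
  have c: "?b \<bullet> ?bi \<bullet> ((u \<odot> a) \<lhd> f) \<bullet> ?b = ((u \<odot> a) \<lhd> f) \<bullet> ?b"
    using conj_comp o cat_Ob by blast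
  have u: "((u \<lhd> t) \<rhd> v) \<bullet> (u \<lhd> slide a a v f) \<bullet> ((u \<odot> a) \<lhd> f)
      = ((u \<odot> a) \<lhd> f) \<bullet> ((u \<lhd> t) \<rhd> v)"
    using fusion_law unfolding fusion_law_def by (metis lw_comp lw_lw lw_rw)
  have "(t \<rhd> (u \<odot> v)) \<bullet> ?S \<bullet> (a \<lhd> slide a u v f)
     = ((t \<rhd> (u \<odot> v)) \<bullet> ?bi) \<bullet> (u \<lhd> slide a a v f) \<bullet> ?b \<bullet> ?bi \<bullet> ((u \<odot> a) \<lhd> f) \<bullet> ?b"
    unfolding S l by (simp only: comp_assoc)
  also have "\<dots> = ?bi \<bullet> (((u \<lhd> t) \<rhd> v) \<bullet> (u \<lhd> slide a a v f) \<bullet> ((u \<odot> a) \<lhd> f)) \<bullet> ?b"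
    unfolding c T by (simp only: comp_assoc)
  also have "\<dots> = ?bi \<bullet> ((u \<odot> a) \<lhd> f) \<bullet> ?b \<bullet> (t \<rhd> (u \<odot> v))"
    unfolding u T by (simp only: comp_assoc)
  also have "\<dots> = (a \<lhd> slide a u v f) \<bullet> (t \<rhd> (u \<odot> v))"
    unfolding l by (simp only: comp_assoc)
  finally show ?thesis unfolding fusion_law_def .
qed

text \<open>
  The diagonal action \<open>a \<otimes> x \<otimes> y \<mapsto> a1 \<otimes> a2 x \<otimes> a3 y\<close>.
\<close>

definition tens :: "'w \<Rightarrow> 'w \<Rightarrow> 'f \<Rightarrow> 'w \<Rightarrow> 'f \<Rightarrow> 'f" where
  "tens a w q v p = (q \<rhd> v) \<bullet> slide a w v p"

lemma tens_in:
  assumes "a \<in> Ob" "w \<in> Ob" "v \<in> Ob" "q \<in> H (a \<odot> w) (a \<odot> w)" "p \<in> H (a \<odot> v) (a \<odot> v)"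
  shows "tens a w q v p \<in> H (a \<odot> (w \<odot> v)) (a \<odot> (w \<odot> v))"
  unfolding tens_def using slide_in[OF assms(1,2,3,5)] rw_in[OF assms(4,3)]
  by (metis comp_in cat_assoc)

text \<open>
  Sliding is multiplicative, so the equation factors into those for \<open>q\<close> and for \<open>slide a w v p\<close>,
  once \<open>q\<close> on one copy of \<open>a\<close> has been moved past the slide of \<open>p\<close> along \<open>a \<odot> w\<close>. That is
  naturality in the word slid over.
\<close>

lemma fusion_tens:
  assumes o: "a \<in> Ob" "w \<in> Ob" "v \<in> Ob"
    and q: "q \<in> H (a \<odot> w) (a \<odot> w)" and p: "p \<in> H (a \<odot> v) (a \<odot> v)"
    and t: "t \<in> H (a \<odot> a) (a \<odot> a)" and fq: "fusion_law a t w q" and fp: "fusion_law a t v p"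
  shows "fusion_law a t (w \<odot> v) (tens a w q v p)"
proof -
  let ?s = "slide a w v p" and ?T = "t \<rhd> (w \<odot> v)"
  have qv: "q \<rhd> v \<in> H (a \<odot> (w \<odot> v)) (a \<odot> (w \<odot> v))"
    using rw_in[OF q o(3)] by (simp add: cat_assoc)
  have S: "slide a a (w \<odot> v) (tens a w q v p) = (slide a a w q \<rhd> v) \<bullet> slide a (a \<odot> w) v p"
    unfolding tens_def using slide_comp[OF o(1,1) cat_Ob[OF o(2,3)] slide_in[OF o p] qv] slide_rw
      slide_cat o
    by simp
  \<comment> \<open>Here \<open>p\<close> slides over the second \<open>a\<close> together with \<open>w\<close>, so \<open>q\<close> on these two passes through.\<close>
  have c: "slide a (a \<odot> w) v p \<bullet> ((a \<lhd> q) \<rhd> v) = ((a \<lhd> q) \<rhd> v) \<bullet> slide a (a \<odot> w) v p"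
    using slide_nat[OF o(1,3) q p] by simp
  have fq': "?T \<bullet> (slide a a w q \<rhd> v) \<bullet> ((a \<lhd> q) \<rhd> v) = ((a \<lhd> q) \<rhd> v) \<bullet> ?T"
    using fq unfolding fusion_law_def by (metis rw_comp rw_rw)
  have fp': "?T \<bullet> slide a (a \<odot> w) v p \<bullet> (a \<lhd> ?s) = (a \<lhd> ?s) \<bullet> ?T"
    using fusion_slide[OF o p t fp] o unfolding fusion_law_def by (simp add: slide_cat)
  have "?T \<bullet> slide a a (w \<odot> v) (tens a w q v p) \<bullet> (a \<lhd> tens a w q v p)
     = ?T \<bullet> (slide a a w q \<rhd> v) \<bullet> (slide a (a \<odot> w) v p \<bullet> ((a \<lhd> q) \<rhd> v)) \<bullet> (a \<lhd> ?s)"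
    unfolding S by (simp only: tens_def lw_comp lw_rw comp_assoc)
  also have "\<dots> = (?T \<bullet> (slide a a w q \<rhd> v) \<bullet> ((a \<lhd> q) \<rhd> v)) \<bullet> slide a (a \<odot> w) v p \<bullet> (a \<lhd> ?s)"
    unfolding c by (simp only: comp_assoc)
  also have "\<dots> = ((a \<lhd> q) \<rhd> v) \<bullet> (?T \<bullet> slide a (a \<odot> w) v p \<bullet> (a \<lhd> ?s))"
    unfolding fq' by (simp only: comp_assoc)
  also have "\<dots> = (a \<lhd> tens a w q v p) \<bullet> ?T"
    unfolding fp' by (simp only: tens_def lw_comp lw_rw comp_assoc)
  finally show ?thesis unfolding fusion_law_def .
qed

lemma comm_tens:
  assumes o: "a \<in> Ob" "w \<in> Ob" "v \<in> Ob"
    and q: "q \<in> H (a \<odot> w) (a \<odot> w)" and p: "p \<in> H (a \<odot> v) (a \<odot> v)"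
    and s: "s \<in> H (a \<odot> a) (a \<odot> a)"
    and cq: "(s \<rhd> w) \<bullet> (a \<lhd> q) = (a \<lhd> q) \<bullet> (s \<rhd> w)"
    and cp: "(s \<rhd> v) \<bullet> (a \<lhd> p) = (a \<lhd> p) \<bullet> (s \<rhd> v)"
  shows "(s \<rhd> (w \<odot> v)) \<bullet> (a \<lhd> tens a w q v p) = (a \<lhd> tens a w q v p) \<bullet> (s \<rhd> (w \<odot> v))"
proof -
  have "(s \<rhd> (w \<odot> v)) \<bullet> ((a \<lhd> q) \<rhd> v) = ((a \<lhd> q) \<rhd> v) \<bullet> (s \<rhd> (w \<odot> v))"
    using cq by (metis rw_comp rw_rw)
  with comm_slide[OF o p s cp] show ?thesis
    unfolding tens_def lw_comp lw_rw by (metis comp_assoc)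
qed

lemma tens_assoc:
  assumes o: "a \<in> Ob" "w \<in> Ob" "w' \<in> Ob" "v \<in> Ob"
    and q: "q \<in> H (a \<odot> w) (a \<odot> w)" and p: "p \<in> H (a \<odot> w') (a \<odot> w')"
    and r: "r \<in> H (a \<odot> v) (a \<odot> v)"
  shows "tens a (w \<odot> w') (tens a w q w' p) v r = tens a w q (w' \<odot> v) (tens a w' p v r)"
proof -
  have "p \<rhd> v \<in> H (a \<odot> (w' \<odot> v)) (a \<odot> (w' \<odot> v))"
    using rw_in[OF p o(4)] by (simp add: cat_assoc)
  note slide_comp[OF o(1,2) cat_Ob[OF o(3,4)] slide_in[OF o(1,3,4) r] this]
  then show ?thesis
    unfolding tens_def using o by (simp add: rw_comp slide_rw rw_rw slide_cat comp_assoc)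
qed

lemma tens_emp_l:
  assumes "a \<in> Ob" "v \<in> Ob" "p \<in> H (a \<odot> v) (a \<odot> v)"
  shows "tens a emp (Id a) v p = p"
  using assms by (simp add: tens_def slide_emp rw_Id Id_comp)

lemma tens_emp_r:
  assumes "a \<in> Ob" "w \<in> Ob" "q \<in> H (a \<odot> w) (a \<odot> w)"
  shows "tens a w q emp (Id a) = q"
  using assms rw_in[OF B_in, of a w emp] rw_in[OF Bi_in, of a w emp]
  by (simp add: tens_def slide_def rw_emp[OF assms(3)] lw_Id Id_comp rw_comp[symmetric]
      Bi_B rw_Id cat_Ob cat_emp emp_Ob comp_Id rw_emp[OF B_in] rw_emp[OF Bi_in] Id_comp[OF B_in])

lemma tens_mor_l:
  assumes o: "a \<in> Ob" "v \<in> Ob" and f: "f \<in> H w w'"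
    and p: "p \<in> H (a \<odot> v) (a \<odot> v)"
    and m: "(a \<lhd> f) \<bullet> q = q' \<bullet> (a \<lhd> f)"
  shows "(a \<lhd> (f \<rhd> v)) \<bullet> tens a w q v p = tens a w' q' v p \<bullet> (a \<lhd> (f \<rhd> v))"
proof -
  have "((a \<lhd> f) \<rhd> v) \<bullet> (q \<rhd> v) = (q' \<rhd> v) \<bullet> ((a \<lhd> f) \<rhd> v)"
    using m by (metis rw_comp)
  with slide_nat[OF o f p] show ?thesis unfolding tens_def lw_rw by (metis comp_assoc)
qed

lemma tens_mor_r:
  assumes o: "a \<in> Ob" "w \<in> Ob" and q: "q \<in> H (a \<odot> w) (a \<odot> w)" and g: "g \<in> H v v'"
    and m: "(a \<lhd> g) \<bullet> p = p' \<bullet> (a \<lhd> g)"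
  shows "(a \<lhd> (w \<lhd> g)) \<bullet> tens a w q v p = tens a w q v' p' \<bullet> (a \<lhd> (w \<lhd> g))"
  using interchange[OF q g] slide_mor[OF o g m] unfolding tens_def lw_lw by (metis comp_assoc)

definition act :: "'f \<Rightarrow> 'w \<Rightarrow> 'f \<Rightarrow> 'f" where
  "act c v q = (c \<rhd> v) \<bullet> q"

lemma act_in:
  assumes "c \<in> H a emp" "v \<in> Ob" "q \<in> H (a \<odot> v) (a \<odot> v)"
  shows "act c v q \<in> H (a \<odot> v) v"
  unfolding act_def using rw_in[OF assms(1,2)] assms by (metis comp_in emp_cat)

text \<open>
  Applying the counit in the middle turns the fusion equation into \<open>a1 \<otimes> a2 (b x) = a1 \<otimes> (a2 b)
  x\<close>.
\<close>

lemma act_fusion: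
  assumes o: "a \<in> Ob" "v \<in> Ob" and c: "c \<in> H a emp"
    and q: "q \<in> H (a \<odot> v) (a \<odot> v)" and f: "fusion_law a t v q"
    and counit: "(a \<lhd> c) \<bullet> t = a \<lhd> c"
  shows "q \<bullet> (a \<lhd> act c v q) = (a \<lhd> act c v q) \<bullet> (t \<rhd> v)"
proof -
  have "((a \<lhd> c) \<rhd> v) \<bullet> slide a a v q = q \<bullet> ((a \<lhd> c) \<rhd> v)"
    using slide_nat[OF o c q] slide_emp[OF o q] by simp
  moreover have "((a \<lhd> c) \<rhd> v) \<bullet> (t \<rhd> v) = (a \<lhd> c) \<rhd> v"
    using counit by (metis rw_comp)
  ultimately show ?thesis using f unfolding fusion_law_def act_def lw_comp lw_rw by (metis
    comp_assoc)
qed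

lemma act_assoc:
  assumes o: "a \<in> Ob" "v \<in> Ob" and c: "c \<in> H a emp"
    and q: "q \<in> H (a \<odot> v) (a \<odot> v)" and f: "fusion_law a t v q"
    and counit: "(a \<lhd> c) \<bullet> t = a \<lhd> c"
  shows "act c v q \<bullet> (a \<lhd> act c v q) = act c v q \<bullet> (((c \<rhd> a) \<bullet> t) \<rhd> v)"
proof -
  have ai: "act c v q \<in> H (a \<odot> v) v" using act_in o c q by blast
  have "(c \<rhd> v) \<bullet> (a \<lhd> act c v q) = act c v q \<bullet> (c \<rhd> (a \<odot> v))"
    using interchange[OF c ai] emp_lw[OF ai] by simp
  moreover have "act c v q \<bullet> (a \<lhd> act c v q) = (c \<rhd> v) \<bullet> (a \<lhd> act c v q) \<bullet> (t \<rhd> v)"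
    using act_fusion[OF assms] by (simp add: act_def comp_assoc)
  ultimately show ?thesis by (metis comp_assoc rw_comp rw_rw)
qed

definition splits :: "'w \<Rightarrow> 'w \<Rightarrow> 'f \<Rightarrow> bool" where
  "splits X Y f \<longleftrightarrow> f \<in> H X Y \<and> (\<exists>s \<in> H Y X. f \<bullet> s = Id Y)"

lemma splits_comp: assumes "splits X Y f" "splits Y Z g" shows "splits X Z (g \<bullet> f)"
proof -
  obtain r s where r: "r \<in> H Y X" "f \<bullet> r = Id Y" and s: "s \<in> H Z Y" "g \<bullet> s = Id Z"
    using assms by (auto simp: splits_def)
  have "(g \<bullet> f) \<bullet> (r \<bullet> s) = Id Z"
    using r s cancel[OF r(2) s(1)] by (simp add: comp_assoc)
  thus ?thesis using assms r s comp_in unfolding splits_def by blast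
qed

lemma splits_cancel:
  assumes "splits X Z (g \<bullet> f)" "f \<in> H X Y" "g \<in> H Y Z" shows "splits Y Z g"
  using assms unfolding splits_def by (metis comp_assoc comp_in)

lemma splits_lw: "splits X Y f \<Longrightarrow> W \<in> Ob \<Longrightarrow> splits (W \<odot> X) (W \<odot> Y) (W \<lhd> f)"
  unfolding splits_def by (metis lw_comp lw_in lw_Id H_Ob)

lemma splits_rw: "splits X Y f \<Longrightarrow> W \<in> Ob \<Longrightarrow> splits (X \<odot> W) (Y \<odot> W) (f \<rhd> W)"
  unfolding splits_def by (metis rw_comp rw_in rw_Id H_Ob)

lemma splits_iso:
  assumes "f \<in> H X Y" "g \<in> H Y X" "f \<bullet> g = Id Y" shows "splits X Y f"
  using assms unfolding splits_def by blast

lemma splits_right_cancel: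
  assumes "splits X Y f" "g \<in> H Y Z" "h \<in> H Y Z" "g \<bullet> f = h \<bullet> f" shows "g = h"
  using assms unfolding splits_def by (metis comp_assoc comp_Id)

end

text \<open>
  Reversing all words and exchanging the braiding with its inverse gives the same kind of
  structure, so every fact about left actions has a mirror image about right actions. The separate
  locale keeps the mirror image from being mirrored again.
\<close>

locale two_sided = strict_braided
begin

sublocale mirror: strict_braided "\<lambda>X Y. Y \<odot> X" emp Ob H Id comp "\<lambda>W f. f \<rhd> W" "\<lambda>f W. W \<lhd> f" Bi B
  by unfold_locales (simp_all add: cat_assoc emp_cat cat_emp emp_Ob cat_Ob Id_in comp_in comp_assoc
    Id_comp comp_Id lw_in rw_in lw_Id rw_Id lw_comp rw_comp lw_lw rw_rw lw_rw emp_lw rw_emp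
    interchange B_in Bi_in B_Bi Bi_B Bi_nat_l Bi_nat_r Bi_cat_l Bi_cat_r H_Ob)

end

section \<open>Modules over a regular multiplier bimonoid, strictly\<close>

context strict_braided
begin

text \<open>
  Conditions on an action pass along a split epimorphism \<open>i\<close> that preserves the action, since \<open>i\<close>
  whiskered by a word is again a split epimorphism and can be cancelled on the right.
\<close>

lemma fusion_quotient:
  assumes a: "a \<in> Ob" and t: "t \<in> H (a \<odot> a) (a \<odot> a)" and i: "splits w w' i"
    and q: "q \<in> H (a \<odot> w) (a \<odot> w)" and q': "q' \<in> H (a \<odot> w') (a \<odot> w')"
    and m: "(a \<lhd> i) \<bullet> q = q' \<bullet> (a \<lhd> i)" and f: "fusion_law a t w q"
  shows "fusion_law a t w' q'"
proof -
  have ih: "i \<in> H w w'" and o: "w \<in> Ob" "w' \<in> Ob" using i H_Ob by (auto simp: splits_def)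
  let ?i = "(a \<odot> a) \<lhd> i"
  have t': "(t \<rhd> w') \<bullet> ?i = ?i \<bullet> (t \<rhd> w)" using interchange[OF t ih] .
  have s: "?i \<bullet> slide a a w q = slide a a w' q' \<bullet> ?i" using slide_mor[OF a a ih m] .
  have l: "?i \<bullet> (a \<lhd> q) = (a \<lhd> q') \<bullet> ?i" using m by (metis lw_comp lw_lw)
  have e: "((t \<rhd> w') \<bullet> slide a a w' q' \<bullet> (a \<lhd> q')) \<bullet> ?i = ((a \<lhd> q') \<bullet> (t \<rhd> w')) \<bullet> ?i"
    using f t' s l unfolding fusion_law_def by (metis comp_assoc)
  have h: "t \<rhd> w' \<in> H (a \<odot> a \<odot> w') (a \<odot> a \<odot> w')"
    "slide a a w' q' \<in> H (a \<odot> a \<odot> w') (a \<odot> a \<odot> w')"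
    "a \<lhd> q' \<in> H (a \<odot> a \<odot> w') (a \<odot> a \<odot> w')"
    using rw_in[OF t o(2)] slide_in[OF a a o(2) q'] lw_in[OF q' a] by (simp_all add: cat_assoc)
  show ?thesis
    unfolding fusion_law_def
    using splits_right_cancel[OF splits_lw[OF i] _ _ e] h a comp_in cat_Ob by blast
qed

lemma comm_quotient:
  assumes a: "a \<in> Ob" and s: "s \<in> H (a \<odot> a) (a \<odot> a)" and i: "splits w w' i"
    and q': "q' \<in> H (a \<odot> w') (a \<odot> w')"
    and m: "(a \<lhd> i) \<bullet> q = q' \<bullet> (a \<lhd> i)"
    and f: "(s \<rhd> w) \<bullet> (a \<lhd> q) = (a \<lhd> q) \<bullet> (s \<rhd> w)"
  shows "(s \<rhd> w') \<bullet> (a \<lhd> q') = (a \<lhd> q') \<bullet> (s \<rhd> w')"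
proof -
  have ih: "i \<in> H w w'" and o: "w \<in> Ob" "w' \<in> Ob" using i H_Ob by (auto simp: splits_def)
  let ?i = "(a \<odot> a) \<lhd> i"
  have s': "(s \<rhd> w') \<bullet> ?i = ?i \<bullet> (s \<rhd> w)" using interchange[OF s ih] .
  have l: "?i \<bullet> (a \<lhd> q) = (a \<lhd> q') \<bullet> ?i" using m by (metis lw_comp lw_lw)
  have e: "((s \<rhd> w') \<bullet> (a \<lhd> q')) \<bullet> ?i = ((a \<lhd> q') \<bullet> (s \<rhd> w')) \<bullet> ?i"
    using f s' l by (metis comp_assoc)
  have h: "s \<rhd> w' \<in> H (a \<odot> a \<odot> w') (a \<odot> a \<odot> w')"
    "a \<lhd> q' \<in> H (a \<odot> a \<odot> w') (a \<odot> a \<odot> w')"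
    using rw_in[OF s o(2)] lw_in[OF q' a] by (simp_all add: cat_assoc)
  show ?thesis
    using splits_right_cancel[OF splits_lw[OF i] _ _ e] h a comp_in cat_Ob by blast
qed

lemma act_mor:
  assumes c: "c \<in> H a emp" and i: "i \<in> H w w'" and m: "(a \<lhd> i) \<bullet> q = q' \<bullet> (a \<lhd> i)"
  shows "act c w' q' \<bullet> (a \<lhd> i) = i \<bullet> act c w q"
  using interchange[OF c i] emp_lw[OF i] m unfolding act_def by (metis comp_assoc)

end

text \<open>
  The part of a regular multiplier bimonoid that acts on modules. \<open>opposite_mult\<close> says that \<open>t4\<close>
  induces the opposite of the multiplication induced by \<open>t1\<close>, and \<open>diagonal_splits\<close> concerns the
  arrow \<open>a \<otimes> b \<otimes> c \<mapsto> b1 a \<otimes> b2 c\<close>.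
\<close>

locale multiplier_actions = two_sided +
  fixes a and t1 t4 c
  assumes a: "a \<in> Ob"
    and t1: "t1 \<in> H (a \<odot> a) (a \<odot> a)" and t4: "t4 \<in> H (a \<odot> a) (a \<odot> a)"
    and c: "c \<in> H a emp"
    and counit1: "(a \<lhd> c) \<bullet> t1 = a \<lhd> c"
    and counit4: "(c \<rhd> a) \<bullet> t4 = c \<rhd> a"
    and opposite_mult: "(a \<lhd> c) \<bullet> t4 = ((c \<rhd> a) \<bullet> t1) \<bullet> Bi a a"
    and c_splits: "splits a emp c"
    and diagonal_splits: "splits (a \<odot> a \<odot> a) (a \<odot> a)
      ((((c \<rhd> a) \<bullet> t1) \<rhd> a) \<bullet> (Bi a a \<rhd> a) \<bullet> (a \<lhd> t1))"
begin

definition regmod where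
  "regmod w q1 q4 \<longleftrightarrow> w \<in> Ob \<and> q1 \<in> H (a \<odot> w) (a \<odot> w) \<and> q4 \<in> H (w \<odot> a) (w \<odot> a) \<and>
     fusion_law a t1 w q1 \<and> mirror.fusion_law a t4 w q4 \<and>
     (t4 \<rhd> w) \<bullet> (a \<lhd> q1) = (a \<lhd> q1) \<bullet> (t4 \<rhd> w) \<and>
     (w \<lhd> t1) \<bullet> (q4 \<rhd> a) = (q4 \<rhd> a) \<bullet> (w \<lhd> t1) \<and>
     act c w q1 = mirror.act c w q4 \<bullet> B a w \<and>
     splits (a \<odot> w) w (act c w q1)"

definition mor where
  "mor f q1 q4 p1 p4 \<longleftrightarrow> (a \<lhd> f) \<bullet> q1 = p1 \<bullet> (a \<lhd> f) \<and> (f \<rhd> a) \<bullet> q4 = p4 \<bullet> (f \<rhd> a)"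

lemma regmodD:
  assumes "regmod w q1 q4"
  shows "w \<in> Ob" "q1 \<in> H (a \<odot> w) (a \<odot> w)" "q4 \<in> H (w \<odot> a) (w \<odot> a)"
    "fusion_law a t1 w q1" "mirror.fusion_law a t4 w q4"
    "(t4 \<rhd> w) \<bullet> (a \<lhd> q1) = (a \<lhd> q1) \<bullet> (t4 \<rhd> w)"
    "(w \<lhd> t1) \<bullet> (q4 \<rhd> a) = (q4 \<rhd> a) \<bullet> (w \<lhd> t1)"
    "act c w q1 = mirror.act c w q4 \<bullet> B a w"
    "splits (a \<odot> w) w (act c w q1)"
  using assms unfolding regmod_def by blast+

lemma ract_in: "regmod w q1 q4 \<Longrightarrow> mirror.act c w q4 \<in> H (w \<odot> a) w"
  using mirror.act_in[OF c] regmodD by blast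

lemma act_Bi:
  assumes "regmod w q1 q4" shows "act c w q1 \<bullet> Bi a w = mirror.act c w q4"
  using regmodD(1,8)[OF assms] B_Bi a ract_in[OF assms] by (simp add: comp_assoc comp_Id)

lemma ract_splits:
  assumes "regmod w q1 q4" shows "splits (w \<odot> a) w (mirror.act c w q4)"
proof -
  have w: "w \<in> Ob" using regmodD(1)[OF assms] .
  have "splits (w \<odot> a) (a \<odot> w) (Bi a w)"
    using splits_iso[OF Bi_in[OF a w] B_in[OF a w] Bi_B[OF a w]] .
  then show ?thesis using splits_comp regmodD(9)[OF assms] act_Bi[OF assms] by metis
qed

lemma ract_t1:
  assumes "regmod w q1 q4"
  shows "(mirror.act c w q4 \<rhd> a) \<bullet> (w \<lhd> t1) = (w \<lhd> ((c \<rhd> a) \<bullet> t1)) \<bullet> (q4 \<rhd> a)"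
  using regmodD(7)[OF assms] unfolding mirror.act_def lw_comp rw_comp lw_rw
  by (metis comp_assoc)

text \<open>
  Both sides are \<open>x \<otimes> a \<otimes> b \<otimes> y \<mapsto> a1 x \<otimes> a2 b y\<close>.
\<close>

lemma ract_act:
  assumes "regmod w q1 q4" and "regmod v p1 p4"
  shows "((mirror.act c w q4 \<rhd> v) \<bullet> (w \<lhd> p1)) \<bullet> ((w \<odot> a) \<lhd> act c v p1)
    = (w \<lhd> act c v p1) \<bullet> (((mirror.act c w q4 \<rhd> a) \<bullet> (w \<lhd> t1)) \<rhd> v)"
proof -
  note Q = regmodD[OF assms(1)] and P = regmodD[OF assms(2)]
  let ?v = "act c v p1" and ?w = "mirror.act c w q4"
  have p: "p1 \<bullet> (a \<lhd> ?v) = (a \<lhd> ?v) \<bullet> (t1 \<rhd> v)"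
    using act_fusion[OF a P(1) c P(2,4) counit1] .
  have i: "(?w \<rhd> v) \<bullet> ((w \<odot> a) \<lhd> ?v) = (w \<lhd> ?v) \<bullet> (?w \<rhd> (a \<odot> v))"
    using interchange[OF ract_in[OF assms(1)] act_in[OF c P(1,2)]] .
  have "((?w \<rhd> v) \<bullet> (w \<lhd> p1)) \<bullet> ((w \<odot> a) \<lhd> ?v) = (?w \<rhd> v) \<bullet> (w \<lhd> (p1 \<bullet> (a \<lhd> ?v)))"
    by (simp only: comp_assoc lw_comp lw_lw)
  also have "\<dots> = ((?w \<rhd> v) \<bullet> ((w \<odot> a) \<lhd> ?v)) \<bullet> ((w \<lhd> t1) \<rhd> v)"
    unfolding p by (simp only: comp_assoc lw_comp lw_lw lw_rw)
  also have "\<dots> = (w \<lhd> ?v) \<bullet> (((?w \<rhd> a) \<bullet> (w \<lhd> t1)) \<rhd> v)"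
    unfolding i by (simp only: comp_assoc rw_comp rw_rw)
  finally show ?thesis .
qed

text \<open>
  The two candidates \<open>x \<otimes> a \<otimes> y \<mapsto> a1 x \<otimes> a2 y\<close> for the action on the product coincide. The action
  on \<open>v\<close> splits, so they may be compared on \<open>y = b z\<close>, where \<open>ract_t1\<close> turns one into the other.
\<close>

lemma mixed_actions:
  assumes "regmod w q1 q4" and "regmod v p1 p4"
  shows "(mirror.act c w q4 \<rhd> v) \<bullet> (w \<lhd> p1) = (w \<lhd> act c v p1) \<bullet> (q4 \<rhd> v)"
proof -
  note Q = regmodD[OF assms(1)] and P = regmodD[OF assms(2)]
  let ?v = "act c v p1" and ?w = "mirror.act c w q4"
  have ai: "?v \<in> H (a \<odot> v) v" using act_in[OF c P(1,2)] .
  have i: "(q4 \<rhd> v) \<bullet> ((w \<odot> a) \<lhd> ?v) = ((w \<odot> a) \<lhd> ?v) \<bullet> (q4 \<rhd> (a \<odot> v))"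
    using interchange[OF Q(3) ai] .
  have "((w \<lhd> ?v) \<bullet> (q4 \<rhd> v)) \<bullet> ((w \<odot> a) \<lhd> ?v) = (w \<lhd> (?v \<bullet> (a \<lhd> ?v))) \<bullet> (q4 \<rhd> (a \<odot> v))"
    using i by (simp only: comp_assoc lw_comp lw_lw)
  also have "\<dots> = (w \<lhd> ?v) \<bullet> (((w \<lhd> ((c \<rhd> a) \<bullet> t1)) \<bullet> (q4 \<rhd> a)) \<rhd> v)"
    unfolding act_assoc[OF a P(1) c P(2,4) counit1]
    by (simp only: comp_assoc lw_comp rw_comp rw_rw lw_rw)
  also have "\<dots> = ((?w \<rhd> v) \<bullet> (w \<lhd> p1)) \<bullet> ((w \<odot> a) \<lhd> ?v)"
    unfolding ract_act[OF assms] ract_t1[OF assms(1)] ..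
  finally have e: "((?w \<rhd> v) \<bullet> (w \<lhd> p1)) \<bullet> ((w \<odot> a) \<lhd> ?v)
    = ((w \<lhd> ?v) \<bullet> (q4 \<rhd> v)) \<bullet> ((w \<odot> a) \<lhd> ?v)" by simp
  have 1: "w \<lhd> p1 \<in> H (w \<odot> a \<odot> v) (w \<odot> a \<odot> v)" "w \<lhd> ?v \<in> H (w \<odot> a \<odot> v) (w \<odot> v)"
    using lw_in[OF P(2) Q(1)] lw_in[OF ai Q(1)] by (simp_all add: cat_assoc)
  have 2: "?w \<rhd> v \<in> H (w \<odot> a \<odot> v) (w \<odot> v)" "q4 \<rhd> v \<in> H (w \<odot> a \<odot> v) (w \<odot> a \<odot> v)"
    using rw_in[OF ract_in[OF assms(1)] P(1)] rw_in[OF Q(3) P(1)] by simp_all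
  show ?thesis
    using splits_right_cancel[OF splits_lw[OF P(9), of "w \<odot> a"] _ _ e] 1 2 comp_in cat_Ob a Q(1)
    by blast
qed

lemma act_tens:
  assumes "regmod w q1 q4" and "regmod v p1 p4"
  shows "act c (w \<odot> v) (tens a w q1 v p1)
    = ((mirror.act c w q4 \<rhd> v) \<bullet> (w \<lhd> p1)) \<bullet> (B a w \<rhd> v)"
proof -
  have "act c (w \<odot> v) (tens a w q1 v p1)
    = ((act c w q1 \<bullet> Bi a w) \<rhd> v) \<bullet> (w \<lhd> p1) \<bullet> (B a w \<rhd> v)"
    unfolding act_def tens_def slide_def by (simp only: comp_assoc rw_comp rw_rw)
  then show ?thesis unfolding act_Bi[OF assms(1)] by (simp only: comp_assoc)
qed

lemma ract_tens:
  assumes "regmod w q1 q4" and "regmod v p1 p4"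
  shows "mirror.act c (w \<odot> v) (mirror.tens a v p4 w q4) \<bullet> B a (w \<odot> v)
    = ((w \<lhd> act c v p1) \<bullet> (q4 \<rhd> v)) \<bullet> (B a w \<rhd> v)"
proof -
  note Q = regmodD[OF assms(1)] and P = regmodD[OF assms(2)]
  have c': "(w \<lhd> Bi a v) \<bullet> (w \<lhd> B a v) = Id (w \<odot> a \<odot> v)"
    using a P(1) Q(1) by (simp add: lw_comp[symmetric] Bi_B lw_Id cat_Ob cat_assoc)
  have b: "B a w \<rhd> v \<in> H (a \<odot> w \<odot> v) (w \<odot> a \<odot> v)"
    using rw_in[OF B_in[OF a Q(1)] P(1)] .
  have "mirror.act c (w \<odot> v) (mirror.tens a v p4 w q4) \<bullet> B a (w \<odot> v)
    = (w \<lhd> (mirror.act c v p4 \<bullet> B a v)) \<bullet> (q4 \<rhd> v)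
        \<bullet> (w \<lhd> Bi a v) \<bullet> (w \<lhd> B a v) \<bullet> (B a w \<rhd> v)"
    unfolding mirror.act_def mirror.tens_def mirror.slide_def B_cat_r[OF a Q(1) P(1)]
    by (simp only: comp_assoc lw_comp lw_lw)
  also have "\<dots> = ((w \<lhd> act c v p1) \<bullet> (q4 \<rhd> v)) \<bullet> (B a w \<rhd> v)"
    unfolding cancel[OF c' b] P(8)[symmetric] by (simp only: comp_assoc)
  finally show ?thesis .
qed

text \<open>
  Precomposed with the actions on \<open>w\<close> and \<open>v\<close>, the action on \<open>w \<odot> v\<close> becomes \<open>x \<otimes> a \<otimes> b \<otimes> c \<otimes> y \<mapsto>
  b1 a x \<otimes> b2 c y\<close>. This is the arrow of \<open>diagonal_splits\<close> followed by the two actions, a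
  composite of split epimorphisms, and the last factor of a split epimorphism splits.
\<close>

lemma act_tens_splits:
  assumes "regmod w q1 q4" and "regmod v p1 p4"
  shows "splits (a \<odot> (w \<odot> v)) (w \<odot> v) (act c (w \<odot> v) (tens a w q1 v p1))"
proof -
  note Q = regmodD[OF assms(1)] and P = regmodD[OF assms(2)]
  let ?v = "act c v p1" and ?w = "mirror.act c w q4" and ?m = "(c \<rhd> a) \<bullet> t1"
  let ?d = "(?m \<rhd> a) \<bullet> (Bi a a \<rhd> a) \<bullet> (a \<lhd> t1)"
  let ?g = "(?w \<rhd> v) \<bullet> (w \<lhd> p1)"
  have ai: "?v \<in> H (a \<odot> v) v" using act_in[OF c P(1,2)] .
  note wi = ract_in[OF assms(1)] and ws = ract_splits[OF assms(1)]
  have t: "t1 \<rhd> v \<in> H (a \<odot> a \<odot> v) (a \<odot> a \<odot> v)" using rw_in[OF t1 P(1)] .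
  have i: "(?w \<rhd> (a \<odot> a \<odot> v)) \<bullet> (((w \<odot> a) \<lhd> t1) \<rhd> v) = ((w \<lhd> t1) \<rhd> v) \<bullet> (?w \<rhd> (a \<odot> a \<odot> v))"
    using interchange[OF wi t] by (simp only: lw_rw)
  have ww: "?w \<bullet> (?w \<rhd> a) = ?w \<bullet> (w \<lhd> (?m \<bullet> Bi a a))"
    using mirror.act_assoc[OF a Q(1) c Q(3,5) counit4] opposite_mult by simp
  have "?g \<bullet> (((w \<odot> a) \<lhd> ?v) \<bullet> (?w \<rhd> (a \<odot> a \<odot> v)))
     = (w \<lhd> ?v) \<bullet> (?w \<rhd> (a \<odot> v)) \<bullet> ((w \<lhd> t1) \<rhd> v) \<bullet> (?w \<rhd> (a \<odot> a \<odot> v))"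
    using ract_act[OF assms] by (simp only: comp_assoc[symmetric] rw_comp rw_rw)
  also have "\<dots> = (w \<lhd> ?v) \<bullet> ((?w \<bullet> (?w \<rhd> a)) \<rhd> (a \<odot> v)) \<bullet> (((w \<odot> a) \<lhd> t1) \<rhd> v)"
    unfolding i[symmetric] by (simp only: comp_assoc rw_comp rw_rw cat_assoc)
  also have "\<dots> = (w \<lhd> ?v) \<bullet> (?w \<rhd> (a \<odot> v)) \<bullet> ((w \<lhd> ?d) \<rhd> v)"
    unfolding ww by (simp only: comp_assoc rw_comp lw_comp rw_rw lw_rw lw_lw cat_assoc)
  finally have e: "?g \<bullet> (((w \<odot> a) \<lhd> ?v) \<bullet> (?w \<rhd> (a \<odot> a \<odot> v)))
    = (w \<lhd> ?v) \<bullet> (?w \<rhd> (a \<odot> v)) \<bullet> ((w \<lhd> ?d) \<rhd> v)" .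
  have s1: "splits (w \<odot> a \<odot> v) (w \<odot> v) (w \<lhd> ?v)"
    using splits_lw[OF P(9) Q(1)] by (simp add: cat_assoc)
  have s2: "splits (w \<odot> a \<odot> (a \<odot> v)) (w \<odot> (a \<odot> v)) (?w \<rhd> (a \<odot> v))"
    using splits_rw[OF ws] a P(1) cat_Ob by blast
  have s3: "splits (w \<odot> (a \<odot> a \<odot> a) \<odot> v) (w \<odot> (a \<odot> a) \<odot> v) ((w \<lhd> ?d) \<rhd> v)"
    using splits_rw[OF splits_lw[OF diagonal_splits]] P(1) Q(1) by blast
  have s: "splits (w \<odot> (a \<odot> a \<odot> a) \<odot> v) (w \<odot> v) (?g \<bullet> (((w \<odot> a) \<lhd> ?v) \<bullet> (?w \<rhd> (a \<odot> a \<odot> v))))"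
    unfolding e using splits_comp[OF splits_comp[OF s3] s1] s2 by (simp add: cat_assoc comp_assoc)
  have f: "((w \<odot> a) \<lhd> ?v) \<bullet> (?w \<rhd> (a \<odot> a \<odot> v)) \<in> H (w \<odot> (a \<odot> a \<odot> a) \<odot> v) (w \<odot> a \<odot> v)"
    using comp_in[of "?w \<rhd> (a \<odot> a \<odot> v)" _ "w \<odot> a \<odot> (a \<odot> v)", OF _ lw_in[OF ai, of "w \<odot> a"]]
      rw_in[OF wi, of "a \<odot> a \<odot> v"] a P(1) Q(1) by (simp add: cat_assoc cat_Ob)
  have g: "?g \<in> H (w \<odot> a \<odot> v) (w \<odot> v)"
    using comp_in[OF _ rw_in[OF wi P(1)]] lw_in[OF P(2) Q(1)] by (simp add: cat_assoc)
  have b: "splits (a \<odot> w \<odot> v) (w \<odot> a \<odot> v) (B a w \<rhd> v)"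
    using splits_rw[OF splits_iso[OF B_in Bi_in B_Bi]] a P(1) Q(1) by blast
  show ?thesis
    unfolding act_tens[OF assms] using splits_comp[OF b splits_cancel[OF s f g]]
    by (simp add: cat_assoc)
qed

theorem regmod_tens:
  assumes "regmod w q1 q4" and "regmod v p1 p4"
  shows "regmod (w \<odot> v) (tens a w q1 v p1) (mirror.tens a v p4 w q4)"
proof -
  note Q = regmodD[OF assms(1)] and P = regmodD[OF assms(2)]
  show ?thesis
    unfolding regmod_def
    using cat_Ob[OF Q(1) P(1)] tens_in[OF a Q(1) P(1) Q(2) P(2)]
      mirror.tens_in[OF a P(1) Q(1) P(3) Q(3)]
      fusion_tens[OF a Q(1) P(1) Q(2) P(2) t1 Q(4) P(4)]
      mirror.fusion_tens[OF a P(1) Q(1) P(3) Q(3) t4 P(5) Q(5)]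
      comm_tens[OF a Q(1) P(1) Q(2) P(2) t4 Q(6) P(6)]
      mirror.comm_tens[OF a P(1) Q(1) P(3) Q(3) t1 P(7) Q(7)]
      act_tens_splits[OF assms] act_tens[OF assms] ract_tens[OF assms] mixed_actions[OF assms]
    by simp
qed

theorem regmod_unit: "regmod emp (Id a) (Id a)"
proof -
  have i: "Bi a a \<bullet> B a a = Id (a \<odot> a)" "B a a \<bullet> Bi a a = Id (a \<odot> a)" using Bi_B B_Bi a by auto
  have "fusion_law a t1 emp (Id a)"
    unfolding fusion_law_def slide_def using a t1 i
    by (simp add: lw_Id rw_emp[OF t1] rw_emp[OF B_in] rw_emp[OF Bi_in] Id_comp[OF B_in] Id_comp[OF
      Id_in]
      comp_Id[OF t1] Id_comp[OF t1] cat_Ob)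
  moreover have "mirror.fusion_law a t4 emp (Id a)"
    unfolding mirror.fusion_law_def mirror.slide_def using a t4 i
    by (simp add: rw_Id emp_lw[OF t4] emp_lw[OF B_in] emp_lw[OF Bi_in] Id_comp[OF Bi_in]
      Id_comp[OF Id_in]
      comp_Id[OF t4] Id_comp[OF t4] cat_Ob)
  moreover have "act c emp (Id a) = c" "mirror.act c emp (Id a) = c"
    using c a by (simp_all add: act_def mirror.act_def rw_emp[OF c] emp_lw[OF c] comp_Id)
  ultimately show ?thesis
    unfolding regmod_def using a c c_splits t1 t4
    by (simp add: emp_Ob cat_emp emp_cat Id_in rw_emp[OF t4] emp_lw[OF t1] lw_Id rw_Id Id_comp
      comp_Id B_emp_r)
qed

theorem regmod_quotient:
  assumes r: "regmod w q1 q4" and i: "splits w w' i" and m: "mor i q1 q4 q1' q4'"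
    and q1': "q1' \<in> H (a \<odot> w') (a \<odot> w')" and q4': "q4' \<in> H (w' \<odot> a) (w' \<odot> a)"
  shows "regmod w' q1' q4'"
proof -
  note Q = regmodD[OF r]
  have ih: "i \<in> H w w'" and o: "w' \<in> Ob" using i H_Ob by (auto simp: splits_def)
  have m1: "(a \<lhd> i) \<bullet> q1 = q1' \<bullet> (a \<lhd> i)" and m4: "(i \<rhd> a) \<bullet> q4 = q4' \<bullet> (i \<rhd> a)"
    using m by (auto simp: mor_def)
  have mi: "mirror.splits w w' i" using i unfolding mirror.splits_def splits_def .
  note ae = act_mor[OF c ih m1] and re = mirror.act_mor[OF c ih m4]
  have a': "act c w' q1' \<in> H (a \<odot> w') w'" using act_in[OF c o q1'] .
  have r': "mirror.act c w' q4' \<bullet> B a w' \<in> H (a \<odot> w') w'"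
    using comp_in[OF B_in[OF a o] mirror.act_in[OF c o q4']] .
  have "splits (a \<odot> w) w' (act c w' q1' \<bullet> (a \<lhd> i))"
    unfolding ae using splits_comp[OF Q(9) i] .
  from splits_cancel[OF this lw_in[OF ih a] a'] have "splits (a \<odot> w') w' (act c w' q1')" .
  moreover have "act c w' q1' \<bullet> (a \<lhd> i) = (mirror.act c w' q4' \<bullet> B a w') \<bullet> (a \<lhd> i)"
    using ae re Q(8) B_nat_r[OF ih a] by (metis comp_assoc)
  from splits_right_cancel[OF splits_lw[OF i a] a' r' this]
  have "act c w' q1' = mirror.act c w' q4' \<bullet> B a w'" .
  ultimately show ?thesis
    unfolding regmod_def
    using o q1' q4' fusion_quotient[OF a t1 i Q(2) q1' m1 Q(4)]
      mirror.fusion_quotient[OF a t4 mi Q(3) q4' m4 Q(5)]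
      comm_quotient[OF a t4 i q1' m1 Q(6)] mirror.comm_quotient[OF a t1 mi q4' m4 Q(7)]
    by simp
qed

theorem regmod_transport:
  assumes r: "regmod w q1 q4" and i: "i \<in> H w w'" and j: "j \<in> H w' w"
    and ij: "i \<bullet> j = Id w'" and ji: "j \<bullet> i = Id w"
  shows "regmod w' ((a \<lhd> i) \<bullet> q1 \<bullet> (a \<lhd> j)) ((i \<rhd> a) \<bullet> q4 \<bullet> (j \<rhd> a))"
    and "mor i q1 q4 ((a \<lhd> i) \<bullet> q1 \<bullet> (a \<lhd> j)) ((i \<rhd> a) \<bullet> q4 \<bullet> (j \<rhd> a))"
    and "mor j ((a \<lhd> i) \<bullet> q1 \<bullet> (a \<lhd> j)) ((i \<rhd> a) \<bullet> q4 \<bullet> (j \<rhd> a)) q1 q4"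
proof -
  note Q = regmodD[OF r]
  have o: "w' \<in> Ob" using H_Ob i by auto
  have l: "(a \<lhd> j) \<bullet> (a \<lhd> i) = Id (a \<odot> w)" "(j \<rhd> a) \<bullet> (i \<rhd> a) = Id (w \<odot> a)"
    using ji a Q(1) by (simp_all add: lw_comp[symmetric] rw_comp[symmetric] lw_Id rw_Id)
  have h: "a \<lhd> i \<in> H (a \<odot> w) (a \<odot> w')" "a \<lhd> j \<in> H (a \<odot> w') (a \<odot> w)"
    "i \<rhd> a \<in> H (w \<odot> a) (w' \<odot> a)" "j \<rhd> a \<in> H (w' \<odot> a) (w \<odot> a)"
    using lw_in[OF i a] lw_in[OF j a] rw_in[OF i a] rw_in[OF j a] .
  show m: "mor i q1 q4 ((a \<lhd> i) \<bullet> q1 \<bullet> (a \<lhd> j)) ((i \<rhd> a) \<bullet> q4 \<bullet> (j \<rhd> a))"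
    unfolding mor_def using l Q(2,3) by (simp add: comp_assoc comp_Id)
  show "mor j ((a \<lhd> i) \<bullet> q1 \<bullet> (a \<lhd> j)) ((i \<rhd> a) \<bullet> q4 \<bullet> (j \<rhd> a)) q1 q4"
    unfolding mor_def using cancel[OF l(1) comp_in[OF h(2) Q(2)]] cancel[OF l(2) comp_in[OF h(4)
      Q(3)]]
    by simp
  show "regmod w' ((a \<lhd> i) \<bullet> q1 \<bullet> (a \<lhd> j)) ((i \<rhd> a) \<bullet> q4 \<bullet> (j \<rhd> a))"
    using regmod_quotient[OF r splits_iso[OF i j ij] m] comp_in[OF comp_in[OF h(2) Q(2)] h(1)]
      comp_in[OF comp_in[OF h(4) Q(3)] h(3)] by blast
qed

lemma mor_comp: "mor f q1 q4 p1 p4 \<Longrightarrow> mor g p1 p4 r1 r4 \<Longrightarrow> mor (g \<bullet> f) q1 q4 r1 r4"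
  unfolding mor_def lw_comp rw_comp by (metis comp_assoc)

lemma mor_Id: "regmod w q1 q4 \<Longrightarrow> mor (Id w) q1 q4 q1 q4"
  unfolding mor_def using a by (simp add: regmodD(1) lw_Id rw_Id Id_comp[OF regmodD(2)]
    comp_Id[OF regmodD(2)] Id_comp[OF regmodD(3)] comp_Id[OF regmodD(3)])

lemma mor_inverse:
  assumes m: "mor f q1 q4 p1 p4" and q: "regmod w q1 q4" and p: "regmod v p1 p4"
    and f: "f \<in> H w v" and g: "g \<in> H v w" and gf: "g \<bullet> f = Id w" and fg: "f \<bullet> g = Id v"
  shows "mor g p1 p4 q1 q4"
proof -
  note Q = regmodD[OF q] and P = regmodD[OF p]
  have m': "(a \<lhd> f) \<bullet> q1 = p1 \<bullet> (a \<lhd> f)" "(f \<rhd> a) \<bullet> q4 = p4 \<bullet> (f \<rhd> a)"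
    using m by (auto simp: mor_def)
  have i: "(a \<lhd> g) \<bullet> (a \<lhd> f) = Id (a \<odot> w)" "(a \<lhd> f) \<bullet> (a \<lhd> g) = Id (a \<odot> v)"
    "(g \<rhd> a) \<bullet> (f \<rhd> a) = Id (w \<odot> a)" "(f \<rhd> a) \<bullet> (g \<rhd> a) = Id (v \<odot> a)"
    using gf fg a Q(1) P(1) by (simp_all add: lw_comp[symmetric] rw_comp[symmetric] lw_Id rw_Id)
  show ?thesis
    unfolding mor_def
    using
      i comp_assoc Id_comp comp_Id Q(2,3) P(2,3) m'
      lw_in[OF f a] lw_in[OF g a] rw_in[OF f a] rw_in[OF g a] comp_in by metis
qed

lemma mor_rw:
  assumes "f \<in> H w w'" "mor f q1 q4 q1' q4'" "regmod v p1 p4"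
  shows "mor (f \<rhd> v) (tens a w q1 v p1) (mirror.tens a v p4 w q4)
    (tens a w' q1' v p1) (mirror.tens a v p4 w' q4')"
  using tens_mor_l[OF a _ assms(1), of v p1 q1 q1'] regmodD[OF assms(3)] assms(2)
    mirror.tens_mor_r[OF a _ _ assms(1), of v p4 q4 q4']
  unfolding mor_def by (simp add: rw_rw)

lemma mor_lw:
  assumes "f \<in> H v v'" "mor f p1 p4 p1' p4'" "regmod w q1 q4"
  shows "mor (w \<lhd> f) (tens a w q1 v p1) (mirror.tens a v p4 w q4)
    (tens a w q1 v' p1') (mirror.tens a v' p4' w q4)"
  using tens_mor_r[OF a _ _ assms(1), of w q1 p1 p1'] regmodD[OF assms(3)] assms(2)
    mirror.tens_mor_l[OF a _ assms(1), of w q4 p4 p4']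
  unfolding mor_def by (simp add: lw_rw)

end

section \<open>Arrows with endpoints\<close>

text \<open>
  In \<open>C\<close> an arrow does not determine its endpoints. Here an arrow carries them, taken from a type
  of formal objects \<open>x\<close> with interpretation \<open>T x\<close>; \<open>None\<close> stands for an ill-typed composite. The
  formal objects will be bracketed products, and then words.
\<close>

locale typed_arrows = category C
  for C :: "('o, 'm, 'z) category_data_scheme" (structure) +
  fixes V :: "'x set" and T :: "'x \<Rightarrow> 'o"
  assumes T_Obj: "x \<in> V \<Longrightarrow> T x \<in> Obj C"
begin

definition Hm :: "'x \<Rightarrow> 'x \<Rightarrow> ('x \<times> 'm \<times> 'x) option set" where
  "Hm x y = {Some (x, f, y) | f. x \<in> V \<and> y \<in> V \<and> f \<in> Hom C (T x) (T y)}"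

fun cmp :: "('x \<times> 'm \<times> 'x) option \<Rightarrow> ('x \<times> 'm \<times> 'x) option \<Rightarrow> ('x \<times> 'm \<times> 'x) option" where
  "cmp (Some (y', g, z)) (Some (x, f, y)) =
    (if y' = y \<and> Some (y', g, z) \<in> Hm y z \<and> Some (x, f, y) \<in> Hm x y
     then Some (x, g \<cdot> f, z) else None)"
| "cmp None f = None"
| "cmp g None = None"

definition idn :: "'x \<Rightarrow> ('x \<times> 'm \<times> 'x) option" where
  "idn x = (if x \<in> V then Some (x, Idt C (T x), x) else None)"

lemma in_Hm: "Some (x', f, y') \<in> Hm x y \<longleftrightarrow>
    x' = x \<and> y' = y \<and> x \<in> V \<and> y \<in> V \<and> f \<in> Hom C (T x) (T y)"
  by (auto simp: Hm_def)

lemma None_Hm: "None \<notin> Hm x y"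
  by (auto simp: Hm_def)

lemma HmE:
  assumes "f \<in> Hm x y"
  obtains f' where "f = Some (x, f', y)" "x \<in> V" "y \<in> V" "f' \<in> Hom C (T x) (T y)"
  using assms by (auto simp: Hm_def)

lemma Hm_V: "f \<in> Hm x y \<Longrightarrow> x \<in> V \<and> y \<in> V"
  by (auto simp: Hm_def)

lemma Hm_unique: "f \<in> Hm x y \<Longrightarrow> f \<in> Hm x' y' \<Longrightarrow> x = x' \<and> y = y'"
  by (auto simp: Hm_def)

lemma idn_in: "x \<in> V \<Longrightarrow> idn x \<in> Hm x x"
  using Id_in_Hom T_Obj by (auto simp: Hm_def idn_def)

lemma cmp_in: "f \<in> Hm x y \<Longrightarrow> g \<in> Hm y z \<Longrightarrow> cmp g f \<in> Hm x z"
  by (elim HmE) (auto simp: in_Hm intro: Comp_in_Hom[OF T_Obj T_Obj T_Obj, of x y z])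

lemma idn_cmp: "f \<in> Hm x y \<Longrightarrow> cmp (idn y) f = f"
  by (elim HmE) (simp add: in_Hm idn_def Id_Comp[OF T_Obj T_Obj] Id_in_Hom[OF T_Obj])

lemma cmp_idn: "f \<in> Hm x y \<Longrightarrow> cmp f (idn x) = f"
  by (elim HmE) (simp add: in_Hm idn_def Comp_Id[OF T_Obj T_Obj] Id_in_Hom[OF T_Obj])

lemma cmp_NoneI: "(\<And>x y z. f \<in> Hm x y \<Longrightarrow> g \<in> Hm y z \<Longrightarrow> False) \<Longrightarrow> cmp g f = None"
  by (cases "(g, f)" rule: cmp.cases) (auto simp: in_Hm)

lemma cmp_None: "cmp g None = None"
  by (cases g) auto

lemma cmp_assoc: "cmp (cmp h g) f = cmp h (cmp g f)"
proof (cases "\<exists>w x y z. f \<in> Hm w x \<and> g \<in> Hm x y \<and> h \<in> Hm y z")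
  case True
  then obtain w x y z f' g' h' where
    "f = Some (w, f', x)" "g = Some (x, g', y)" "h = Some (y, h', z)"
    "w \<in> V" "x \<in> V" "y \<in> V" "z \<in> V"
    "f' \<in> Hom C (T w) (T x)" "g' \<in> Hom C (T x) (T y)" "h' \<in> Hom C (T y) (T z)"
    by (auto simp: Hm_def)
  then show ?thesis
    using Comp_assoc[of "T w" "T x" "T y" "T z" f' g' h'] Comp_in_Hom[of "T w" "T x" "T y" f' g']
      Comp_in_Hom[of "T x" "T y" "T z" g' h']
    by (simp add: T_Obj in_Hm)
next
  case False
  have 1: "cmp (cmp h g) f = None"
  proof (rule cmp_NoneI)
    fix w x z assume f: "f \<in> Hm w x" and hg: "cmp h g \<in> Hm x z"
    then have "cmp h g \<noteq> None" using None_Hm by metis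
    then obtain x' y z' where g: "g \<in> Hm x' y" and h: "h \<in> Hm y z'"
      by (metis cmp_NoneI)
    with hg have "x' = x" using cmp_in[OF g h] by (auto simp: Hm_def)
    then show False using False f g h by blast
  qed
  have 2: "cmp h (cmp g f) = None"
  proof (rule cmp_NoneI)
    fix w y z assume h: "h \<in> Hm y z" and gf: "cmp g f \<in> Hm w y"
    then have "cmp g f \<noteq> None" using None_Hm by metis
    then obtain w' x y' where f: "f \<in> Hm w' x" and g: "g \<in> Hm x y'"
      by (metis cmp_NoneI)
    with gf have "y' = y" using cmp_in[OF f g] by (auto simp: Hm_def)
    then show False using False f g h by blast
  qed
  show ?thesis using 1 2 by simp
qed

definition iso where
  "iso x y f \<longleftrightarrow> f \<in> Hm x y \<and> (\<exists>g \<in> Hm y x. cmp g f = idn x \<and> cmp f g = idn y)"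

lemma iso_in: "iso x y f \<Longrightarrow> f \<in> Hm x y"
  by (simp add: iso_def)

lemma iso_idn: "x \<in> V \<Longrightarrow> iso x x (idn x)"
  unfolding iso_def using idn_in idn_cmp by blast

lemma iso_cmp: assumes "iso x y f" "iso y z g" shows "iso x z (cmp g f)"
proof -
  obtain f' g' where f: "f \<in> Hm x y" "f' \<in> Hm y x" "cmp f' f = idn x" "cmp f f' = idn y"
    and g: "g \<in> Hm y z" "g' \<in> Hm z y" "cmp g' g = idn y" "cmp g g' = idn z"
    using assms by (auto simp: iso_def)
  have "cmp (cmp f' g') (cmp g f) = cmp f' (cmp (cmp g' g) f)"
    "cmp (cmp g f) (cmp f' g') = cmp g (cmp (cmp f f') g')" by (simp_all only: cmp_assoc)
  then show ?thesis
    unfolding iso_def using f g cmp_in idn_cmp by metis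
qed

lemma iso_epi:
  assumes "iso x y f" "g \<in> Hm y z" "h \<in> Hm y z" "cmp g f = cmp h f" shows "g = h"
  using assms unfolding iso_def by (metis cmp_assoc cmp_idn)

lemma iso_mono:
  assumes "iso x y f" "g \<in> Hm w x" "h \<in> Hm w x" "cmp f g = cmp f h" shows "g = h"
  using assms unfolding iso_def by (metis cmp_assoc idn_cmp)

definition inv :: "'x \<Rightarrow> 'x \<Rightarrow> ('x \<times> 'm \<times> 'x) option \<Rightarrow> ('x \<times> 'm \<times> 'x) option" where
  "inv x y f = (SOME g. g \<in> Hm y x \<and> cmp g f = idn x \<and> cmp f g = idn y)"

lemma inv: assumes "iso x y f"
  shows "inv x y f \<in> Hm y x" "cmp (inv x y f) f = idn x" "cmp f (inv x y f) = idn y"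
    "iso y x (inv x y f)"
proof -
  have "\<exists>g. g \<in> Hm y x \<and> cmp g f = idn x \<and> cmp f g = idn y"
    using assms by (auto simp: iso_def)
  from someI_ex[OF this] show "inv x y f \<in> Hm y x" "cmp (inv x y f) f = idn x"
    "cmp f (inv x y f) = idn y" unfolding inv_def by blast+
  then show "iso y x (inv x y f)" using assms unfolding iso_def by blast
qed

lemma iso_arr:
  assumes "iso_arr C (T x) (T y) f" "x \<in> V" "y \<in> V"
  shows "iso x y (Some (x, f, y))"
proof -
  obtain g where "f \<in> Hom C (T x) (T y)" "g \<in> Hom C (T y) (T x)"
    "g \<cdot> f = Idt C (T x)" "f \<cdot> g = Idt C (T y)"
    using assms by (auto simp: iso_arr_def inverse_arrows_def)
  then show ?thesis
    unfolding iso_def using assms by (intro conjI bexI[of _ "Some (y, g, x)"]) (auto simp: in_Hm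
      idn_def)
qed

end

section \<open>Bracketed products and coherence of units\<close>

text \<open>
  Formal bracketed products. The products of \<open>C\<close> need not determine their factors, those of trees
  do, so that the interchange law \<open>par_cmp\<close> holds without typing conditions.
\<close>

datatype 'o tree = Void | Leaf 'o | Node "'o tree" "'o tree"

primrec ev :: "('o, 'm, 'z) monoidal_data_scheme \<Rightarrow> 'o tree \<Rightarrow> 'o" where
  "ev C Void = Unit C"
| "ev C (Leaf x) = x"
| "ev C (Node s t) = ev C s \<otimes>\<^bsub>C\<^esub> ev C t"

context monoidal_category
begin

abbreviation trees :: "'o tree set" where "trees \<equiv> {t. set_tree t \<subseteq> Obj C}"

sublocale tr: typed_arrows C trees "ev C"
proof
  fix t assume "t \<in> trees"
  then show "ev C t \<in> Obj C"
    by (induction t) (auto simp: Unit_Obj Tensor_Obj)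
qed

abbreviation star (infixr "\<star>" 55) where "g \<star> f \<equiv> tr.cmp g f"

fun par :: "('o tree \<times> 'm \<times> 'o tree) option \<Rightarrow> ('o tree \<times> 'm \<times> 'o tree) option
    \<Rightarrow> ('o tree \<times> 'm \<times> 'o tree) option" (infixl "||" 70) where
  "par (Some (s, f, s')) (Some (t, g, t')) =
    (if Some (s, f, s') \<in> tr.Hm s s' \<and> Some (t, g, t') \<in> tr.Hm t t'
     then Some (Node s t, f \<boxtimes> g, Node s' t') else None)"
| "par None g = None"
| "par f None = None"

lemma par_in: "f \<in> tr.Hm s s' \<Longrightarrow> g \<in> tr.Hm t t' \<Longrightarrow> f || g \<in> tr.Hm (Node s t) (Node s' t')"
  by (elim tr.HmE) (auto simp: tr.in_Hm
    intro!: TensorArr_in_Hom[OF tr.T_Obj tr.T_Obj tr.T_Obj tr.T_Obj])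

lemma par_idn: "s \<in> trees \<Longrightarrow> t \<in> trees \<Longrightarrow> tr.idn s || tr.idn t = tr.idn (Node s t)"
  by (auto simp: tr.idn_def tr.in_Hm tr.T_Obj Id_in_Hom TensorArr_Id)

lemma par_NoneI: "(\<And>s s' t t'. f \<in> tr.Hm s s' \<Longrightarrow> g \<in> tr.Hm t t' \<Longrightarrow> False) \<Longrightarrow> f || g = None"
  by (cases "(f, g)" rule: par.cases) (auto simp: tr.in_Hm)

lemma par_cmp: "(f' \<star> f) || (g' \<star> g) = (f' || g') \<star> (f || g)"
proof (cases "(\<exists>s s' s''. f \<in> tr.Hm s s' \<and> f' \<in> tr.Hm s' s'') \<and>
    (\<exists>t t' t''. g \<in> tr.Hm t t' \<and> g' \<in> tr.Hm t' t'')")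
  case True
  then obtain s s' s'' t t' t'' where h: "f \<in> tr.Hm s s'" "f' \<in> tr.Hm s' s''"
      "g \<in> tr.Hm t t'" "g' \<in> tr.Hm t' t''" by blast
  obtain x x' y y' where e: "f = Some (s, x, s')" "f' = Some (s', x', s'')"
      "g = Some (t, y, t')" "g' = Some (t', y', t'')"
    using h by (auto elim!: tr.HmE)
  note m = tr.cmp_in[OF h(1,2)] tr.cmp_in[OF h(3,4)] par_in[OF h(1,3)] par_in[OF h(2,4)]
  show ?thesis
    using h m TensorArr_Comp[of "ev C s" "ev C s'" "ev C s''" "ev C t" "ev C t'" "ev C t''" x x' y
      y']
    unfolding e by (simp add: tr.in_Hm tr.T_Obj)
next
  case False
  have 1: "(f' \<star> f) || (g' \<star> g) = None"
  proof (cases "\<exists>s s' s''. f \<in> tr.Hm s s' \<and> f' \<in> tr.Hm s' s''")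
    case True
    then have "g' \<star> g = None" using False tr.cmp_NoneI[of g g'] by blast
    then show ?thesis by (cases "f' \<star> f") auto
  next
    case False
    then have "f' \<star> f = None" using tr.cmp_NoneI[of f f'] by blast
    then show ?thesis by auto
  qed
  have "(f' || g') \<star> (f || g) = None"
  proof (rule tr.cmp_NoneI)
    fix x y z assume a: "f || g \<in> tr.Hm x y" and b: "f' || g' \<in> tr.Hm y z"
    obtain s s' t t' where f: "f \<in> tr.Hm s s'" and g: "g \<in> tr.Hm t t'"
      using a tr.None_Hm par_NoneI[of f g] by metis
    obtain p p' q q' where f': "f' \<in> tr.Hm p p'" and g': "g' \<in> tr.Hm q q'"
      using b tr.None_Hm par_NoneI[of f' g'] by metis
    have "Node s' t' = y" using par_in[OF f g] a by (auto simp: tr.Hm_def)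
    moreover have "Node p q = y" using par_in[OF f' g'] b by (auto simp: tr.Hm_def)
    ultimately show False using False f g f' g' by auto
  qed
  with 1 show ?thesis by simp
qed

lemma iso_par:
  assumes "tr.iso s s' f" "tr.iso t t' g" shows "tr.iso (Node s t) (Node s' t') (f || g)"
proof -
  obtain f' where f: "f \<in> tr.Hm s s'" "f' \<in> tr.Hm s' s" "f' \<star> f = tr.idn s" "f \<star> f' = tr.idn s'"
    using assms(1) by (auto simp: tr.iso_def)
  obtain g' where g: "g \<in> tr.Hm t t'" "g' \<in> tr.Hm t' t" "g' \<star> g = tr.idn t" "g \<star> g' = tr.idn t'"
    using assms(2) by (auto simp: tr.iso_def)
  have "s \<in> trees" "s' \<in> trees" "t \<in> trees" "t' \<in> trees"
    using f g tr.Hm_V by blast+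
  then show ?thesis
    unfolding tr.iso_def using f g par_in[OF f(1) g(1)] par_in[OF f(2) g(2)]
    by (intro conjI bexI[of _ "f' || g'"]) (simp_all only: par_cmp[symmetric] par_idn)
qed

definition al where "al s t u = Some (Node (Node s t) u, Assoc C (ev C s) (ev C t) (ev C u), Node
  s (Node t u))"
definition lun where "lun s = Some (Node Void s, LUnit C (ev C s), s)"
definition run where "run s = Some (Node s Void, RUnit C (ev C s), s)"

lemma iso_al: "s \<in> trees \<Longrightarrow> t \<in> trees \<Longrightarrow> u \<in> trees \<Longrightarrow>
    tr.iso (Node (Node s t) u) (Node s (Node t u)) (al s t u)"
  unfolding al_def by (rule tr.iso_arr) (auto simp: tr.T_Obj Assoc_iso)

lemma iso_lun: "s \<in> trees \<Longrightarrow> tr.iso (Node Void s) s (lun s)"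
  unfolding lun_def by (rule tr.iso_arr) (auto simp: tr.T_Obj LUnit_iso)

lemma iso_run: "s \<in> trees \<Longrightarrow> tr.iso (Node s Void) s (run s)"
  unfolding run_def by (rule tr.iso_arr) (auto simp: tr.T_Obj RUnit_iso)

lemmas al_in = tr.iso_in[OF iso_al]
lemmas lun_in = tr.iso_in[OF iso_lun]
lemmas run_in = tr.iso_in[OF iso_run]

abbreviation ali where "ali s t u \<equiv> tr.inv (Node (Node s t) u) (Node s (Node t u)) (al s t u)"

lemmas ali = tr.inv[OF iso_al]

lemma Void_tree: "Void \<in> trees" by simp
lemma Node_tree: "s \<in> trees \<Longrightarrow> t \<in> trees \<Longrightarrow> Node s t \<in> trees" by simp

lemma al_nat:
  assumes "f \<in> tr.Hm s s'" "g \<in> tr.Hm t t'" "h \<in> tr.Hm u u'"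
  shows "al s' t' u' \<star> ((f || g) || h) = (f || (g || h)) \<star> al s t u"
proof -
  note m = par_in[OF par_in[OF assms(1,2)] assms(3)] par_in[OF assms(1) par_in[OF assms(2,3)]]
    par_in[OF assms(1,2)] par_in[OF assms(2,3)]
  have "s \<in> trees" "t \<in> trees" "u \<in> trees" "s' \<in> trees" "t' \<in> trees" "u' \<in> trees"
    using assms tr.Hm_V by blast+
  note al_in[OF this(1,2,3)] al_in[OF this(4,5,6)]
  with m assms show ?thesis
    by (auto elim!: tr.HmE simp: al_def tr.in_Hm tr.T_Obj Assoc_natural)
qed

lemma lun_nat:
  assumes "f \<in> tr.Hm s t" shows "lun t \<star> (tr.idn Void || f) = f \<star> lun s"
proof -
  have "s \<in> trees" "t \<in> trees" using assms tr.Hm_V by blast+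
  note lun_in[OF this(1)] lun_in[OF this(2)] par_in[OF tr.idn_in[OF Void_tree] assms]
  with assms show ?thesis
    by (auto elim!: tr.HmE simp: lun_def tr.idn_def tr.in_Hm tr.T_Obj LUnit_natural Id_in_Hom
      Unit_Obj)
qed

lemma run_nat:
  assumes "f \<in> tr.Hm s t" shows "run t \<star> (f || tr.idn Void) = f \<star> run s"
proof -
  have "s \<in> trees" "t \<in> trees" using assms tr.Hm_V by blast+
  note run_in[OF this(1)] run_in[OF this(2)] par_in[OF assms tr.idn_in[OF Void_tree]]
  with assms show ?thesis
    by (auto elim!: tr.HmE simp: run_def tr.idn_def tr.in_Hm tr.T_Obj RUnit_natural Id_in_Hom
      Unit_Obj)
qed

lemma al_pentagon:
  assumes "w \<in> trees" "x \<in> trees" "y \<in> trees" "z \<in> trees"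
  shows "al w x (Node y z) \<star> al (Node w x) y z
    = (tr.idn w || al x y z) \<star> al w (Node x y) z \<star> (al w x y || tr.idn z)"
proof -
  have s: "Node w x \<in> trees" "Node x y \<in> trees" "Node y z \<in> trees" using assms by auto
  note al_in[OF assms(1,2) s(3)] al_in[OF s(1) assms(3,4)]
    par_in[OF tr.idn_in[OF assms(1)] al_in[OF assms(2,3,4)]] al_in[OF assms(1) s(2) assms(4)]
    par_in[OF al_in[OF assms(1,2,3)] tr.idn_in[OF assms(4)]]
    al_in[OF assms(1,2,3)] al_in[OF assms(2,3,4)] tr.idn_in[OF assms(1)] tr.idn_in[OF assms(4)]
    tr.cmp_in[OF par_in[OF al_in[OF assms(1,2,3)] tr.idn_in[OF assms(4)]] al_in[OF assms(1) s(2)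
      assms(4)]]
  then show ?thesis
    using assms pentagon[of "ev C w" "ev C x" "ev C y" "ev C z"]
    by (simp add: al_def tr.idn_def tr.in_Hm tr.T_Obj)
qed

lemma al_triangle:
  assumes "x \<in> trees" "y \<in> trees"
  shows "(tr.idn x || lun y) \<star> al x Void y = run x || tr.idn y"
proof -
  note al_in[OF assms(1) Void_tree assms(2)] par_in[OF tr.idn_in[OF assms(1)] lun_in[OF assms(2)]]
    lun_in[OF assms(2)] run_in[OF assms(1)] tr.idn_in[OF assms(1)] tr.idn_in[OF assms(2)]
  then show ?thesis
    using assms triangle[of "ev C x" "ev C y"]
    by (simp add: al_def lun_def run_def tr.idn_def tr.in_Hm tr.T_Obj)
qed

lemma idn_par_cmp: "s \<in> trees \<Longrightarrow> tr.idn s || (g \<star> f) = (tr.idn s || g) \<star> (tr.idn s || f)"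
  by (simp add: par_cmp[symmetric] tr.idn_cmp[OF tr.idn_in])

lemma par_idn_cmp: "s \<in> trees \<Longrightarrow> (g \<star> f) || tr.idn s = (g || tr.idn s) \<star> (f || tr.idn s)"
  by (simp add: par_cmp[symmetric] tr.idn_cmp[OF tr.idn_in])

lemma idn_Void_faithful:
  assumes "f \<in> tr.Hm s t" "g \<in> tr.Hm s t" "tr.idn Void || f = tr.idn Void || g" shows "f = g"
  using lun_nat[OF assms(1)] lun_nat[OF assms(2)] assms tr.iso_epi[OF iso_lun]
  by (metis tr.Hm_V)

lemma par_Void_faithful:
  assumes "f \<in> tr.Hm s t" "g \<in> tr.Hm s t" "f || tr.idn Void = g || tr.idn Void" shows "f = g"
  using run_nat[OF assms(1)] run_nat[OF assms(2)] assms tr.iso_epi[OF iso_run]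
  by (metis tr.Hm_V)

text \<open>
  Kelly's argument: tensoring with the unit is faithful, and after tensoring, the pentagon for two
  units and \<open>x\<close>, \<open>y\<close> reduces the equation to triangles and naturality. \<open>run_Node\<close> is its
  counterpart on the right.
\<close>

lemma lun_Node:
  assumes o: "x \<in> trees" "y \<in> trees"
  shows "lun (Node x y) \<star> al Void x y = lun x || tr.idn y"
proof (rule idn_Void_faithful)
  let ?i = "tr.idn Void"
  have n: "Node x y \<in> trees" "Node Void x \<in> trees" "Node Void Void \<in> trees" using o by auto
  note ai = al_in[OF Void_tree o]
  show lh: "lun (Node x y) \<star> al Void x y \<in> tr.Hm (Node (Node Void x) y) (Node x y)"
    using tr.cmp_in[OF ai lun_in[OF n(1)]] .
  show rh: "lun x || tr.idn y \<in> tr.Hm (Node (Node Void x) y) (Node x y)"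
    using par_in[OF lun_in tr.idn_in] o .
  \<comment> \<open>The isomorphism from which the pentagon with two units starts.\<close>
  let ?p = "al Void (Node Void x) y \<star> (al Void Void x || tr.idn y)"
  have "((?i || (lun (Node x y) \<star> al Void x y)) \<star> ?p)
      = (?i || lun (Node x y)) \<star> (?i || al Void x y) \<star> al Void (Node Void x) y \<star> (al Void Void x
        || tr.idn y)"
    by (simp add: idn_par_cmp[OF Void_tree] tr.cmp_assoc)
  also have "\<dots> = ((?i || lun (Node x y)) \<star> al Void Void (Node x y)) \<star> al (Node Void Void) x y"
    unfolding al_pentagon[OF Void_tree Void_tree o, symmetric] by (simp only: tr.cmp_assoc)
  also have "\<dots> = (run Void || (tr.idn x || tr.idn y)) \<star> al (Node Void Void) x y"
    by (simp only: al_triangle[OF Void_tree n(1)] par_idn[OF o])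
  also have "\<dots> = al Void x y \<star> ((run Void || tr.idn x) || tr.idn y)"
    using al_nat[OF run_in[OF Void_tree] tr.idn_in[OF o(1)] tr.idn_in[OF o(2)]] by simp
  also have "\<dots> = al Void x y \<star> ((?i || lun x) || tr.idn y) \<star> (al Void Void x || tr.idn y)"
    by (simp only: al_triangle[OF Void_tree o(1), symmetric] par_idn_cmp[OF o(2)])
  also have "\<dots> = (?i || (lun x || tr.idn y)) \<star> ?p"
    using al_nat[OF tr.idn_in[OF Void_tree] lun_in[OF o(1)] tr.idn_in[OF o(2)]]
    by (simp add: tr.cmp_assoc[symmetric])
  finally have e: "(?i || (lun (Node x y) \<star> al Void x y)) \<star> ?p = (?i || (lun x || tr.idn y)) \<star> ?p" .
  have p: "tr.iso (Node (Node (Node Void Void) x) y) (Node Void (Node (Node Void x) y)) ?p"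
    using tr.iso_cmp[OF iso_par[OF iso_al tr.iso_idn] iso_al] o n Void_tree by simp
  show "?i || (lun (Node x y) \<star> al Void x y) = ?i || (lun x || tr.idn y)"
    using tr.iso_epi[OF p _ _ e] par_in[OF tr.idn_in[OF Void_tree] lh] par_in[OF tr.idn_in[OF
      Void_tree] rh]
    by blast
qed

lemma run_Node:
  assumes o: "x \<in> trees" "y \<in> trees"
  shows "(tr.idn x || run y) \<star> al x y Void = run (Node x y)"
proof (rule par_Void_faithful)
  let ?i = "tr.idn Void"
  have n: "Node x y \<in> trees" "Node y Void \<in> trees" "Node Void Void \<in> trees" using o by auto
  show lh: "(tr.idn x || run y) \<star> al x y Void \<in> tr.Hm (Node (Node x y) Void) (Node x y)"
    using tr.cmp_in[OF al_in par_in[OF tr.idn_in run_in]] o Void_tree by simp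
  show rh: "run (Node x y) \<in> tr.Hm (Node (Node x y) Void) (Node x y)" using run_in[OF n(1)] .
  have "al x y Void \<star> (run (Node x y) || ?i) = al x y Void \<star> ((tr.idn x || tr.idn y) || lun Void)
    \<star> al (Node x y) Void Void"
    by (simp only: al_triangle[OF n(1) Void_tree, symmetric] par_idn[OF o])
  also have "\<dots> = (tr.idn x || (tr.idn y || lun Void)) \<star> al x y (Node Void Void) \<star> al (Node x y)
    Void Void"
    using al_nat[OF tr.idn_in[OF o(1)] tr.idn_in[OF o(2)] lun_in[OF Void_tree]]
    by (simp add: tr.cmp_assoc[symmetric])
  also have "\<dots> = (tr.idn x || ((tr.idn y || lun Void) \<star> al y Void Void)) \<star> al x (Node y Void) Void
    \<star> (al x y Void || ?i)"
    unfolding al_pentagon[OF o Void_tree Void_tree] by (simp only: idn_par_cmp[OF o(1)]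
      tr.cmp_assoc)
  also have "\<dots> = ((tr.idn x || (run y || ?i)) \<star> al x (Node y Void) Void) \<star> (al x y Void || ?i)"
    by (simp only: al_triangle[OF o(2) Void_tree] tr.cmp_assoc)
  also have "\<dots> = al x y Void \<star> (((tr.idn x || run y) \<star> al x y Void) || ?i)"
    unfolding al_nat[OF tr.idn_in[OF o(1)] run_in[OF o(2)] tr.idn_in[OF Void_tree], symmetric]
    by (simp only: par_idn_cmp[OF Void_tree] tr.cmp_assoc)
  finally show "((tr.idn x || run y) \<star> al x y Void) || ?i = run (Node x y) || ?i"
    using tr.iso_mono[OF iso_al[OF o Void_tree]] par_in[OF lh tr.idn_in[OF Void_tree]]
      par_in[OF rh tr.idn_in[OF Void_tree]] by metis
qed

text \<open>
  By \<open>run_Node\<close> and the triangle, the two become equal when tensored with the unit on the left.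
\<close>

lemma lun_Void: "lun Void = run Void"
proof (rule idn_Void_faithful)
  let ?i = "tr.idn Void"
  show "lun Void \<in> tr.Hm (Node Void Void) Void" "run Void \<in> tr.Hm (Node Void Void) Void"
    using lun_in[OF Void_tree] run_in[OF Void_tree] .
  have n: "Node Void Void \<in> trees" by simp
  have "run Void \<star> (run Void || ?i) = run Void \<star> run (Node Void Void)"
    using run_nat[OF run_in[OF Void_tree]] .
  then have "run Void || ?i = run (Node Void Void)"
    using tr.iso_mono[OF iso_run[OF Void_tree]] run_in[OF n] par_in[OF run_in tr.idn_in, OF
      Void_tree Void_tree]
    by blast
  then have "(?i || lun Void) \<star> al Void Void Void = (?i || run Void) \<star> al Void Void Void"
    using al_triangle[OF Void_tree Void_tree] run_Node[OF Void_tree Void_tree] by simp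
  then show "?i || lun Void = ?i || run Void"
    using tr.iso_epi[OF iso_al[OF Void_tree Void_tree Void_tree]] par_in[OF tr.idn_in lun_in, OF
      Void_tree Void_tree]
      par_in[OF tr.idn_in run_in, OF Void_tree Void_tree] by blast
qed

end

section \<open>Words and their concatenation\<close>

fun tree_of :: "'o list \<Rightarrow> 'o tree" where
  "tree_of [] = Void"
| "tree_of (x # xs) = foldl (\<lambda>t y. Node t (Leaf y)) (Leaf x) xs"

lemma tree_of_snoc: "xs \<noteq> [] \<Longrightarrow> tree_of (xs @ [y]) = Node (tree_of xs) (Leaf y)"
  by (cases xs) auto

lemma set_tree_of: "set_tree (tree_of xs) = set xs"
proof (induction xs rule: rev_induct)
  case (snoc x xs)
  then show ?case by (cases "xs = []") (auto simp: tree_of_snoc)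
qed simp

lemma tree_of_inj: "tree_of xs = tree_of ys \<Longrightarrow> xs = ys"
proof (induction xs arbitrary: ys rule: rev_induct)
  case Nil
  then show ?case by (cases ys rule: rev_cases) (auto, case_tac "ys = []", auto simp: tree_of_snoc)
next
  case (snoc x xs)
  show ?case
  proof (cases ys rule: rev_cases)
    case Nil
    with snoc(2) show ?thesis by (cases "xs = []") (auto simp: tree_of_snoc)
  next
    case (snoc zs z)
    with snoc.prems snoc.IH[of zs] show ?thesis
      by (cases "xs = []"; cases "zs = []") (auto simp: tree_of_snoc)
  qed
qed

context monoidal_category
begin

abbreviation words :: "'o list set" where "words \<equiv> lists (Obj C)"

lemma tree_of_trees: "xs \<in> words \<longleftrightarrow> tree_of xs \<in> trees"
  by (auto simp: set_tree_of in_lists_conv_set)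

sublocale wd: typed_arrows C words "\<lambda>xs. ev C (tree_of xs)"
  using tr.T_Obj tree_of_trees by unfold_locales blast

abbreviation one where "one xs \<equiv> tr.idn (tree_of xs)"

text \<open>
  \<open>glue xs ys\<close> is the canonical isomorphism from the product of the two bracketed words to the
  bracketed concatenation. It peels off letters at the end of \<open>ys\<close>, so that recursion is over the
  reversed word. Left bracketing makes it an identity when \<open>ys\<close> is a single letter and \<open>xs\<close> is not
  empty.
\<close>

fun glue_rev where
  "glue_rev xs [] = None"
| "glue_rev xs [y] = tr.idn (Node (tree_of xs) (Leaf y))"
| "glue_rev xs (y # z # zs) = (glue_rev xs (z # zs) || tr.idn (Leaf y)) \<star> ali (tree_of xs)
  (tree_of (rev (z # zs))) (Leaf y)"

definition glue where
  "glue xs ys = (if xs = [] then lun (tree_of ys) else if ys = [] then run (tree_of xs) else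
    glue_rev xs (rev ys))"

lemma glue_Nil: "glue [] ys = lun (tree_of ys)" and glue_Nil2: "glue xs [] = run (tree_of xs)"
  by (auto simp: glue_def lun_Void)

lemma glue_single: "xs \<noteq> [] \<Longrightarrow> glue xs [y] = tr.idn (tree_of (xs @ [y]))"
  by (simp add: glue_def tree_of_snoc)

lemma glue_snoc: "xs \<noteq> [] \<Longrightarrow> ys \<noteq> [] \<Longrightarrow>
    glue xs (ys @ [y]) = (glue xs ys || tr.idn (Leaf y)) \<star> ali (tree_of xs) (tree_of ys) (Leaf y)"
  by (cases "rev ys") (auto simp: glue_def dest: arg_cong[where f = rev])

lemma one_in: "xs \<in> words \<Longrightarrow> one xs \<in> tr.Hm (tree_of xs) (tree_of xs)"
  using tree_of_trees tr.idn_in by blast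

lemma iso_glue:
  "xs \<in> words \<Longrightarrow> ys \<in> words \<Longrightarrow> tr.iso (Node (tree_of xs) (tree_of ys)) (tree_of (xs @ ys)) (glue xs
    ys)"
proof (induction ys rule: rev_induct)
  case Nil
  then show ?case using iso_run tree_of_trees by (simp add: glue_Nil2)
next
  case (snoc y ys)
  then have ys: "ys \<in> words" and y: "Leaf y \<in> trees" and "[y] \<in> words" by auto
  have xs': "tree_of xs \<in> trees" and ys': "tree_of ys \<in> trees" using snoc(2) ys tree_of_trees by
    blast+
  show ?case
  proof (cases "xs = [] \<or> ys = []")
    case True
    show ?thesis
    proof (cases "xs = []")
      case True
      then show ?thesis using iso_lun tree_of_trees snoc(3) by (simp add: glue_Nil)
    next
      case False
      with True have "ys = []" by simp
      then show ?thesis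
        using False glue_single[OF False, of y] tr.iso_idn[of "Node (tree_of xs) (Leaf y)"] xs' y
        by (simp add: tree_of_snoc)
    qed
  next
    case False
    have "tr.iso (Node (Node (tree_of xs) (tree_of ys)) (Leaf y)) (Node (tree_of (xs @ ys)) (Leaf
      y)) (glue xs ys || tr.idn (Leaf y))"
      using iso_par[OF snoc(1)[OF snoc(2) ys] tr.iso_idn[OF y]] .
    from tr.iso_cmp[OF ali(4)[OF xs' ys' y] this]
    show ?thesis using False tree_of_snoc[of "xs @ ys" y] by (simp add: glue_snoc tree_of_snoc)
  qed
qed

lemmas glue_in = tr.iso_in[OF iso_glue]

lemma glue_snoc_al:
  assumes "xs \<noteq> []" "ys \<noteq> []" and w: "xs \<in> words" "ys \<in> words" "y \<in> Obj C"
  shows "glue xs (ys @ [y]) \<star> al (tree_of xs) (tree_of ys) (Leaf y) = glue xs ys || tr.idn (Leaf y)"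
proof -
  have t: "tree_of xs \<in> trees" "tree_of ys \<in> trees" and y: "Leaf y \<in> trees"
    using w tree_of_trees by auto
  show ?thesis
    unfolding glue_snoc[OF assms(1,2)] tr.cmp_assoc ali(2)[OF t y]
    using tr.cmp_idn[OF par_in[OF glue_in[OF w(1,2)] tr.idn_in[OF y]]] .
qed

text \<open>
  The only coherence needed between more than two words. Empty words reduce to the unit laws, and
  the step for a further letter of \<open>zs\<close> is the pentagon.
\<close>

lemma glue_assoc:
  assumes "xs \<in> words" "ys \<in> words"
  shows "zs \<in> words \<Longrightarrow> glue (xs @ ys) zs \<star> (glue xs ys || one zs)
    = glue xs (ys @ zs) \<star> (one xs || glue ys zs) \<star> al (tree_of xs) (tree_of ys) (tree_of zs)"
proof (induction zs rule: rev_induct)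
  case Nil
  have t: "tree_of xs \<in> trees" "tree_of ys \<in> trees" using assms tree_of_trees by blast+
  show ?case
    using run_nat[OF glue_in[OF assms]] run_Node[OF t] by (simp add: glue_Nil2)
next
  case (snoc z zs)
  have zs: "zs \<in> words" "[z] \<in> words" and z: "Leaf z \<in> trees" using snoc by auto
  have t: "tree_of xs \<in> trees" "tree_of ys \<in> trees" "tree_of zs \<in> trees" "tree_of (zs @ [z]) \<in>
    trees"
    "tree_of (ys @ zs) \<in> trees" "tree_of (ys @ zs @ [z]) \<in> trees"
    unfolding tree_of_trees[symmetric] using assms snoc zs by auto
  let ?x = "tree_of xs" and ?y = "tree_of ys" and ?w = "tree_of zs" and ?z = "Leaf z"
  consider "xs = []" | "xs \<noteq> []" "ys = []" | "xs \<noteq> []" "ys \<noteq> []" "zs = []"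
    | "xs \<noteq> []" "ys \<noteq> []" "zs \<noteq> []" by blast
  then show ?case
  proof cases
    case 1
    have "lun (tree_of (ys @ zs @ [z])) \<star> (tr.idn Void || glue ys (zs @ [z])) \<star> al Void ?y
      (tree_of (zs @ [z]))
      = glue ys (zs @ [z]) \<star> lun (Node ?y (tree_of (zs @ [z]))) \<star> al Void ?y (tree_of (zs @ [z]))"
      using lun_nat[OF glue_in[OF assms(2) snoc(2)]] by (metis tr.cmp_assoc)
    then show ?thesis using 1 lun_Node[OF t(2,4)] by (simp add: glue_Nil)
  next
    case 2
    then show ?thesis using al_triangle[OF t(1,4)] by (simp add: glue_Nil glue_Nil2)
  next
    case 3
    have zz: "one [z] = tr.idn ?z" by simp
    have 1: "glue (xs @ ys) [z] \<star> (glue xs ys || tr.idn ?z) = glue xs ys || tr.idn ?z"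
      using tr.idn_cmp[OF par_in[OF glue_in[OF assms] tr.idn_in[OF z]]] glue_single[of "xs @ ys" z]
        tree_of_snoc[of "xs @ ys" z] 3 by simp
    have "(one xs || glue ys [z]) \<star> al ?x ?y ?z = al ?x ?y ?z"
      using 3 glue_single[of ys z] tr.idn_cmp[OF al_in[OF t(1,2) z]]
        par_idn[OF t(1), of "Node ?y ?z"] t(2) z by (simp add: tree_of_snoc)
    moreover have "glue xs (ys @ [z]) \<star> al ?x ?y ?z = glue xs ys || tr.idn ?z"
      using 3 ali(2)[OF t(1,2) z] tr.cmp_idn[OF par_in[OF glue_in[OF assms] tr.idn_in[OF z]]]
      by (simp add: glue_snoc tr.cmp_assoc)
    ultimately show ?thesis using 1 3 by simp
  next
    case 4
    let ?iz = "tr.idn ?z"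
    have nz: "Node ?w ?z \<in> trees" "Node ?y ?w \<in> trees" "Node ?x ?y \<in> trees" using t z by auto
    have Wz: "tree_of (zs @ [z]) = Node ?w ?z" using 4 by (simp add: tree_of_snoc)
    have oz: "one zs || ?iz = tr.idn (Node ?w ?z)" using par_idn[OF t(3) z] .
    \<comment> \<open>Both sides are compared after the associator that separates the last letter.\<close>
    let ?a = "al (Node ?x ?y) ?w ?z" and ?b = "al ?x ?y ?w || ?iz" and ?c = "al ?x (Node ?y ?w) ?z"
    have s: "glue xs (ys @ zs @ [z]) \<star> al ?x (tree_of (ys @ zs)) ?z = glue xs (ys @ zs) || ?iz"
      using glue_snoc_al[of xs "ys @ zs" z] 4 assms zs by simp
    have "glue (xs @ ys) (zs @ [z]) \<star> (glue xs ys || one (zs @ [z])) \<star> ?a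
      = (glue (xs @ ys) (zs @ [z]) \<star> al (tree_of (xs @ ys)) ?w ?z) \<star> ((glue xs ys || one zs) ||
        ?iz)"
      using al_nat[OF glue_in[OF assms] one_in[OF zs(1)] tr.idn_in[OF z]]
      by (simp only: Wz oz tr.cmp_assoc)
    also have "\<dots> = (glue (xs @ ys) zs \<star> (glue xs ys || one zs)) || ?iz"
      using glue_snoc_al[of "xs @ ys" zs z] 4 assms zs by (simp add: par_idn_cmp[OF z])
    also have "\<dots> = (glue xs (ys @ zs) || ?iz) \<star> ((one xs || glue ys zs) || ?iz) \<star> ?b"
      unfolding snoc(1)[OF zs(1)] by (simp only: par_idn_cmp[OF z])
    also have "\<dots> = glue xs (ys @ zs @ [z]) \<star> (al ?x (tree_of (ys @ zs)) ?z
        \<star> ((one xs || glue ys zs) || ?iz)) \<star> ?b"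
      unfolding s[symmetric] by (simp only: tr.cmp_assoc)
    also have "\<dots> = glue xs (ys @ zs @ [z]) \<star> (one xs || (glue ys zs || ?iz)) \<star> ?c \<star> ?b"
      unfolding al_nat[OF one_in[OF assms(1)] glue_in[OF assms(2) zs(1)] tr.idn_in[OF z]]
      by (simp only: tr.cmp_assoc)
    also have "glue ys zs || ?iz = glue ys (zs @ [z]) \<star> al ?y ?w ?z"
      using glue_snoc_al[of ys zs z] 4 assms zs by simp
    also have "glue xs (ys @ zs @ [z]) \<star> (one xs || (glue ys (zs @ [z]) \<star> al ?y ?w ?z)) \<star> ?c \<star> ?b
      = (glue xs (ys @ zs @ [z]) \<star> (one xs || glue ys (zs @ [z])) \<star> al ?x ?y (tree_of (zs @ [z])))
        \<star> ?a"
      unfolding Wz tr.cmp_assoc al_pentagon[OF t(1,2,3) z] by (simp only: idn_par_cmp[OF t(1)]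
        tr.cmp_assoc)
    finally have e: "(glue (xs @ ys) (zs @ [z]) \<star> (glue xs ys || one (zs @ [z]))) \<star> ?a = \<dots>"
      by (simp only: tr.cmp_assoc)
    \<comment> \<open>The associator is an epimorphism, once both sides are known to be well-typed.\<close>
    have "ys @ zs @ [z] \<in> words" "xs @ ys \<in> words" using assms zs by auto
    note m = tr.cmp_in[OF par_in[OF glue_in[OF assms] one_in[OF snoc(2)]] glue_in[OF this(2)
      snoc(2)]]
      tr.cmp_in[OF tr.cmp_in[OF al_in[OF t(1,2,4)] par_in[OF one_in[OF assms(1)] glue_in[OF
        assms(2) snoc(2)]]]
        glue_in[OF assms(1) this(1)]]
    show ?thesis
      using tr.iso_epi[OF iso_al[OF nz(3) t(3) z] _ _ e] m by (simp add: Wz)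
  qed
qed

text \<open>
  Arrows between words are compared as arrows between the bracketed words.
\<close>

fun embed :: "('o list \<times> 'm \<times> 'o list) option \<Rightarrow> ('o tree \<times> 'm \<times> 'o tree) option" where
  "embed None = None"
| "embed (Some (xs, f, ys)) = Some (tree_of xs, f, tree_of ys)"

fun pull :: "'o list \<Rightarrow> 'o list \<Rightarrow> ('o tree \<times> 'm \<times> 'o tree) option \<Rightarrow> ('o list \<times> 'm \<times> 'o list)
  option" where
  "pull xs ys None = None"
| "pull xs ys (Some (s, f, t)) = Some (xs, f, ys)"

lemma embed_in_iff: "embed f \<in> tr.Hm (tree_of xs) (tree_of ys) \<longleftrightarrow> f \<in> wd.Hm xs ys"
  by (cases f rule: embed.cases) (auto simp: tr.in_Hm wd.in_Hm tree_of_trees tr.None_Hm wd.None_Hm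
    dest: tree_of_inj)

lemmas embed_in = embed_in_iff[THEN iffD2]

lemma embed_valid: "embed f \<in> tr.Hm s t \<Longrightarrow> \<exists>xs ys. f \<in> wd.Hm xs ys"
  by (cases f rule: embed.cases) (auto simp: tr.in_Hm wd.in_Hm tree_of_trees tr.None_Hm)

lemma embed_inj: "f \<in> wd.Hm xs ys \<Longrightarrow> g \<in> wd.Hm xs ys \<Longrightarrow> embed f = embed g \<Longrightarrow> f = g"
  by (auto elim!: wd.HmE)

lemma embed_cmp: "f \<in> wd.Hm xs ys \<Longrightarrow> g \<in> wd.Hm ys zs \<Longrightarrow> embed (wd.cmp g f) = embed g \<star> embed f"
  using embed_in[of f xs ys] embed_in[of g ys zs] by (auto elim!: wd.HmE simp: wd.in_Hm)

lemma embed_idn: "xs \<in> words \<Longrightarrow> embed (wd.idn xs) = one xs"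
  using tree_of_trees by (auto simp: wd.idn_def tr.idn_def)

lemma embed_pull: "g \<in> tr.Hm (tree_of xs) (tree_of ys) \<Longrightarrow> embed (pull xs ys g) = g"
  by (auto elim!: tr.HmE)

lemma pull_in: "g \<in> tr.Hm (tree_of xs) (tree_of ys) \<Longrightarrow> pull xs ys g \<in> wd.Hm xs ys"
  using embed_in_iff embed_pull by metis

abbreviation unglue where "unglue xs ys \<equiv> tr.inv (Node (tree_of xs) (tree_of ys)) (tree_of (xs @
  ys)) (glue xs ys)"
lemmas unglue = tr.inv[OF iso_glue]

fun ten :: "('o list \<times> 'm \<times> 'o list) option \<Rightarrow> ('o list \<times> 'm \<times> 'o list) option
    \<Rightarrow> ('o list \<times> 'm \<times> 'o list) option" where
  "ten (Some (u, f, v)) (Some (u', g, v')) = pull (u @ u') (v @ v')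
    (glue v v' \<star> (embed (Some (u, f, v)) || embed (Some (u', g, v'))) \<star> unglue u u')"
| "ten None g = None"
| "ten f None = None"

definition lw where "lw X f = ten (wd.idn X) f"

definition rw where "rw f X = ten f (wd.idn X)"

lemma conj_glue:
  assumes "tr.iso s t p" "g \<in> tr.Hm s s'" "p' \<in> tr.Hm s' t'"
  shows "p' \<star> g \<star> tr.inv s t p \<in> tr.Hm t t'" "(p' \<star> g \<star> tr.inv s t p) \<star> p = p' \<star> g"
  using tr.cmp_in[OF tr.cmp_in[OF tr.inv(1)[OF assms(1)] assms(2)] assms(3)]
    tr.inv(2)[OF assms(1)] tr.cmp_idn[OF assms(2)] by (simp_all add: tr.cmp_assoc)

lemma ten_in_char:
  assumes "f \<in> wd.Hm u v" "g \<in> wd.Hm u' v'"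
  shows "ten f g \<in> wd.Hm (u @ u') (v @ v')"
    "embed (ten f g) \<star> glue u u' = glue v v' \<star> (embed f || embed g)"
proof -
  have w: "u \<in> words" "v \<in> words" "u' \<in> words" "v' \<in> words" using assms wd.Hm_V by blast+
  note g = conj_glue[OF iso_glue[OF w(1,3)] par_in[OF embed_in[OF assms(1)] embed_in[OF assms(2)]]
      glue_in[OF w(2,4)]]
  have l: "ten f g = pull (u @ u') (v @ v') (glue v v' \<star> (embed f || embed g) \<star> unglue u u')"
    using assms by (auto elim!: wd.HmE)
  show "ten f g \<in> wd.Hm (u @ u') (v @ v')"
    "embed (ten f g) \<star> glue u u' = glue v v' \<star> (embed f || embed g)"
    unfolding l embed_pull[OF g(1)] using pull_in[OF g(1)] g(2) .
qed

lemmas ten_in = ten_in_char(1) and ten_char = ten_in_char(2)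

lemma ten_None:
  assumes n: "\<not> ((\<exists>u v. f \<in> wd.Hm u v) \<and> (\<exists>u v. g \<in> wd.Hm u v))" shows "ten f g = None"
proof (cases "(f, g)" rule: ten.cases)
  case (1 u f' v u' g' v')
  have "embed f || embed g = None"
    by (rule par_NoneI) (use n embed_valid in blast)
  then show ?thesis using 1 by (simp add: tr.cmp_None)
qed auto

declare ten.simps(1) [simp del]

lemma tenE:
  assumes "ten f g \<in> wd.Hm a b"
  obtains u v u' v' where "f \<in> wd.Hm u v" "g \<in> wd.Hm u' v'" "a = u @ u'" "b = v @ v'"
proof -
  obtain u v u' v' where f: "f \<in> wd.Hm u v" "g \<in> wd.Hm u' v'"
    using ten_None assms wd.None_Hm by metis
  with wd.Hm_unique[OF ten_in[OF f] assms] that show ?thesis by metis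
qed

lemma idnE: "wd.idn X \<in> wd.Hm u v \<Longrightarrow> X \<in> words \<and> u = X \<and> v = X"
  by (auto simp: wd.idn_def wd.Hm_def split: if_splits)

lemma lw_in: "f \<in> wd.Hm u v \<Longrightarrow> X \<in> words \<Longrightarrow> lw X f \<in> wd.Hm (X @ u) (X @ v)"
  and rw_in: "f \<in> wd.Hm u v \<Longrightarrow> X \<in> words \<Longrightarrow> rw f X \<in> wd.Hm (u @ X) (v @ X)"
  unfolding lw_def rw_def using ten_in wd.idn_in by blast+

lemma lw_char: "f \<in> wd.Hm u v \<Longrightarrow> X \<in> words \<Longrightarrow>
    embed (lw X f) \<star> glue X u = glue X v \<star> (one X || embed f)"
  and rw_char: "f \<in> wd.Hm u v \<Longrightarrow> X \<in> words \<Longrightarrow>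
    embed (rw f X) \<star> glue u X = glue v X \<star> (embed f || one X)"
  unfolding lw_def rw_def using ten_char wd.idn_in embed_idn by metis+

lemma cmpE:
  assumes "wd.cmp g f \<in> wd.Hm a b"
  obtains y where "f \<in> wd.Hm a y" "g \<in> wd.Hm y b"
proof -
  obtain x y z where f: "f \<in> wd.Hm x y" "g \<in> wd.Hm y z"
    using assms wd.None_Hm by (metis wd.cmp_NoneI)
  with wd.Hm_unique[OF wd.cmp_in[OF f] assms] that show ?thesis by metis
qed

definition ok where "ok f \<longleftrightarrow> f = None \<or> (\<exists>x y. f \<in> wd.Hm x y)"

lemma ok: "ok (ten f g)" "ok (wd.cmp g f)" "ok (wd.idn X)"
  unfolding ok_def using ten_None[of f g] ten_in[of f _ _ g] wd.cmp_NoneI[of f g]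
    wd.cmp_in[of f _ _ g] wd.idn_in[of X] by (blast, blast, auto simp: wd.idn_def)

text \<open>
  Each side of an equation is \<open>None\<close> or well-typed, so the equation may be proved under the
  assumption that one of the sides is well-typed.
\<close>

lemma ok_eqI:
  assumes "ok f" "ok g" "\<And>x y. f \<in> wd.Hm x y \<Longrightarrow> f = g" "\<And>x y. g \<in> wd.Hm x y \<Longrightarrow> f = g"
  shows "f = g"
  using assms unfolding ok_def by metis

text \<open>
  The pattern of all equations between arrows of words: compare the composites with a gluing
  isomorphism, over which tensor products and braidings move to the bracketed factors.
\<close>

lemma eq_via:
  assumes "tr.iso s (tree_of x) p" "f \<in> wd.Hm x y" "g \<in> wd.Hm x y" "embed f \<star> p = embed g \<star> p"
  shows "f = g"
  using embed_inj[OF assms(2,3)] tr.iso_epi[OF assms(1) _ _ assms(4)] embed_in assms(2,3) by blast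

lemma ten_cmp:
  assumes f: "f \<in> wd.Hm x y" "f' \<in> wd.Hm y z" and g: "g \<in> wd.Hm u v" "g' \<in> wd.Hm v w"
  shows "wd.cmp (ten f' g') (ten f g) = ten (wd.cmp f' f) (wd.cmp g' g)"
proof -
  have o: "x \<in> words" "u \<in> words" using f g wd.Hm_V by blast+
  note t = ten_in[OF f(1) g(1)] ten_in[OF f(2) g(2)]
  show ?thesis
  proof (rule eq_via[OF iso_glue[OF o] wd.cmp_in[OF t] ten_in[OF wd.cmp_in[OF f] wd.cmp_in[OF g]]])
    have "embed (wd.cmp (ten f' g') (ten f g)) \<star> glue x u
        = (embed (ten f' g') \<star> glue y v) \<star> (embed f || embed g)"
      unfolding embed_cmp[OF t] using ten_char[OF f(1) g(1)] by (metis tr.cmp_assoc)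
    also have "\<dots> = embed (ten (wd.cmp f' f) (wd.cmp g' g)) \<star> glue x u"
      unfolding ten_char[OF f(2) g(2)] ten_char[OF wd.cmp_in[OF f] wd.cmp_in[OF g]]
        embed_cmp[OF f] embed_cmp[OF g] by (simp only: tr.cmp_assoc par_cmp)
    finally show "embed (wd.cmp (ten f' g') (ten f g)) \<star> glue x u
      = embed (ten (wd.cmp f' f) (wd.cmp g' g)) \<star> glue x u" .
  qed
qed

lemma ten_idn: "ten (wd.idn X) (wd.idn Y) = wd.idn (X @ Y)"
proof (rule ok_eqI[OF ok(1,3)])
  have e: "ten (wd.idn X) (wd.idn Y) = wd.idn (X @ Y)" if o: "X \<in> words" "Y \<in> words"
  proof (rule eq_via[OF iso_glue[OF o] ten_in[OF wd.idn_in[OF o(1)] wd.idn_in[OF o(2)]] wd.idn_in])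
    have "tree_of X \<in> trees" "tree_of Y \<in> trees" using o tree_of_trees by blast+
    then show "embed (ten (wd.idn X) (wd.idn Y)) \<star> glue X Y = embed (wd.idn (X @ Y)) \<star> glue X Y"
      using ten_char[OF wd.idn_in[OF o(1)] wd.idn_in[OF o(2)]] o glue_in[OF o]
      by (simp add: embed_idn par_idn tr.idn_cmp tr.cmp_idn)
  qed (use o in simp)
  fix a b
  show "ten (wd.idn X) (wd.idn Y) = wd.idn (X @ Y)" if "ten (wd.idn X) (wd.idn Y) \<in> wd.Hm a b"
    using that e by (elim tenE) (blast dest: idnE)
  show "ten (wd.idn X) (wd.idn Y) = wd.idn (X @ Y)" if "wd.idn (X @ Y) \<in> wd.Hm a b"
    using idnE[OF that] e by simp
qed

lemma ten_assoc_typed: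
  assumes f: "f \<in> wd.Hm x x'" and g: "g \<in> wd.Hm y y'" and h: "h \<in> wd.Hm z z'"
  shows "ten (ten f g) h = ten f (ten g h)"
proof -
  have w: "x \<in> words" "y \<in> words" "z \<in> words" and w': "x' \<in> words" "y' \<in> words" "z' \<in> words"
    and yz: "y @ z \<in> words" using f g h wd.Hm_V by auto
  have t: "tree_of x \<in> trees" "tree_of y \<in> trees" "tree_of z \<in> trees"
    unfolding tree_of_trees[symmetric] using w .
  note fg = ten_in[OF f g] and gh = ten_in[OF g h] and e = embed_in[OF f] embed_in[OF g]
    embed_in[OF h]
  let ?f = "embed f" and ?g = "embed g" and ?h = "embed h"
  let ?al = "al (tree_of x) (tree_of y) (tree_of z)"
  let ?p = "glue x (y @ z) \<star> (one x || glue y z) \<star> ?al"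
  have "embed (ten f (ten g h)) \<star> ?p
      = glue x' (y' @ z') \<star> ((?f || embed (ten g h)) \<star> (one x || glue y z)) \<star> ?al"
    using ten_char[OF f gh] by (metis tr.cmp_assoc)
  also have "\<dots> = glue x' (y' @ z') \<star> (?f || (embed (ten g h) \<star> glue y z)) \<star> ?al"
    by (simp only: par_cmp[symmetric] tr.cmp_idn[OF e(1)])
  also have "\<dots> = glue x' (y' @ z') \<star> ((one x' \<star> ?f) || (glue y' z' \<star> (?g || ?h))) \<star> ?al"
    unfolding ten_char[OF g h] tr.idn_cmp[OF e(1)] ..
  also have "\<dots> = (glue x' (y' @ z') \<star> (one x' || glue y' z')
      \<star> al (tree_of x') (tree_of y') (tree_of z')) \<star> ((?f || ?g) || ?h)"
    using al_nat[OF e] by (simp only: par_cmp tr.cmp_assoc)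
  also have "\<dots> = glue (x' @ y') z' \<star> ((glue x' y' \<star> (?f || ?g)) || (one z' \<star> ?h))"
    unfolding glue_assoc[OF w', symmetric] by (simp only: par_cmp tr.cmp_assoc)
  also have "\<dots> = glue (x' @ y') z' \<star> ((embed (ten f g) \<star> glue x y) || (?h \<star> one z))"
    unfolding ten_char[OF f g] tr.idn_cmp[OF e(3)] tr.cmp_idn[OF e(3)] ..
  also have "\<dots> = (embed (ten (ten f g) h) \<star> glue (x @ y) z) \<star> (glue x y || one z)"
    unfolding ten_char[OF fg h] by (simp only: par_cmp tr.cmp_assoc)
  also have "\<dots> = embed (ten (ten f g) h) \<star> ?p"
    unfolding glue_assoc[OF w, symmetric] by (simp only: tr.cmp_assoc)
  finally have c: "embed (ten (ten f g) h) \<star> ?p = embed (ten f (ten g h)) \<star> ?p" by simp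
  have p: "tr.iso (Node (Node (tree_of x) (tree_of y)) (tree_of z)) (tree_of (x @ y @ z)) ?p"
    using tr.iso_cmp[OF tr.iso_cmp[OF iso_al[OF t] iso_par[OF tr.iso_idn[OF t(1)] iso_glue[OF
      w(2,3)]]]
        iso_glue[OF w(1) yz]] by simp
  have "ten (ten f g) h \<in> wd.Hm (x @ y @ z) (x' @ y' @ z')" using ten_in[OF fg h] by simp
  from eq_via[OF p this ten_in[OF f gh] c] show ?thesis .
qed

lemma ten_assoc: "ten (ten f g) h = ten f (ten g h)"
proof (rule ok_eqI[OF ok(1,1)])
  fix a b
  show "ten (ten f g) h = ten f (ten g h)" if "ten (ten f g) h \<in> wd.Hm a b"
    using that by (elim tenE) (rule ten_assoc_typed)
  show "ten (ten f g) h = ten f (ten g h)" if "ten f (ten g h) \<in> wd.Hm a b"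
    using that by (elim tenE) (rule ten_assoc_typed)
qed

lemma lw_cmp: "lw X (wd.cmp g f) = wd.cmp (lw X g) (lw X f)"
  unfolding lw_def
proof (rule ok_eqI[OF ok(1,2)])
  let ?i = "wd.idn X"
  have e: "ten ?i (wd.cmp g f) = wd.cmp (ten ?i g) (ten ?i f)"
    if "f \<in> wd.Hm x y" "g \<in> wd.Hm y z" "X \<in> words" for x y z
    using ten_cmp[OF wd.idn_in[OF that(3)] wd.idn_in[OF that(3)] that(1,2)]
      wd.idn_cmp[OF wd.idn_in[OF that(3)]] by simp
  fix a b
  show "ten ?i (wd.cmp g f) = wd.cmp (ten ?i g) (ten ?i f)" if "ten ?i (wd.cmp g f) \<in> wd.Hm a b"
    using that e by (elim tenE cmpE) (blast dest: idnE)
  show "ten ?i (wd.cmp g f) = wd.cmp (ten ?i g) (ten ?i f)"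
    if "wd.cmp (ten ?i g) (ten ?i f) \<in> wd.Hm a b"
    using that e by (elim tenE cmpE) (auto dest!: idnE)
qed

lemma rw_cmp: "rw (wd.cmp g f) X = wd.cmp (rw g X) (rw f X)"
  unfolding rw_def
proof (rule ok_eqI[OF ok(1,2)])
  let ?i = "wd.idn X"
  have e: "ten (wd.cmp g f) ?i = wd.cmp (ten g ?i) (ten f ?i)"
    if "f \<in> wd.Hm x y" "g \<in> wd.Hm y z" "X \<in> words" for x y z
    using ten_cmp[OF that(1,2) wd.idn_in[OF that(3)] wd.idn_in[OF that(3)]]
      wd.idn_cmp[OF wd.idn_in[OF that(3)]] by simp
  fix a b
  show "ten (wd.cmp g f) ?i = wd.cmp (ten g ?i) (ten f ?i)" if "ten (wd.cmp g f) ?i \<in> wd.Hm a b"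
    using that e by (elim tenE cmpE) (blast dest: idnE)
  show "ten (wd.cmp g f) ?i = wd.cmp (ten g ?i) (ten f ?i)"
    if "wd.cmp (ten g ?i) (ten f ?i) \<in> wd.Hm a b"
    using that e by (elim tenE cmpE) (auto dest!: idnE)
qed

lemma lw_lw: "lw X (lw Y f) = lw (X @ Y) f" and rw_rw: "rw (rw f X) Y = rw f (X @ Y)"
  and lw_rw: "lw X (rw f Y) = rw (lw X f) Y"
  by (simp_all add: lw_def rw_def ten_assoc flip: ten_idn)

lemma lw_idn: "lw X (wd.idn x) = wd.idn (X @ x)" and rw_idn: "rw (wd.idn x) X = wd.idn (x @ X)"
  by (simp_all add: lw_def rw_def ten_idn)

lemma Nil_lw:
  assumes f: "f \<in> wd.Hm x y" shows "lw [] f = f"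
proof -
  have w: "[] \<in> words" "x \<in> words" using f wd.Hm_V by auto
  have g: "lw [] f \<in> wd.Hm x y" using lw_in[OF f w(1)] by simp
  have p: "tr.iso (Node Void (tree_of x)) (tree_of x) (glue [] x)" using iso_glue[OF w] by simp
  show ?thesis
    using eq_via[OF p g f] lw_char[OF f w(1)] lun_nat[OF embed_in[OF f]] by (simp add: glue_Nil)
qed

lemma rw_Nil:
  assumes f: "f \<in> wd.Hm x y" shows "rw f [] = f"
proof -
  have w: "[] \<in> words" "x \<in> words" using f wd.Hm_V by auto
  have g: "rw f [] \<in> wd.Hm x y" using rw_in[OF f w(1)] by simp
  have p: "tr.iso (Node (tree_of x) Void) (tree_of x) (glue x [])" using iso_glue[OF w(2,1)] by simp
  show ?thesis
    using eq_via[OF p g f] rw_char[OF f w(1)] run_nat[OF embed_in[OF f]] by (simp add: glue_Nil2)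
qed

lemma word_interchange:
  assumes f: "f \<in> wd.Hm x y" and g: "g \<in> wd.Hm u v"
  shows "wd.cmp (rw f v) (lw x g) = ten f g" "wd.cmp (lw y g) (rw f u) = ten f g"
proof -
  have w: "x \<in> words" "y \<in> words" "u \<in> words" "v \<in> words" using f g wd.Hm_V by auto
  show "wd.cmp (rw f v) (lw x g) = ten f g"
    unfolding lw_def rw_def ten_cmp[OF wd.idn_in[OF w(1)] f g wd.idn_in[OF w(4)]]
    using wd.cmp_idn[OF f] wd.idn_cmp[OF g] by simp
  show "wd.cmp (lw y g) (rw f u) = ten f g"
    unfolding lw_def rw_def ten_cmp[OF f wd.idn_in[OF w(2)] wd.idn_in[OF w(3)] g]
    using wd.idn_cmp[OF f] wd.cmp_idn[OF g] by simp
qed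

end

section \<open>The braiding on words\<close>

context category
begin

lemma inverse_arrows_unique:
  assumes o: "X \<in> Obj C" "Y \<in> Obj C"
    and g: "inverse_arrows C X Y f g" and h: "inverse_arrows C X Y f h"
  shows "g = h"
proof -
  have "(g \<cdot> f) \<cdot> h = g \<cdot> (f \<cdot> h)"
    by (rule Comp_assoc[of Y X Y X]) (use o g h in \<open>auto simp: inverse_arrows_def\<close>)
  with o g h show ?thesis by (simp add: inverse_arrows_def Id_Comp Comp_Id)
qed

lemma Inv_eq:
  assumes "X \<in> Obj C" "Y \<in> Obj C" "inverse_arrows C X Y f g" shows "Inv C X Y f = g"
  unfolding Inv_def using inverse_arrows_unique assms by blast

lemma Inv_inverse:
  assumes "X \<in> Obj C" "Y \<in> Obj C" "iso_arr C X Y f" shows "inverse_arrows C X Y f (Inv C X Y f)"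
  using assms Inv_eq unfolding iso_arr_def by metis

end

lemma (in typed_arrows) inv_Some:
  assumes "iso_arr C (T x) (T y) f" "x \<in> V" "y \<in> V"
  shows "inv x y (Some (x, f, y)) = Some (y, Inv C (T x) (T y) f, x)"
proof -
  let ?g = "Some (y, Inv C (T x) (T y) f, x)"
  have "inverse_arrows C (T x) (T y) f (Inv C (T x) (T y) f)"
    using Inv_inverse[OF T_Obj T_Obj] assms by blast
  then have g: "?g \<in> Hm y x" "cmp ?g (Some (x, f, y)) = idn x" "cmp (Some (x, f, y)) ?g = idn y"
    using assms by (auto simp: in_Hm idn_def inverse_arrows_def)
  note i = inv[OF iso_arr[OF assms]]
  show ?thesis
    using iso_epi[OF iso_arr[OF assms] i(1) g(1)] i(2) g(2) by simp
qed

context braided_monoidal_category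
begin

lemma ali_eq:
  assumes "s \<in> trees" "t \<in> trees" "u \<in> trees"
  shows "ali s t u = Some (Node s (Node t u), AssocInv C (ev C s) (ev C t) (ev C u), Node (Node s
    t) u)"
  unfolding al_def AssocInv_def using assms by (subst tr.inv_Some) (auto simp: Assoc_iso tr.T_Obj)

definition br where "br s t = Some (Node s t, Braid C (ev C s) (ev C t), Node t s)"

lemma iso_br: "s \<in> trees \<Longrightarrow> t \<in> trees \<Longrightarrow> tr.iso (Node s t) (Node t s) (br s t)"
  unfolding br_def by (rule tr.iso_arr) (auto simp: tr.T_Obj Braid_iso)

lemmas br_in = tr.iso_in[OF iso_br]
abbreviation bri where "bri s t \<equiv> tr.inv (Node s t) (Node t s) (br s t)"
lemmas bri = tr.inv[OF iso_br]

lemma br_nat: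
  assumes "f \<in> tr.Hm s s'" "g \<in> tr.Hm t t'"
  shows "br s' t' \<star> (f || g) = (g || f) \<star> br s t"
proof -
  have "s \<in> trees" "t \<in> trees" "s' \<in> trees" "t' \<in> trees"
    using assms tr.Hm_V by blast+
  note br_in[OF this(1,2)] br_in[OF this(3,4)] par_in[OF assms] par_in[OF assms(2,1)]
  with assms show ?thesis
    by (auto elim!: tr.HmE simp: br_def tr.in_Hm tr.T_Obj Braid_natural)
qed

lemma br_hexagon1:
  assumes o: "x \<in> trees" "y \<in> trees" "z \<in> trees"
  shows "al y z x \<star> br x (Node y z) \<star> al x y z
    = (tr.idn y || br x z) \<star> al y x z \<star> (br x y || tr.idn z)"
proof -
  have n: "Node y z \<in> trees" using o by auto
  note m = al_in[OF o(1,2,3)] al_in[OF o(2,1,3)] al_in[OF o(2,3,1)] br_in[OF o(1) n]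
    br_in[OF o(1,2)] br_in[OF o(1,3)] tr.idn_in[OF o(2)] tr.idn_in[OF o(3)]
    par_in[OF tr.idn_in[OF o(2)] br_in[OF o(1,3)]] par_in[OF br_in[OF o(1,2)] tr.idn_in[OF o(3)]]
    tr.cmp_in[OF al_in[OF o(1,2,3)] br_in[OF o(1) n]]
    tr.cmp_in[OF par_in[OF br_in[OF o(1,2)] tr.idn_in[OF o(3)]] al_in[OF o(2,1,3)]]
  then show ?thesis
    using o hexagon1[of "ev C x" "ev C y" "ev C z"]
    by (simp add: al_def br_def tr.idn_def tr.in_Hm tr.T_Obj)
qed

lemma br_hexagon2:
  assumes o: "x \<in> trees" "y \<in> trees" "z \<in> trees"
  shows "ali z x y \<star> br (Node x y) z \<star> ali x y z
    = (br x z || tr.idn y) \<star> ali x z y \<star> (tr.idn x || br y z)"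
proof -
  have n: "Node x y \<in> trees" using o by auto
  note m = ali(1)[OF o(1,2,3)] ali(1)[OF o(1,3,2)] ali(1)[OF o(3,1,2)] br_in[OF n o(3)]
    br_in[OF o(1,3)] br_in[OF o(2,3)] tr.idn_in[OF o(1)] tr.idn_in[OF o(2)]
    par_in[OF tr.idn_in[OF o(1)] br_in[OF o(2,3)]] par_in[OF br_in[OF o(1,3)] tr.idn_in[OF o(2)]]
    tr.cmp_in[OF ali(1)[OF o(1,2,3)] br_in[OF n o(3)]]
    tr.cmp_in[OF par_in[OF tr.idn_in[OF o(1)] br_in[OF o(2,3)]] ali(1)[OF o(1,3,2)]]
  then show ?thesis
    using o hexagon2[of "ev C x" "ev C y" "ev C z"]
    unfolding ali_eq[OF o(1,2,3)] ali_eq[OF o(1,3,2)] ali_eq[OF o(3,1,2)]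
    by (simp add: br_def tr.idn_def tr.in_Hm tr.T_Obj)
qed

definition wB where
  "wB X Y = pull (X @ Y) (Y @ X) (glue Y X \<star> br (tree_of X) (tree_of Y) \<star> unglue X Y)"

definition wBi where
  "wBi X Y = pull (Y @ X) (X @ Y) (glue X Y \<star> bri (tree_of X) (tree_of Y) \<star> unglue Y X)"

lemma wB:
  assumes o: "X \<in> words" "Y \<in> words"
  shows "wB X Y \<in> wd.Hm (X @ Y) (Y @ X)" "embed (wB X Y) \<star> glue X Y = glue Y X \<star> br (tree_of X)
    (tree_of Y)"
    "wBi X Y \<in> wd.Hm (Y @ X) (X @ Y)" "embed (wBi X Y) \<star> glue Y X = glue X Y \<star> bri (tree_of X)
      (tree_of Y)"
proof -
  have t: "tree_of X \<in> trees" "tree_of Y \<in> trees" using o tree_of_trees by blast+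
  note g = conj_glue[OF iso_glue[OF o] br_in[OF t] glue_in[OF o(2,1)]]
    and h = conj_glue[OF iso_glue[OF o(2,1)] bri(1)[OF t] glue_in[OF o]]
  show "wB X Y \<in> wd.Hm (X @ Y) (Y @ X)" "embed (wB X Y) \<star> glue X Y = glue Y X \<star> br (tree_of X)
    (tree_of Y)"
    unfolding wB_def embed_pull[OF g(1)] using pull_in[OF g(1)] g(2) .
  show "wBi X Y \<in> wd.Hm (Y @ X) (X @ Y)" "embed (wBi X Y) \<star> glue Y X = glue X Y \<star> bri (tree_of X)
    (tree_of Y)"
    unfolding wBi_def embed_pull[OF h(1)] using pull_in[OF h(1)] h(2) .
qed

lemma wB_inv:
  assumes o: "X \<in> words" "Y \<in> words"
  shows "wd.cmp (wB X Y) (wBi X Y) = wd.idn (Y @ X)" "wd.cmp (wBi X Y) (wB X Y) = wd.idn (X @ Y)"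
proof -
  have t: "tree_of X \<in> trees" "tree_of Y \<in> trees" and c: "X @ Y \<in> words" "Y @ X \<in> words"
    unfolding tree_of_trees[symmetric] using o by auto
  note b = wB[OF o]
  show "wd.cmp (wB X Y) (wBi X Y) = wd.idn (Y @ X)"
  proof (rule eq_via[OF iso_glue[OF o(2,1)] wd.cmp_in[OF b(3,1)] wd.idn_in[OF c(2)]])
    have "embed (wd.cmp (wB X Y) (wBi X Y)) \<star> glue Y X = glue Y X \<star> br (tree_of X) (tree_of Y) \<star>
      bri (tree_of X) (tree_of Y)"
      unfolding embed_cmp[OF b(3,1)] using b(2,4) by (metis tr.cmp_assoc)
    then show "embed (wd.cmp (wB X Y) (wBi X Y)) \<star> glue Y X = embed (wd.idn (Y @ X)) \<star> glue Y X"
      using bri(3)[OF t] tr.cmp_idn[OF glue_in[OF o(2,1)]] tr.idn_cmp[OF glue_in[OF o(2,1)]]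
        embed_idn[OF c(2)]
      by simp
  qed
  show "wd.cmp (wBi X Y) (wB X Y) = wd.idn (X @ Y)"
  proof (rule eq_via[OF iso_glue[OF o] wd.cmp_in[OF b(1,3)] wd.idn_in[OF c(1)]])
    have "embed (wd.cmp (wBi X Y) (wB X Y)) \<star> glue X Y = glue X Y \<star> bri (tree_of X) (tree_of Y) \<star>
      br (tree_of X) (tree_of Y)"
      unfolding embed_cmp[OF b(1,3)] using b(2,4) by (metis tr.cmp_assoc)
    then show "embed (wd.cmp (wBi X Y) (wB X Y)) \<star> glue X Y = embed (wd.idn (X @ Y)) \<star> glue X Y"
      using bri(2)[OF t] tr.cmp_idn[OF glue_in[OF o]] tr.idn_cmp[OF glue_in[OF o]] embed_idn[OF
        c(1)]
      by simp
  qed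
qed

lemma wB_nat:
  assumes f: "f \<in> wd.Hm x y" and g: "g \<in> wd.Hm u v"
  shows "wd.cmp (wB y v) (ten f g) = wd.cmp (ten g f) (wB x u)"
proof -
  have w: "x \<in> words" "y \<in> words" "u \<in> words" "v \<in> words" using f g wd.Hm_V by auto
  note h = ten_in[OF f g] wB(1)[OF w(2,4)] wB(1)[OF w(1,3)] ten_in[OF g f]
  show ?thesis
  proof (rule eq_via[OF iso_glue[OF w(1,3)] wd.cmp_in[OF h(1,2)] wd.cmp_in[OF h(3,4)]])
    have "embed (wd.cmp (wB y v) (ten f g)) \<star> glue x u
        = glue v y \<star> br (tree_of y) (tree_of v) \<star> (embed f || embed g)"
      unfolding embed_cmp[OF h(1,2)] using ten_char[OF f g] wB(2)[OF w(2,4)] by (metis tr.cmp_assoc)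
    also have "\<dots> = glue v y \<star> (embed g || embed f) \<star> br (tree_of x) (tree_of u)"
      using br_nat[OF embed_in[OF f] embed_in[OF g]] by simp
    also have "\<dots> = embed (wd.cmp (ten g f) (wB x u)) \<star> glue x u"
      unfolding embed_cmp[OF h(3,4)] using ten_char[OF g f] wB(2)[OF w(1,3)] by (metis tr.cmp_assoc)
    finally show "embed (wd.cmp (wB y v) (ten f g)) \<star> glue x u
      = embed (wd.cmp (ten g f) (wB x u)) \<star> glue x u" .
  qed
qed

text \<open>
  After gluing the three words, this is the first hexagon; \<open>wB_cat_l\<close> is the second.
\<close>

lemma wB_cat_r:
  assumes o: "X \<in> words" "Y \<in> words" "Z \<in> words"
  shows "wB X (Y @ Z) = wd.cmp (lw Y (wB X Z)) (rw (wB X Y) Z)"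
proof -
  have t: "tree_of X \<in> trees" "tree_of Y \<in> trees" "tree_of Z \<in> trees" using o tree_of_trees by
    blast+
  have c: "X @ Y \<in> words" "Y @ Z \<in> words" using o by auto
  note XZ = wB[OF o(1,3)] and XY = wB[OF o(1,2)] and XYZ = wB[OF o(1) c(2)]
  have h: "lw Y (wB X Z) \<in> wd.Hm (Y @ X @ Z) (Y @ Z @ X)"
    "rw (wB X Y) Z \<in> wd.Hm (X @ Y @ Z) (Y @ X @ Z)" "wB X (Y @ Z) \<in> wd.Hm (X @ Y @ Z) (Y @ Z @ X)"
    using lw_in[OF XZ(1) o(2)] rw_in[OF XY(1) o(3)] XYZ(1) by simp_all
  let ?a = "al (tree_of X) (tree_of Y) (tree_of Z)" and ?b = "br (tree_of X) (tree_of Y)" and ?c =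
    "br (tree_of X) (tree_of Z)"
  let ?p = "glue X (Y @ Z) \<star> (one X || glue Y Z) \<star> ?a"
  have "embed (wB X (Y @ Z)) \<star> ?p
      = glue (Y @ Z) X \<star> (br (tree_of X) (tree_of (Y @ Z)) \<star> (one X || glue Y Z)) \<star> ?a"
    using XYZ(2) by (metis tr.cmp_assoc)
  also have "\<dots> = (glue (Y @ Z) X \<star> (glue Y Z || one X)) \<star> br (tree_of X) (Node (tree_of Y)
    (tree_of Z)) \<star> ?a"
    unfolding br_nat[OF one_in[OF o(1)] glue_in[OF o(2,3)]] by (simp only: tr.cmp_assoc)
  also have "\<dots> = glue Y (Z @ X) \<star> (one Y || glue Z X) \<star>
      (al (tree_of Y) (tree_of Z) (tree_of X) \<star> br (tree_of X) (Node (tree_of Y) (tree_of Z)) \<star> ?a)"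
    unfolding glue_assoc[OF o(2,3,1)] by (simp only: tr.cmp_assoc)
  also have "\<dots> = glue Y (Z @ X) \<star> (one Y || (glue Z X \<star> ?c)) \<star> al (tree_of Y) (tree_of X) (tree_of
    Z) \<star> (?b || one Z)"
    unfolding br_hexagon1[OF t] by (simp only: idn_par_cmp[OF t(2)] tr.cmp_assoc)
  finally have 1: "embed (wB X (Y @ Z)) \<star> ?p = \<dots>" .
  have "embed (wd.cmp (lw Y (wB X Z)) (rw (wB X Y) Z)) \<star> ?p
    = embed (lw Y (wB X Z)) \<star> (embed (rw (wB X Y) Z) \<star> glue (X @ Y) Z) \<star> (glue X Y || one Z)"
    unfolding embed_cmp[OF h(2,1)] glue_assoc[OF o, symmetric] by (simp only: tr.cmp_assoc)
  also have "\<dots> = embed (lw Y (wB X Z)) \<star> glue (Y @ X) Z \<star> ((embed (wB X Y) \<star> glue X Y) || one Z)"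
    unfolding rw_char[OF XY(1) o(3)] by (simp only: par_idn_cmp[OF t(3)] tr.cmp_assoc)
  also have "\<dots> = embed (lw Y (wB X Z)) \<star> (glue (Y @ X) Z \<star> (glue Y X || one Z)) \<star> (?b || one Z)"
    unfolding XY(2) by (simp only: par_idn_cmp[OF t(3)] tr.cmp_assoc)
  also have "\<dots> = (embed (lw Y (wB X Z)) \<star> glue Y (X @ Z)) \<star> (one Y || glue X Z) \<star> al (tree_of Y)
    (tree_of X) (tree_of Z)
      \<star> (?b || one Z)"
    unfolding glue_assoc[OF o(2,1,3)] by (simp only: tr.cmp_assoc)
  also have "\<dots> = glue Y (Z @ X) \<star> (one Y || (embed (wB X Z) \<star> glue X Z)) \<star> al (tree_of Y) (tree_of
    X) (tree_of Z) \<star> (?b || one Z)"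
    unfolding lw_char[OF XZ(1) o(2)] by (simp only: idn_par_cmp[OF t(2)] tr.cmp_assoc)
  finally have 2: "embed (wd.cmp (lw Y (wB X Z)) (rw (wB X Y) Z)) \<star> ?p = embed (wB X (Y @ Z)) \<star> ?p"
    unfolding 1 XZ(2) .
  have p: "tr.iso (Node (Node (tree_of X) (tree_of Y)) (tree_of Z)) (tree_of (X @ Y @ Z)) ?p"
    using tr.iso_cmp[OF tr.iso_cmp[OF iso_al[OF t] iso_par[OF tr.iso_idn[OF t(1)] iso_glue[OF
      o(2,3)]]]
        iso_glue[OF o(1) c(2)]] by simp
  show ?thesis using eq_via[OF p h(3) wd.cmp_in[OF h(2,1)]] 2 by simp
qed

lemma wB_cat_l:
  assumes o: "X \<in> words" "Y \<in> words" "Z \<in> words"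
  shows "wB (X @ Y) Z = wd.cmp (rw (wB X Z) Y) (lw X (wB Y Z))"
proof -
  have t: "tree_of X \<in> trees" "tree_of Y \<in> trees" "tree_of Z \<in> trees" using o tree_of_trees by
    blast+
  have c: "X @ Y \<in> words" "Y @ Z \<in> words" "Z @ X \<in> words" using o by auto
  note XZ = wB[OF o(1,3)] and YZ = wB[OF o(2,3)] and XYZ = wB[OF c(1) o(3)]
  have h: "rw (wB X Z) Y \<in> wd.Hm (X @ Z @ Y) (Z @ X @ Y)"
    "lw X (wB Y Z) \<in> wd.Hm (X @ Y @ Z) (X @ Z @ Y)" "wB (X @ Y) Z \<in> wd.Hm (X @ Y @ Z) (Z @ X @ Y)"
    using rw_in[OF XZ(1) o(2)] lw_in[OF YZ(1) o(1)] XYZ(1) by simp_all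
  have unglue_assoc: "glue x (y @ z) \<star> (one x || glue y z) = glue (x @ y) z \<star> (glue x y || one z)
    \<star> ali (tree_of x) (tree_of y) (tree_of z)"
    if w: "x \<in> words" "y \<in> words" "z \<in> words" for x y z
  proof -
    have tt: "tree_of x \<in> trees" "tree_of y \<in> trees" "tree_of z \<in> trees" using w tree_of_trees by
      blast+
    have y: "y @ z \<in> words" using w by simp
    have i: "glue x (y @ z) \<star> (one x || glue y z) \<in> tr.Hm (Node (tree_of x) (Node (tree_of y)
      (tree_of z))) (tree_of (x @ y @ z))"
      using tr.cmp_in[OF par_in[OF one_in[OF w(1)] glue_in[OF w(2,3)]] glue_in[OF w(1) y]] .
    have "glue (x @ y) z \<star> (glue x y || one z) \<star> ali (tree_of x) (tree_of y) (tree_of z)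
      = (glue x (y @ z) \<star> (one x || glue y z)) \<star> al (tree_of x) (tree_of y) (tree_of z) \<star> ali
        (tree_of x) (tree_of y) (tree_of z)"
      using glue_assoc[OF w] by (metis tr.cmp_assoc)
    then show ?thesis unfolding ali(3)[OF tt] using tr.cmp_idn[OF i] by simp
  qed
  let ?a = "ali (tree_of X) (tree_of Y) (tree_of Z)" and ?b = "br (tree_of Y) (tree_of Z)" and ?c
    = "br (tree_of X) (tree_of Z)"
  let ?p = "glue X (Y @ Z) \<star> (one X || glue Y Z)"
  have "embed (wB (X @ Y) Z) \<star> ?p
      = glue Z (X @ Y) \<star> (br (tree_of (X @ Y)) (tree_of Z) \<star> (glue X Y || one Z)) \<star> ?a"
    unfolding unglue_assoc[OF o] using XYZ(2) by (metis tr.cmp_assoc)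
  also have "\<dots> = (glue Z (X @ Y) \<star> (one Z || glue X Y)) \<star> br (Node (tree_of X) (tree_of Y))
    (tree_of Z) \<star> ?a"
    unfolding br_nat[OF glue_in[OF o(1,2)] one_in[OF o(3)]] by (simp only: tr.cmp_assoc)
  also have "\<dots> = glue (Z @ X) Y \<star> (glue Z X || one Y) \<star>
      (ali (tree_of Z) (tree_of X) (tree_of Y) \<star> br (Node (tree_of X) (tree_of Y)) (tree_of Z) \<star>
        ?a)"
    unfolding unglue_assoc[OF o(3,1,2)] by (simp only: tr.cmp_assoc)
  also have "\<dots> = glue (Z @ X) Y \<star> ((glue Z X \<star> ?c) || one Y) \<star> ali (tree_of X) (tree_of Z)
    (tree_of Y) \<star> (one X || ?b)"
    unfolding br_hexagon2[OF t] by (simp only: par_idn_cmp[OF t(2)] tr.cmp_assoc)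
  finally have 1: "embed (wB (X @ Y) Z) \<star> ?p = \<dots>" .
  have "embed (wd.cmp (rw (wB X Z) Y) (lw X (wB Y Z))) \<star> ?p
    = embed (rw (wB X Z) Y) \<star> (embed (lw X (wB Y Z)) \<star> glue X (Y @ Z)) \<star> (one X || glue Y Z)"
    unfolding embed_cmp[OF h(2,1)] by (simp only: tr.cmp_assoc)
  also have "\<dots> = embed (rw (wB X Z) Y) \<star> glue X (Z @ Y) \<star> (one X || (embed (wB Y Z) \<star> glue Y Z))"
    unfolding lw_char[OF YZ(1) o(1)] by (simp only: idn_par_cmp[OF t(1)] tr.cmp_assoc)
  also have "\<dots> = embed (rw (wB X Z) Y) \<star> (glue X (Z @ Y) \<star> (one X || glue Z Y)) \<star> (one X || ?b)"
    unfolding YZ(2) by (simp only: idn_par_cmp[OF t(1)] tr.cmp_assoc)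
  also have "\<dots> = (embed (rw (wB X Z) Y) \<star> glue (X @ Z) Y) \<star> (glue X Z || one Y) \<star> ali (tree_of X)
    (tree_of Z) (tree_of Y)
      \<star> (one X || ?b)"
    unfolding unglue_assoc[OF o(1,3,2)] by (simp only: tr.cmp_assoc)
  also have "\<dots> = glue (Z @ X) Y \<star> ((embed (wB X Z) \<star> glue X Z) || one Y) \<star> ali (tree_of X)
    (tree_of Z) (tree_of Y) \<star> (one X || ?b)"
    unfolding rw_char[OF XZ(1) o(2)] by (simp only: par_idn_cmp[OF t(2)] tr.cmp_assoc)
  finally have 2: "embed (wd.cmp (rw (wB X Z) Y) (lw X (wB Y Z))) \<star> ?p = embed (wB (X @ Y) Z) \<star> ?p"
    unfolding 1 XZ(2) .
  have p: "tr.iso (Node (tree_of X) (Node (tree_of Y) (tree_of Z))) (tree_of (X @ Y @ Z)) ?p"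
    using tr.iso_cmp[OF iso_par[OF tr.iso_idn[OF t(1)] iso_glue[OF o(2,3)]] iso_glue[OF o(1)
      c(2)]] by simp
  show ?thesis using eq_via[OF p h(3) wd.cmp_in[OF h(2,1)]] 2 by simp
qed

sublocale st: two_sided "(@)" "[]" words wd.Hm wd.idn wd.cmp lw rw wB wBi
  by unfold_locales
    (simp_all add: wd.Hm_V[simplified] wd.idn_in wd.cmp_in wd.cmp_assoc wd.idn_cmp wd.cmp_idn
      lw_in rw_in lw_idn rw_idn lw_cmp rw_cmp
      lw_lw rw_rw lw_rw Nil_lw rw_Nil word_interchange wB wB_inv wB_nat[OF _ wd.idn_in, folded
        lw_def rw_def]
      wB_nat[OF wd.idn_in, folded lw_def rw_def] wB_cat_r wB_cat_l)

end

section \<open>Short words and the arrows of the given category\<close>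

context braided_monoidal_category
begin

abbreviation Ar where "Ar xs f ys \<equiv> Some (xs, f, ys)"

lemma idn_letter: "z \<in> Obj C \<Longrightarrow> wd.idn [z] = Ar [z] (Idt C z) [z]"
  by (simp add: wd.idn_def)

text \<open>
  Gluing a letter at the end does nothing, so no coherence isomorphism appears in the source. In
  the target, \<open>k\<close> is an identity or a unit isomorphism. The following lemmas evaluate the
  whiskerings by a letter that occur in the axioms of bimonoids and modules.
\<close>

lemma ten_Some:
  assumes f: "Ar xs f ys \<in> wd.Hm xs ys" and g: "Ar [z] g zs \<in> wd.Hm [z] zs" and ne: "xs \<noteq> []"
    and k: "glue ys zs = Some (Node (tree_of ys) (tree_of zs), k, tree_of (ys @ zs))"
  shows "ten (Ar xs f ys) (Ar [z] g zs) = Ar (xs @ [z]) (k \<cdot> (f \<boxtimes> g)) (ys @ zs)"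
proof -
  have w: "ys \<in> words" "zs \<in> words" using f g wd.Hm_V by blast+
  note t = ten_in[OF f g] and p = par_in[OF embed_in[OF f] embed_in[OF g]] and i = glue_in[OF w]
  have "embed (ten (Ar xs f ys) (Ar [z] g zs)) = glue ys zs \<star> (embed (Ar xs f ys) || embed (Ar [z]
    g zs))"
    using ten_char[OF f g] glue_single[OF ne] tr.cmp_idn[OF embed_in[OF t]] by simp
  also have "\<dots> = embed (Ar (xs @ [z]) (k \<cdot> (f \<boxtimes> g)) (ys @ zs))"
    using i p embed_in[OF f] embed_in[OF g] ne unfolding k
    by (simp add: tr.in_Hm tree_of_snoc)
  finally show ?thesis using t by (auto elim!: wd.HmE)
qed

lemma ten_letter:
  assumes f: "Ar xs f ys \<in> wd.Hm xs ys" and g: "Ar [z] g [z'] \<in> wd.Hm [z] [z']"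
    and ne: "xs \<noteq> []" "ys \<noteq> []"
  shows "ten (Ar xs f ys) (Ar [z] g [z']) = Ar (xs @ [z]) (f \<boxtimes> g) (ys @ [z'])"
proof -
  have w: "xs @ [z] \<in> words" "ys @ [z'] \<in> words" using wd.Hm_V[OF f] wd.Hm_V[OF g] by auto
  then have "glue ys [z'] = Some (Node (tree_of ys) (tree_of [z']), Idt C (ev C (tree_of (ys @
    [z']))),
      tree_of (ys @ [z']))"
    using glue_single[OF ne(2)] ne(2) unfolding tree_of_trees by (simp add: tr.idn_def tree_of_snoc)
  note t = ten_Some[OF f g ne(1) this]
  have "f \<boxtimes> g \<in> Hom C (ev C (tree_of (xs @ [z]))) (ev C (tree_of (ys @ [z'])))"
    using par_in[OF embed_in[OF f] embed_in[OF g]] embed_in[OF f] embed_in[OF g] ne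
    by (simp add: tr.in_Hm tree_of_snoc)
  then show ?thesis using t Id_Comp wd.T_Obj w by metis
qed

lemma rw_letter:
  assumes f: "Ar xs f ys \<in> wd.Hm xs ys" and z: "z \<in> Obj C" and ne: "xs \<noteq> []" "ys \<noteq> []"
  shows "rw (Ar xs f ys) [z] = Ar (xs @ [z]) (f \<boxtimes> Idt C z) (ys @ [z])"
  unfolding rw_def idn_letter[OF z]
  using ten_letter[OF f _ ne] wd.idn_in[of "[z]"] idn_letter[OF z] z by simp

lemma lw_letter:
  assumes f: "Ar [y] f [z] \<in> wd.Hm [y] [z]" and x: "x \<in> Obj C"
  shows "lw [x] (Ar [y] f [z]) = Ar [x, y] (Idt C x \<boxtimes> f) [x, z]"
  unfolding lw_def idn_letter[OF x]
  using ten_letter[OF _ f, of "[x]" "Idt C x" "[x]"] wd.idn_in[of "[x]"] idn_letter[OF x] x by simp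

lemma rw_counit:
  assumes f: "Ar [x] f [] \<in> wd.Hm [x] []" and z: "z \<in> Obj C"
  shows "rw (Ar [x] f []) [z] = Ar [x, z] (LUnit C z \<cdot> (f \<boxtimes> Idt C z)) [z]"
  unfolding rw_def idn_letter[OF z]
  using ten_Some[OF f, of z "Idt C z" "[z]"] wd.idn_in[of "[z]"] idn_letter[OF z] z
  by (simp add: glue_Nil lun_def)

lemma lw_counit:
  assumes f: "Ar [y] f [] \<in> wd.Hm [y] []" and x: "x \<in> Obj C"
  shows "lw [x] (Ar [y] f []) = Ar [x, y] (RUnit C x \<cdot> (Idt C x \<boxtimes> f)) [x]"
  unfolding lw_def idn_letter[OF x]
  using ten_Some[OF _ f, of "[x]" "Idt C x" "[x]"] wd.idn_in[of "[x]"] idn_letter[OF x] x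
  by (simp add: glue_Nil2 run_def)

lemma glue_pair:
  assumes "x \<in> Obj C" "y \<in> Obj C" "z \<in> Obj C"
  shows "glue [x] [y, z] = ali (Leaf x) (Leaf y) (Leaf z)"
proof -
  have t: "Leaf x \<in> trees" "Leaf y \<in> trees" "Leaf z \<in> trees" "Node (Leaf x) (Leaf y) \<in> trees"
    using assms by auto
  show ?thesis
    using glue_snoc[of "[x]" "[y]" z] glue_single[of "[x]" y] par_idn[OF t(4,3)]
      tr.idn_cmp[OF ali(1)[OF t(1,2,3)]] by simp
qed

lemma lw_pair:
  assumes f: "Ar [y, z] f vs \<in> wd.Hm [y, z] vs" and x: "x \<in> Obj C"
    and k: "glue [x] vs = Some (Node (Leaf x) (tree_of vs), k, tree_of (x # vs))"
  shows "lw [x] (Ar [y, z] f vs) = Ar [x, y, z] (k \<cdot> (Idt C x \<boxtimes> f) \<cdot> Assoc C x y z) (x # vs)"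
proof -
  have w: "[x] \<in> words" "vs \<in> words" and o: "y \<in> Obj C" "z \<in> Obj C"
    and t: "Leaf x \<in> trees" "Leaf y \<in> trees" "Leaf z \<in> trees" using x wd.Hm_V[OF f] by auto
  let ?p = "one [x] || embed (Ar [y, z] f vs)"
  note a = al_in[OF t] and i = glue_in[OF w] and l = lw_in[OF f w(1)]
  have p: "?p \<in> tr.Hm (Node (Leaf x) (Node (Leaf y) (Leaf z))) (Node (Leaf x) (tree_of vs))"
    using par_in[OF one_in[OF w(1)] embed_in[OF f]] by simp
  have pe: "?p = Some (Node (Leaf x) (Node (Leaf y) (Leaf z)), Idt C x \<boxtimes> f, Node (Leaf x) (tree_of
    vs))"
    using embed_in[OF f] one_in[OF w(1)] x by (simp add: tr.idn_def)
  note pa = tr.cmp_in[OF a p]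
  have "embed (lw [x] (Ar [y, z] f vs)) = (embed (lw [x] (Ar [y, z] f vs)) \<star> glue [x] [y, z])
      \<star> al (Leaf x) (Leaf y) (Leaf z)"
    unfolding glue_pair[OF x o] tr.cmp_assoc ali(2)[OF t] using tr.cmp_idn[OF embed_in[OF l]] by
      simp
  also have "\<dots> = glue [x] vs \<star> ?p \<star> al (Leaf x) (Leaf y) (Leaf z)"
    unfolding lw_char[OF f w(1)] by (simp only: tr.cmp_assoc)
  also have "\<dots> = embed (Ar [x, y, z] (k \<cdot> (Idt C x \<boxtimes> f) \<cdot> Assoc C x y z) (x # vs))"
    using a p pa i unfolding k pe al_def by (simp add: tr.in_Hm)
  finally show ?thesis using l by (auto elim!: wd.HmE)
qed

lemma lw_whisker:
  assumes f: "Ar [y, z] f [y', z'] \<in> wd.Hm [y, z] [y', z']" and x: "x \<in> Obj C"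
  shows "lw [x] (Ar [y, z] f [y', z'])
    = Ar [x, y, z] (AssocInv C x y' z' \<cdot> (Idt C x \<boxtimes> f) \<cdot> Assoc C x y z) [x, y', z']"
proof -
  have "y' \<in> Obj C" "z' \<in> Obj C" using wd.Hm_V[OF f] by auto
  then show ?thesis
    using lw_pair[OF f x, of "AssocInv C x y' z'"] glue_pair[OF x] ali_eq x by simp
qed

lemma lw_bracket:
  assumes f: "Ar [y, z] f [q] \<in> wd.Hm [y, z] [q]" and x: "x \<in> Obj C"
  shows "lw [x] (Ar [y, z] f [q]) = Ar [x, y, z] ((Idt C x \<boxtimes> f) \<cdot> Assoc C x y z) [x, q]"
proof -
  have w: "[x] \<in> words" and o: "y \<in> Obj C" "z \<in> Obj C" "q \<in> Obj C" using wd.Hm_V[OF f] x by auto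
  have "glue [x] [q] = Some (Node (Leaf x) (tree_of [q]), Idt C (x \<otimes> q), tree_of (x # [q]))"
    using glue_single[of "[x]" q] o x by (simp add: tr.idn_def)
  note l = lw_pair[OF f x this]
  have "Idt C x \<boxtimes> f \<in> Hom C (x \<otimes> (y \<otimes> z)) (x \<otimes> q)"
    using TensorArr_in_Hom[OF x x Tensor_Obj[OF o(1,2)] o(3) Id_in_Hom[OF x]] f by (simp add:
      wd.in_Hm)
  moreover have "Assoc C x y z \<in> Hom C ((x \<otimes> y) \<otimes> z) (x \<otimes> (y \<otimes> z))"
    using Assoc_iso[OF x o(1,2)] by (auto simp: iso_arr_def inverse_arrows_def)
  ultimately have "(Idt C x \<boxtimes> f) \<cdot> Assoc C x y z \<in> Hom C ((x \<otimes> y) \<otimes> z) (x \<otimes> q)"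
    using Comp_in_Hom[of "(x \<otimes> y) \<otimes> z" "x \<otimes> (y \<otimes> z)" "x \<otimes> q"] x o by (simp add: Tensor_Obj)
  then have "Idt C (x \<otimes> q) \<cdot> (Idt C x \<boxtimes> f) \<cdot> Assoc C x y z = (Idt C x \<boxtimes> f) \<cdot> Assoc C x y z"
    using Id_Comp[of "(x \<otimes> y) \<otimes> z" "x \<otimes> q"] x o by (simp add: Tensor_Obj)
  with l show ?thesis by simp
qed

lemma wB_letter:
  assumes o: "x \<in> Obj C" "y \<in> Obj C"
  shows "wB [x] [y] = Some ([x, y], Braid C x y, [y, x])"
    and "wBi [x] [y] = Some ([y, x], BraidInv C x y, [x, y])"
proof -
  have t: "Leaf x \<in> trees" "Leaf y \<in> trees" and w: "[x] \<in> words" "[y] \<in> words" using o by auto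
  note b = br_in[OF t] and bi = bri(1)[OF t]
  have be: "bri (Leaf x) (Leaf y) = Some (Node (Leaf y) (Leaf x), BraidInv C x y, Node (Leaf x)
    (Leaf y))"
    unfolding br_def BraidInv_def using o by (subst tr.inv_Some) (auto simp: Braid_iso)
  have i: "tr.inv (Node (Leaf x) (Leaf y)) (Node (Leaf x) (Leaf y)) (tr.idn (Node (Leaf x) (Leaf
    y))) = tr.idn (Node (Leaf x) (Leaf y))"
    "tr.inv (Node (Leaf y) (Leaf x)) (Node (Leaf y) (Leaf x)) (tr.idn (Node (Leaf y) (Leaf x))) =
      tr.idn (Node (Leaf y) (Leaf x))"
    using tr.inv(1,2)[OF tr.iso_idn[OF Node_tree[OF t]]] tr.inv(1,2)[OF tr.iso_idn[OF Node_tree[OF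
      t(2,1)]]]
      tr.cmp_idn by metis+
  show "wB [x] [y] = Some ([x, y], Braid C x y, [y, x])"
    using i tr.cmp_idn[OF b] tr.idn_cmp[OF b] by (simp add: wB_def glue_single br_def)
  show "wBi [x] [y] = Some ([y, x], BraidInv C x y, [x, y])"
    using i tr.cmp_idn[OF bi] tr.idn_cmp[OF bi] be by (simp add: wBi_def glue_single)
qed

lemma cmp_Some:
  assumes "Some (y, g, z) \<in> wd.Hm y z" "Some (x, f, y) \<in> wd.Hm x y"
  shows "wd.cmp (Some (y, g, z)) (Some (x, f, y)) = Some (x, g \<cdot> f, z)"
    and "Some (x, g \<cdot> f, z) \<in> wd.Hm x z"
  using assms wd.cmp_in[OF assms(2,1)] by simp_all

lemma splits_iff:
  assumes f: "Some (x, f, y) \<in> wd.Hm x y"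
  shows "st.splits x y (Some (x, f, y)) \<longleftrightarrow> split_epi C (ev C (tree_of x)) (ev C (tree_of y)) f"
proof
  assume "st.splits x y (Some (x, f, y))"
  then obtain s where s: "s \<in> wd.Hm y x" "wd.cmp (Some (x, f, y)) s = wd.idn y"
    by (auto simp: st.splits_def)
  with f show "split_epi C (ev C (tree_of x)) (ev C (tree_of y)) f"
    by (elim wd.HmE) (auto simp: split_epi_def wd.in_Hm wd.idn_def)
next
  assume "split_epi C (ev C (tree_of x)) (ev C (tree_of y)) f"
  then obtain s where "s \<in> Hom C (ev C (tree_of y)) (ev C (tree_of x))" "f \<cdot> s = Idt C (ev C
    (tree_of y))"
    by (auto simp: split_epi_def)
  with f show "st.splits x y (Some (x, f, y))"
    unfolding st.splits_def
    by (intro conjI bexI[of _ "Some (y, s, x)"]) (simp_all add: wd.in_Hm wd.idn_def)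
qed

end

section \<open>Translation of bimonoids and modules\<close>

lemma bar_data:
  "Obj (bar C) = Obj C" "Hom (bar C) = Hom C" "Idt (bar C) = Idt C" "Comp (bar C) = Comp C"
  "Tensor (bar C) = Tensor C" "TensorArr (bar C) = TensorArr C" "Unit (bar C) = Unit C"
  "Assoc (bar C) = Assoc C" "LUnit (bar C) = LUnit C" "RUnit (bar C) = RUnit C"
  "Braid (bar C) = (\<lambda>X Y. BraidInv C Y X)"
  by (simp_all add: bar_def)

lemma reverse_data:
  "Obj (reverse C) = Obj C" "Hom (reverse C) = Hom C" "Idt (reverse C) = Idt C"
  "Comp (reverse C) = Comp C" "Tensor (reverse C) = (\<lambda>X Y. Tensor C Y X)"
  "TensorArr (reverse C) = (\<lambda>f g. TensorArr C g f)" "Unit (reverse C) = Unit C"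
  "Assoc (reverse C) = (\<lambda>X Y Z. AssocInv C Z Y X)" "LUnit (reverse C) = RUnit C"
  "RUnit (reverse C) = LUnit C" "Braid (reverse C) = (\<lambda>X Y. Braid C Y X)"
  by (simp_all add: reverse_def)

lemma Inv_same_category:
  assumes "Hom D = Hom C" "Idt D = Idt C" "Comp D = Comp C" shows "Inv D = Inv C"
  using assms by (simp add: Inv_def inverse_arrows_def fun_eq_iff)

lemma Inv_bar: "Inv (bar C) = Inv C" and Inv_reverse: "Inv (reverse C) = Inv C"
  by (rule Inv_same_category; simp add: bar_data reverse_data)+

lemma AssocInv_bar: "AssocInv (bar C) = AssocInv C"
  by (simp add: AssocInv_def Inv_bar bar_data fun_eq_iff)

context category
begin

text \<open>
  Equations on a triple product in the reversed category live on the other bracketing. They are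
  moved across the associator by this conjugation, which is multiplicative and injective.
\<close>

definition "conj_by a i x = a \<cdot> x \<cdot> i"

lemma conj_by:
  assumes o: "X \<in> Obj C" "Y \<in> Obj C" and a: "inverse_arrows C X Y a i"
    and x: "x \<in> Hom C X X"
  shows "conj_by a i x \<in> Hom C Y Y" "i \<cdot> conj_by a i x \<cdot> a = x"
    "y \<in> Hom C X X \<Longrightarrow> conj_by a i y \<cdot> conj_by a i x = conj_by a i (y \<cdot> x)"
proof -
  have ai: "a \<in> Hom C X Y" "i \<in> Hom C Y X" "i \<cdot> a = Idt C X" "a \<cdot> i = Idt C Y"
    using a by (auto simp: inverse_arrows_def)
  have xi: "x \<cdot> i \<in> Hom C Y X" using Comp_in_Hom[OF o(2,1,1) ai(2) x] .
  have ax: "a \<cdot> x \<cdot> i \<in> Hom C Y Y" using Comp_in_Hom[OF o(2,1,2) xi ai(1)] .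
  show "conj_by a i x \<in> Hom C Y Y" unfolding conj_by_def using ax .
  have "(a \<cdot> (x \<cdot> i)) \<cdot> a = a \<cdot> x"
    using Comp_assoc[OF o(1,2,1,2) ai(1) xi ai(1)] Comp_assoc[OF o(1,2,1,1) ai(1,2) x] ai(3)
      Comp_Id[OF o(1,1) x] by simp
  then show "i \<cdot> conj_by a i x \<cdot> a = x"
    unfolding conj_by_def using Comp_assoc[OF o(1,1,2,1) x ai(1,2)] ai(3) Id_Comp[OF o(1,1) x] by
      simp
  show "conj_by a i y \<cdot> conj_by a i x = conj_by a i (y \<cdot> x)" if y: "y \<in> Hom C X X"
  proof -
    have yi: "y \<cdot> i \<in> Hom C Y X" using Comp_in_Hom[OF o(2,1,1) ai(2) y] .
    have "(a \<cdot> (y \<cdot> i)) \<cdot> (a \<cdot> (x \<cdot> i)) = a \<cdot> (y \<cdot> i) \<cdot> (a \<cdot> (x \<cdot> i))"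
      using Comp_assoc[OF o(2,2,1,2) ax yi ai(1)] .
    also have "(y \<cdot> i) \<cdot> (a \<cdot> (x \<cdot> i)) = y \<cdot> i \<cdot> (a \<cdot> (x \<cdot> i))"
      using Comp_assoc[OF o(2,2,1,1) ax ai(2) y] .
    also have "i \<cdot> (a \<cdot> (x \<cdot> i)) = x \<cdot> i"
      using Comp_assoc[OF o(2,1,2,1) xi ai(1,2)] ai(3) Id_Comp[OF o(2,1) xi] by simp
    also have "y \<cdot> (x \<cdot> i) = (y \<cdot> x) \<cdot> i"
      using Comp_assoc[OF o(2,1,1,1) ai(2) x y] by simp
    finally show ?thesis unfolding conj_by_def .
  qed
qed

lemma endo_comp: "X \<in> Obj C \<Longrightarrow> f \<in> Hom C X X \<Longrightarrow> g \<in> Hom C X X \<Longrightarrow> g \<cdot> f \<in> Hom C X X"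
  using Comp_in_Hom[of X X X f g] by simp

end

context braided_monoidal_category
begin

lemma Assoc_inverse:
  assumes "X \<in> Obj C" "Y \<in> Obj C" "Z \<in> Obj C"
  shows "inverse_arrows C ((X \<otimes> Y) \<otimes> Z) (X \<otimes> (Y \<otimes> Z)) (Assoc C X Y Z) (AssocInv C X Y Z)"
  unfolding AssocInv_def using assms by (intro Inv_inverse Assoc_iso Tensor_Obj)

lemma Braid_inverse:
  assumes "X \<in> Obj C" "Y \<in> Obj C"
  shows "inverse_arrows C (X \<otimes> Y) (Y \<otimes> X) (Braid C X Y) (BraidInv C X Y)"
  unfolding BraidInv_def using assms by (intro Inv_inverse Braid_iso Tensor_Obj)

lemma inverse_arrows_sym: "inverse_arrows C X Y f g \<Longrightarrow> inverse_arrows C Y X g f"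
  by (auto simp: inverse_arrows_def)

lemma whisker_in:
  assumes o: "X \<in> Obj C" "Y \<in> Obj C" "Z \<in> Obj C" and f: "f \<in> Hom C (Y \<otimes> Z) (Y \<otimes> Z)"
  shows "whisker C X Y Z f \<in> Hom C ((X \<otimes> Y) \<otimes> Z) ((X \<otimes> Y) \<otimes> Z)"
  unfolding whisker_def
  using conj_by(1)[OF _ _ inverse_arrows_sym[OF Assoc_inverse[OF o]]
      TensorArr_in_Hom[OF o(1,1) _ _ Id_in_Hom[OF o(1)] f]] o
  unfolding conj_by_def by (simp add: Tensor_Obj)

lemma idt_tensor:
  assumes o: "X \<in> Obj C" "Y \<in> Obj C" "Z \<in> Obj C" and f: "f \<in> Hom C (Y \<otimes> Z) (Y \<otimes> Z)"
  shows "Idt C X \<boxtimes> f = conj_by (Assoc C X Y Z) (AssocInv C X Y Z) (whisker C X Y Z f)"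
proof -
  have h: "Idt C X \<boxtimes> f \<in> Hom C (X \<otimes> (Y \<otimes> Z)) (X \<otimes> (Y \<otimes> Z))"
    using TensorArr_in_Hom[OF o(1,1) _ _ Id_in_Hom[OF o(1)] f] o by (simp add: Tensor_Obj)
  show ?thesis
    using conj_by(2)[OF _ _ inverse_arrows_sym[OF Assoc_inverse[OF o]] h] o
    by (simp add: Tensor_Obj conj_by_def whisker_def)
qed

lemma word_whisker:
  assumes o: "X \<in> Obj C" "Y \<in> Obj C" "Z \<in> Obj C" and f: "f \<in> Hom C (Y \<otimes> Z) (Y \<otimes> Z)"
  shows "lw [X] (Ar [Y, Z] f [Y, Z]) = Ar [X, Y, Z] (whisker C X Y Z f) [X, Y, Z]"
  using lw_whisker[of Y Z f Y Z X] assms by (simp add: wd.in_Hm whisker_def)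

lemma word_rw:
  assumes o: "X \<in> Obj C" "Y \<in> Obj C" "Z \<in> Obj C" and f: "f \<in> Hom C (X \<otimes> Y) (X \<otimes> Y)"
  shows "rw (Ar [X, Y] f [X, Y]) [Z] = Ar [X, Y, Z] (f \<boxtimes> Idt C Z) [X, Y, Z]"
  using rw_letter[of "[X, Y]" f "[X, Y]" Z] assms by (simp add: wd.in_Hm)

lemma rw_in_Hom:
  assumes o: "X \<in> Obj C" "Y \<in> Obj C" "Z \<in> Obj C" and f: "f \<in> Hom C (X \<otimes> Y) (X \<otimes> Y)"
  shows "f \<boxtimes> Idt C Z \<in> Hom C ((X \<otimes> Y) \<otimes> Z) ((X \<otimes> Y) \<otimes> Z)"
  using TensorArr_in_Hom[OF _ _ o(3,3) f Id_in_Hom[OF o(3)]] o by (simp add: Tensor_Obj)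

lemma endo3:
  assumes o: "X \<in> Obj C" "Y \<in> Obj C" "Z \<in> Obj C"
    and f: "f \<in> Hom C ((X \<otimes> Y) \<otimes> Z) ((X \<otimes> Y) \<otimes> Z)" "g \<in> Hom C ((X \<otimes> Y) \<otimes> Z) ((X \<otimes> Y) \<otimes> Z)"
  shows "wd.cmp (Ar [X, Y, Z] g [X, Y, Z]) (Ar [X, Y, Z] f [X, Y, Z]) = Ar [X, Y, Z] (g \<cdot> f) [X,
    Y, Z]"
    and "g \<cdot> f \<in> Hom C ((X \<otimes> Y) \<otimes> Z) ((X \<otimes> Y) \<otimes> Z)"
  using assms endo_comp[OF _ f] by (simp_all add: wd.in_Hm Tensor_Obj)

lemma BB_in: "X \<in> Obj C \<Longrightarrow> Braid C X X \<in> Hom C (X \<otimes> X) (X \<otimes> X)"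
  "X \<in> Obj C \<Longrightarrow> BraidInv C X X \<in> Hom C (X \<otimes> X) (X \<otimes> X)"
  using Braid_inverse[of X X] by (auto simp: inverse_arrows_def)

lemma fusion_iff:
  assumes o: "A \<in> Obj C" "Q \<in> Obj C" and t: "t \<in> Hom C (A \<otimes> A) (A \<otimes> A)"
    and q: "q \<in> Hom C (A \<otimes> Q) (A \<otimes> Q)"
  shows "st.fusion_law [A] (Ar [A, A] t [A, A]) [Q] (Ar [A, Q] q [A, Q]) \<longleftrightarrow>
    (t \<boxtimes> Idt C Q) \<cdot> (BraidInv C A A \<boxtimes> Idt C Q) \<cdot> whisker C A A Q q
        \<cdot> (Braid C A A \<boxtimes> Idt C Q) \<cdot> whisker C A A Q q
      = whisker C A A Q q \<cdot> (t \<boxtimes> Idt C Q)"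
proof -
  note m = rw_in_Hom[OF o(1,1,2) t] rw_in_Hom[OF o(1,1,2) BB_in(1)[OF o(1)]]
    rw_in_Hom[OF o(1,1,2) BB_in(2)[OF o(1)]] whisker_in[OF o(1,1,2) q]
  show ?thesis
    unfolding st.fusion_law_def st.slide_def wB_letter[OF o(1,1)] word_whisker[OF o(1,1,2) q]
      word_rw[OF o(1,1,2) t] word_rw[OF o(1,1,2) BB_in(1)[OF o(1)]] word_rw[OF o(1,1,2)
        BB_in(2)[OF o(1)]]
      st.comp_assoc
    using m by (simp add: endo3[OF o(1,1,2)] del: wd.cmp.simps)
qed

end

context braided_monoidal_category
begin

text \<open>
  The right hand side is the fusion equation in the reversed category with inverse braiding, with
  its whiskerings written out; it is the conjugate by \<open>a\<close> of the mirrored equation on words.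
\<close>

lemma mirror_fusion_iff:
  assumes o: "A \<in> Obj C" "Q \<in> Obj C" and t: "t \<in> Hom C (A \<otimes> A) (A \<otimes> A)"
    and q: "q \<in> Hom C (Q \<otimes> A) (Q \<otimes> A)"
    and al: "a = Assoc C Q A A" "ai = AssocInv C Q A A"
  shows "st.mirror.fusion_law [A] (Ar [A, A] t [A, A]) [Q] (Ar [Q, A] q [Q, A]) \<longleftrightarrow>
    (Idt C Q \<boxtimes> t) \<cdot> (Idt C Q \<boxtimes> Braid C A A) \<cdot> (a \<cdot> (q \<boxtimes> Idt C A) \<cdot> ai)
        \<cdot> (Idt C Q \<boxtimes> BraidInv C A A) \<cdot> (a \<cdot> (q \<boxtimes> Idt C A) \<cdot> ai)
      = (a \<cdot> (q \<boxtimes> Idt C A) \<cdot> ai) \<cdot> (Idt C Q \<boxtimes> t)"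
proof -
  note i = Assoc_inverse[OF o(2,1,1)]
  have O: "(Q \<otimes> A) \<otimes> A \<in> Obj C" "Q \<otimes> (A \<otimes> A) \<in> Obj C" using o Tensor_Obj by auto
  note m = whisker_in[OF o(2,1,1) t] whisker_in[OF o(2,1,1) BB_in(1)[OF o(1)]]
    whisker_in[OF o(2,1,1) BB_in(2)[OF o(1)]] rw_in_Hom[OF o(2,1,1) q]
  note e = endo3[OF o(2,1,1)]
  have c: "a \<cdot> (q \<boxtimes> Idt C A) \<cdot> ai = conj_by (Assoc C Q A A) (AssocInv C Q A A) (q \<boxtimes> Idt C A)"
    unfolding al conj_by_def ..
  have inj: "conj_by (Assoc C Q A A) (AssocInv C Q A A) x = conj_by (Assoc C Q A A) (AssocInv C Q
    A A) y
      \<longleftrightarrow> x = y" if "x \<in> Hom C ((Q \<otimes> A) \<otimes> A) ((Q \<otimes> A) \<otimes> A)" "y \<in> Hom C ((Q \<otimes> A) \<otimes> A) ((Q \<otimes> A) \<otimes> A)"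
        for x y
    using conj_by(2)[OF O i that(1)] conj_by(2)[OF O i that(2)] by metis
  show ?thesis
    unfolding st.mirror.fusion_law_def st.mirror.slide_def wB_letter[OF o(1,1)]
      word_whisker[OF o(2,1,1) t] word_whisker[OF o(2,1,1) BB_in(1)[OF o(1)]]
      word_whisker[OF o(2,1,1) BB_in(2)[OF o(1)]] word_rw[OF o(2,1,1) q] st.comp_assoc
      c idt_tensor[OF o(2,1,1) t] idt_tensor[OF o(2,1,1) BB_in(1)[OF o(1)]]
      idt_tensor[OF o(2,1,1) BB_in(2)[OF o(1)]]
    using m by (simp add: e conj_by(3)[OF O i] inj del: wd.cmp.simps)
qed

lemma act_Ar:
  assumes o: "A \<in> Obj C" "Q \<in> Obj C" and e: "e \<in> Hom C A (Unit C)"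
    and q: "q \<in> Hom C (A \<otimes> Q) (A \<otimes> Q)"
  shows "st.act (Ar [A] e []) [Q] (Ar [A, Q] q [A, Q])
      = Ar [A, Q] (LUnit C Q \<cdot> (e \<boxtimes> Idt C Q) \<cdot> q) [Q]" (is ?eq)
    and "Ar [A, Q] (LUnit C Q \<cdot> (e \<boxtimes> Idt C Q) \<cdot> q) [Q] \<in> wd.Hm [A, Q] [Q]" (is ?in)
proof -
  have w: "[A] \<in> words" "[Q] \<in> words" using o by auto
  have eh: "Ar [A] e [] \<in> wd.Hm [A] []" and qh: "Ar [A, Q] q [A, Q] \<in> wd.Hm [A, Q] [A, Q]"
    using o e q by (auto simp: wd.in_Hm)
  have r: "rw (Ar [A] e []) [Q] = Ar [A, Q] (LUnit C Q \<cdot> (e \<boxtimes> Idt C Q)) [Q]"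
    using rw_counit[OF eh o(2)] .
  have h: "Ar [A, Q] (LUnit C Q \<cdot> (e \<boxtimes> Idt C Q)) [Q] \<in> wd.Hm [A, Q] [Q]"
    using rw_in[OF eh w(2)] unfolding r by simp
  have l: "LUnit C Q \<in> Hom C (Unit C \<otimes> Q) Q" using LUnit_iso[OF o(2)] by (auto simp: iso_arr_def
    inverse_arrows_def)
  have ei: "e \<boxtimes> Idt C Q \<in> Hom C (A \<otimes> Q) (Unit C \<otimes> Q)"
    using TensorArr_in_Hom[OF o(1) Unit_Obj o(2,2) e Id_in_Hom[OF o(2)]] .
  have "(LUnit C Q \<cdot> (e \<boxtimes> Idt C Q)) \<cdot> q = LUnit C Q \<cdot> (e \<boxtimes> Idt C Q) \<cdot> q"
    using Comp_assoc[OF _ _ _ o(2) q ei l] o by (simp add: Tensor_Obj Unit_Obj)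
  then show ?eq ?in unfolding st.act_def r using cmp_Some[OF h qh] by simp_all
qed

lemma mirror_act_Ar:
  assumes o: "A \<in> Obj C" "Q \<in> Obj C" and e: "e \<in> Hom C A (Unit C)"
    and q: "q \<in> Hom C (Q \<otimes> A) (Q \<otimes> A)"
  shows "st.mirror.act (Ar [A] e []) [Q] (Ar [Q, A] q [Q, A])
      = Ar [Q, A] (RUnit C Q \<cdot> (Idt C Q \<boxtimes> e) \<cdot> q) [Q]" (is ?eq)
    and "Ar [Q, A] (RUnit C Q \<cdot> (Idt C Q \<boxtimes> e) \<cdot> q) [Q] \<in> wd.Hm [Q, A] [Q]" (is ?in)
proof -
  have w: "[A] \<in> words" "[Q] \<in> words" using o by auto
  have eh: "Ar [A] e [] \<in> wd.Hm [A] []" and qh: "Ar [Q, A] q [Q, A] \<in> wd.Hm [Q, A] [Q, A]"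
    using o e q by (auto simp: wd.in_Hm)
  have r: "lw [Q] (Ar [A] e []) = Ar [Q, A] (RUnit C Q \<cdot> (Idt C Q \<boxtimes> e)) [Q]"
    using lw_counit[OF eh o(2)] .
  have h: "Ar [Q, A] (RUnit C Q \<cdot> (Idt C Q \<boxtimes> e)) [Q] \<in> wd.Hm [Q, A] [Q]"
    using lw_in[OF eh w(2)] unfolding r by simp
  have l: "RUnit C Q \<in> Hom C (Q \<otimes> Unit C) Q" using RUnit_iso[OF o(2)] by (auto simp: iso_arr_def
    inverse_arrows_def)
  have ei: "Idt C Q \<boxtimes> e \<in> Hom C (Q \<otimes> A) (Q \<otimes> Unit C)"
    using TensorArr_in_Hom[OF o(2,2,1) Unit_Obj Id_in_Hom[OF o(2)] e] .
  have "(RUnit C Q \<cdot> (Idt C Q \<boxtimes> e)) \<cdot> q = RUnit C Q \<cdot> (Idt C Q \<boxtimes> e) \<cdot> q"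
    using Comp_assoc[OF _ _ _ o(2) q ei l] o by (simp add: Tensor_Obj Unit_Obj)
  then show ?eq ?in unfolding st.mirror.act_def r using cmp_Some[OF h qh] by simp_all
qed

end

text \<open>
  \<open>e_split\<close> makes the unit object a module, and \<open>d_split\<close> makes tensor products of modules split.
\<close>

locale regular_bimonoid = braided_monoidal_category C
  for C :: "('o, 'm) braided_data" (structure) +
  fixes A :: 'o and t1 t2 t3 t4 e :: 'm
  assumes reg: "regular_multiplier_bimonoid C A t1 t2 t3 t4 e"
    and e_split: "split_epi C A (Unit C) e"
    and d_split: "split_epi C ((A \<otimes> A) \<otimes> A) (A \<otimes> A)
      ((mult C A t1 e \<boxtimes> Idt C A) \<cdot> (BraidInv C A A \<boxtimes> Idt C A) \<cdot> whisker C A A A t1)"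
begin

lemma
  A_Obj: "A \<in> Obj C" and t1_in: "t1 \<in> Hom C (A \<otimes> A) (A \<otimes> A)" and t4_in: "t4 \<in> Hom C (A \<otimes> A) (A \<otimes> A)"
  and e_in: "e \<in> Hom C A (Unit C)"
  and counit1_C: "(Idt C A \<boxtimes> e) \<cdot> t1 = Idt C A \<boxtimes> e"
  and counit4_C: "(e \<boxtimes> Idt C A) \<cdot> t4 = e \<boxtimes> Idt C A"
  and mult4: "RUnit C A \<cdot> (Idt C A \<boxtimes> e) \<cdot> t4 = LUnit C A \<cdot> (e \<boxtimes> Idt C A) \<cdot> t1 \<cdot> BraidInv C A A"
proof -
  interpret R: regular_multiplier_bimonoid C A t1 t2 t3 t4 e by (rule reg)
  interpret m12: multiplier_bimonoid C A t1 t2 e by (rule R.t12)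
  interpret m34: multiplier_bimonoid "bar C" A t3 t4 e by (rule R.t34)
  interpret f1: counital_fusion_morphism C A t1 e by (rule m12.t1)
  interpret f4: counital_fusion_morphism "reverse (bar C)" A t4 e by (rule m34.t2)
  show "A \<in> Obj C" "t1 \<in> Hom C (A \<otimes> A) (A \<otimes> A)" "e \<in> Hom C A (Unit C)"
    "(Idt C A \<boxtimes> e) \<cdot> t1 = Idt C A \<boxtimes> e"
    by (rule f1.carrier f1.in_Hom f1.counit_in_Hom f1.counit)+
  show "t4 \<in> Hom C (A \<otimes> A) (A \<otimes> A)" "(e \<boxtimes> Idt C A) \<cdot> t4 = e \<boxtimes> Idt C A"
    using f4.in_Hom f4.counit by (simp_all add: reverse_data bar_data)
  show "RUnit C A \<cdot> (Idt C A \<boxtimes> e) \<cdot> t4 = LUnit C A \<cdot> (e \<boxtimes> Idt C A) \<cdot> t1 \<cdot> BraidInv C A A"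
    using m34.mult_eq R.ax_C by (simp add: mult_def bar_data)
qed

lemma mult_Ar:
  "wd.cmp (rw (Ar [A] e []) [A]) (Ar [A, A] t1 [A, A]) = Ar [A, A] (mult C A t1 e) [A]"
  "Ar [A, A] (mult C A t1 e) [A] \<in> wd.Hm [A, A] [A]"
  using act_Ar[OF A_Obj A_Obj e_in t1_in] by (simp_all add: st.act_def mult_def)

sublocale ma: multiplier_actions "(@)" "[]" words wd.Hm wd.idn wd.cmp lw rw wB wBi
  "[A]" "Ar [A, A] t1 [A, A]" "Ar [A, A] t4 [A, A]" "Ar [A] e []"
proof
  note o = A_Obj
  let ?t1 = "Ar [A, A] t1 [A, A]" and ?t4 = "Ar [A, A] t4 [A, A]" and ?e = "Ar [A] e []"
  show "[A] \<in> words" using o by simp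
  show t1h: "?t1 \<in> wd.Hm ([A] @ [A]) ([A] @ [A])" and t4h: "?t4 \<in> wd.Hm ([A] @ [A]) ([A] @ [A])"
    and eh: "?e \<in> wd.Hm [A] []"
    using o t1_in t4_in e_in by (auto simp: wd.in_Hm)
  have r: "RUnit C A \<in> Hom C (A \<otimes> Unit C) A" and l: "LUnit C A \<in> Hom C (Unit C \<otimes> A) A"
    using RUnit_iso[OF o] LUnit_iso[OF o] by (auto simp: iso_arr_def inverse_arrows_def)
  have 1: "lw [A] ?e = Ar [A, A] (RUnit C A \<cdot> (Idt C A \<boxtimes> e)) [A]" using lw_counit[OF eh o] .
  have 2: "rw ?e [A] = Ar [A, A] (LUnit C A \<cdot> (e \<boxtimes> Idt C A)) [A]" using rw_counit[OF eh o] .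
  have ei: "Idt C A \<boxtimes> e \<in> Hom C (A \<otimes> A) (A \<otimes> Unit C)" "e \<boxtimes> Idt C A \<in> Hom C (A \<otimes> A) (Unit C \<otimes> A)"
    using TensorArr_in_Hom[OF o o o Unit_Obj Id_in_Hom[OF o] e_in]
      TensorArr_in_Hom[OF o Unit_Obj o o e_in Id_in_Hom[OF o]] .
  have AA: "A \<otimes> A \<in> Obj C" "A \<otimes> Unit C \<in> Obj C" "Unit C \<otimes> A \<in> Obj C"
    using o Unit_Obj Tensor_Obj by auto
  have h: "Ar [A, A] (RUnit C A \<cdot> (Idt C A \<boxtimes> e)) [A] \<in> wd.Hm [A, A] [A]"
    "Ar [A, A] (LUnit C A \<cdot> (e \<boxtimes> Idt C A)) [A] \<in> wd.Hm [A, A] [A]"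
    using Comp_in_Hom[OF AA(1,2) o ei(1) r] Comp_in_Hom[OF AA(1,3) o ei(2) l] o by (auto simp:
      wd.in_Hm)
  have t1h': "?t1 \<in> wd.Hm [A, A] [A, A]" and t4h': "?t4 \<in> wd.Hm [A, A] [A, A]"
    using t1h t4h by simp_all
  show "wd.cmp (lw [A] ?e) ?t1 = lw [A] ?e"
    unfolding 1 cmp_Some(1)[OF h(1) t1h'] Comp_assoc[OF AA(1,1,2) o t1_in ei(1) r] counit1_C ..
  show "wd.cmp (rw ?e [A]) ?t4 = rw ?e [A]"
    unfolding 2 cmp_Some(1)[OF h(2) t4h'] Comp_assoc[OF AA(1,1,3) o t4_in ei(2) l] counit4_C ..
  have bi: "Ar [A, A] (BraidInv C A A) [A, A] \<in> wd.Hm [A, A] [A, A]"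
    using BB_in(2)[OF o] o by (auto simp: wd.in_Hm)
  have et: "(e \<boxtimes> Idt C A) \<cdot> t1 \<in> Hom C (A \<otimes> A) (Unit C \<otimes> A)"
    using Comp_in_Hom[OF AA(1,1,3) t1_in ei(2)] .
  have "mult C A t1 e \<cdot> BraidInv C A A = LUnit C A \<cdot> (e \<boxtimes> Idt C A) \<cdot> t1 \<cdot> BraidInv C A A"
    unfolding mult_def Comp_assoc[OF AA(1,1,3) o BB_in(2)[OF o] et l]
      Comp_assoc[OF AA(1,1,1,3) BB_in(2)[OF o] t1_in ei(2)] ..
  then show "wd.cmp (lw [A] ?e) ?t4 = wd.cmp (wd.cmp (rw ?e [A]) ?t1) (wBi [A] [A])"
    unfolding mult_Ar(1) wB_letter[OF o o] cmp_Some(1)[OF mult_Ar(2) bi]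
    unfolding 1 cmp_Some(1)[OF h(1) t4h'] Comp_assoc[OF AA(1,1,2) o t4_in ei(1) r] mult4 by simp
  show "st.splits [A] [] ?e" using e_split splits_iff[OF eh] by simp
  have mh: "Ar [A, A, A] (mult C A t1 e \<boxtimes> Idt C A) [A, A] \<in> wd.Hm [A, A, A] [A, A]"
    using rw_in[OF mult_Ar(2), of "[A]"] rw_letter[OF mult_Ar(2) o] o by simp
  have bh: "Ar [A, A, A] (BraidInv C A A \<boxtimes> Idt C A) [A, A, A] \<in> wd.Hm [A, A, A] [A, A, A]"
    "Ar [A, A, A] (whisker C A A A t1) [A, A, A] \<in> wd.Hm [A, A, A] [A, A, A]"
    using rw_in_Hom[OF o o o BB_in(2)[OF o]] whisker_in[OF o o o t1_in] o by (auto simp: wd.in_Hm)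
  have d: "wd.cmp (rw (wd.cmp (rw ?e [A]) ?t1) [A]) (wd.cmp (rw (wBi [A] [A]) [A]) (lw [A] ?t1))
    = Ar [A, A, A] ((mult C A t1 e \<boxtimes> Idt C A) \<cdot> (BraidInv C A A \<boxtimes> Idt C A) \<cdot> whisker C A A A t1)
      [A, A]"
    unfolding mult_Ar(1) wB_letter[OF o o] word_rw[OF o o o BB_in(2)[OF o]] word_whisker[OF o o o
      t1_in]
      cmp_Some(1)[OF bh] using rw_letter[OF mult_Ar(2) o] cmp_Some(1)[OF mh cmp_Some(2)[OF bh]] by
        simp
  have dh: "Ar [A, A, A] ((mult C A t1 e \<boxtimes> Idt C A) \<cdot> (BraidInv C A A \<boxtimes> Idt C A) \<cdot> whisker C A A A
    t1) [A, A]
    \<in> wd.Hm [A, A, A] [A, A]"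
    using cmp_Some(2)[OF mh cmp_Some(2)[OF bh]] .
  show "st.splits (([A] @ [A]) @ [A]) ([A] @ [A])
     (wd.cmp (rw (wd.cmp (rw ?e [A]) ?t1) [A]) (wd.cmp (rw (wBi [A] [A]) [A]) (lw [A] ?t1)))"
    unfolding d using d_split splits_iff[OF dh] by simp
qed

end

context regular_bimonoid
begin

abbreviation Cop where "Cop \<equiv> reverse (bar C)"

lemma opposite_whisker:
  assumes Q: "Q \<in> Obj C"
  shows "whisker Cop A A Q q = Assoc C Q A A \<cdot> (q \<boxtimes> Idt C A) \<cdot> AssocInv C Q A A"
proof -
  have "Inv C (Q \<otimes> (A \<otimes> A)) ((Q \<otimes> A) \<otimes> A) (AssocInv C Q A A) = Assoc C Q A A"
    using Q A_Obj by (intro Inv_eq Tensor_Obj inverse_arrows_sym[OF Assoc_inverse])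
  then show ?thesis
    by (simp add: whisker_def AssocInv_def[of Cop] Inv_reverse Inv_bar reverse_data bar_data
      AssocInv_bar)
qed

lemma opposite_braid: "BraidInv Cop A A = Braid C A A" "Braid Cop A A = BraidInv C A A"
proof -
  have "Inv C (A \<otimes> A) (A \<otimes> A) (BraidInv C A A) = Braid C A A"
    using A_Obj by (intro Inv_eq Tensor_Obj inverse_arrows_sym[OF Braid_inverse])
  then show "BraidInv Cop A A = Braid C A A"
    by (simp add: BraidInv_def[of Cop] Inv_reverse Inv_bar reverse_data bar_data)
qed (simp add: reverse_data bar_data)

abbreviation arL where "arL Q q \<equiv> Ar [A, Q] q [A, Q]"
abbreviation arR where "arR Q q \<equiv> Ar [Q, A] q [Q, A]"

lemma arL_in: "arL Q q \<in> wd.Hm [A, Q] [A, Q] \<longleftrightarrow> Q \<in> Obj C \<and> q \<in> Hom C (A \<otimes> Q) (A \<otimes> Q)"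
  and arR_in: "arR Q q \<in> wd.Hm [Q, A] [Q, A] \<longleftrightarrow> Q \<in> Obj C \<and> q \<in> Hom C (Q \<otimes> A) (Q \<otimes> A)"
  using A_Obj by (auto simp: wd.in_Hm)

text \<open>
  On words, splitness is required of the left action only; the right action differs from it by the
  braiding, which is an isomorphism, so it splits as well.
\<close>

lemma regular_module_iff:
  "regular_module C A t1 t4 e Q q1 q4 \<longleftrightarrow> ma.regmod [Q] (arL Q q1) (arR Q q4)"
proof (cases "Q \<in> Obj C \<and> q1 \<in> Hom C (A \<otimes> Q) (A \<otimes> Q) \<and> q4 \<in> Hom C (Q \<otimes> A) (Q \<otimes> A)")
  case False
  have "\<not> regular_module C A t1 t4 e Q q1 q4"
    using False by (auto simp: regular_module_def fusion_module_def reverse_data bar_data)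
  moreover have "\<not> ma.regmod [Q] (arL Q q1) (arR Q q4)"
    using False arL_in[of Q q1] arR_in[of Q q4] ma.regmodD(1-3)[of "[Q]" "arL Q q1" "arR Q q4"] by
      auto
  ultimately show ?thesis by simp
next
  case True
  then have Q: "Q \<in> Obj C" and q1: "q1 \<in> Hom C (A \<otimes> Q) (A \<otimes> Q)" and q4: "q4 \<in> Hom C (Q \<otimes> A) (Q \<otimes> A)"
    by auto
  note o = A_Obj Q
  note act = act_Ar[OF o e_in q1] and ract = mirror_act_Ar[OF o e_in q4]
  let ?v = "LUnit C Q \<cdot> (e \<boxtimes> Idt C Q) \<cdot> q1" and ?w = "RUnit C Q \<cdot> (Idt C Q \<boxtimes> e) \<cdot> q4"
  have b: "Ar [A, Q] (Braid C A Q) [Q, A] \<in> wd.Hm [A, Q] [Q, A]"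
    using Braid_inverse[OF o] o by (auto simp: wd.in_Hm inverse_arrows_def)
  have f1: "fusion_module C A t1 e Q q1 \<longleftrightarrow> st.fusion_law [A] (Ar [A, A] t1 [A, A]) [Q] (arL Q q1) \<and>
      st.splits [A, Q] [Q] (st.act (Ar [A] e []) [Q] (arL Q q1))"
    unfolding fusion_iff[OF o t1_in q1] act(1) splits_iff[OF act(2)] using Q q1
    by (simp add: fusion_module_def)
  have f4: "fusion_module Cop A t4 e Q q4 \<longleftrightarrow> st.mirror.fusion_law [A] (Ar [A, A] t4 [A, A]) [Q]
    (arR Q q4) \<and>
      st.splits [Q, A] [Q] (st.mirror.act (Ar [A] e []) [Q] (arR Q q4))"
    unfolding mirror_fusion_iff[OF o t4_in q4 refl refl] ract(1) splits_iff[OF ract(2)]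
      fusion_module_def opposite_whisker[OF Q] opposite_braid using Q q4
    by (simp add: reverse_data bar_data split_epi_def)
  have c1: "wd.cmp (rw (Ar [A, A] t4 [A, A]) [Q]) (lw [A] (arL Q q1))
      = wd.cmp (lw [A] (arL Q q1)) (rw (Ar [A, A] t4 [A, A]) [Q]) \<longleftrightarrow>
    (t4 \<boxtimes> Idt C Q) \<cdot> whisker C A A Q q1 = whisker C A A Q q1 \<cdot> (t4 \<boxtimes> Idt C Q)"
    unfolding word_rw[OF o(1,1,2) t4_in] word_whisker[OF o(1,1,2) q1]
    using endo3(1)[OF o(1,1,2)] rw_in_Hom[OF o(1,1,2) t4_in] whisker_in[OF o(1,1,2) q1] by simp
  have c4: "wd.cmp (lw [Q] (Ar [A, A] t1 [A, A])) (rw (arR Q q4) [A])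
      = wd.cmp (rw (arR Q q4) [A]) (lw [Q] (Ar [A, A] t1 [A, A])) \<longleftrightarrow>
    whisker C Q A A t1 \<cdot> (q4 \<boxtimes> Idt C A) = (q4 \<boxtimes> Idt C A) \<cdot> whisker C Q A A t1"
    unfolding word_rw[OF o(2,1,1) q4] word_whisker[OF o(2,1,1) t1_in]
    using endo3(1)[OF o(2,1,1)] rw_in_Hom[OF o(2,1,1) q4] whisker_in[OF o(2,1,1) t1_in] by simp
  have assoc: "?w \<cdot> Braid C A Q = RUnit C Q \<cdot> (Idt C Q \<boxtimes> e) \<cdot> q4 \<cdot> Braid C A Q"
  proof -
    have O: "A \<otimes> Q \<in> Obj C" "Q \<otimes> A \<in> Obj C" "Q \<otimes> Unit C \<in> Obj C" using o Tensor_Obj Unit_Obj by auto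
    have r: "RUnit C Q \<in> Hom C (Q \<otimes> Unit C) Q"
      using RUnit_iso[OF Q] by (auto simp: iso_arr_def inverse_arrows_def)
    have ei: "Idt C Q \<boxtimes> e \<in> Hom C (Q \<otimes> A) (Q \<otimes> Unit C)"
      using TensorArr_in_Hom[OF o(2,2,1) Unit_Obj Id_in_Hom[OF o(2)] e_in] .
    have b': "Braid C A Q \<in> Hom C (A \<otimes> Q) (Q \<otimes> A)"
      using Braid_inverse[OF o] by (auto simp: inverse_arrows_def)
    show ?thesis
      unfolding Comp_assoc[OF O(1,2,3) Q b' Comp_in_Hom[OF O(2,2,3) q4 ei] r]
        Comp_assoc[OF O(1,2,2,3) b' q4 ei] ..
  qed
  have a: "st.act (Ar [A] e []) [Q] (arL Q q1)
      = wd.cmp (st.mirror.act (Ar [A] e []) [Q] (arR Q q4)) (wB [A] [Q]) \<longleftrightarrow>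
    ?v = RUnit C Q \<cdot> (Idt C Q \<boxtimes> e) \<cdot> q4 \<cdot> Braid C A Q"
    unfolding act(1) ract(1) wB_letter[OF o] cmp_Some(1)[OF ract(2) b] assoc by simp
  show ?thesis
  proof
    assume "regular_module C A t1 t4 e Q q1 q4"
    then show "ma.regmod [Q] (arL Q q1) (arR Q q4)"
      unfolding regular_module_def ma.regmod_def f1 f4 using True arL_in arR_in c1 c4 a by simp
  next
    assume r: "ma.regmod [Q] (arL Q q1) (arR Q q4)"
    show "regular_module C A t1 t4 e Q q1 q4"
      unfolding regular_module_def f1 f4
      using r ma.ract_splits[OF r] c1 c4 a unfolding ma.regmod_def by simp
  qed
qed

lemma mor_iff:
  assumes f: "f \<in> Hom C Q P" and o: "Q \<in> Obj C" "P \<in> Obj C"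
    and q: "q1 \<in> Hom C (A \<otimes> Q) (A \<otimes> Q)" "q4 \<in> Hom C (Q \<otimes> A) (Q \<otimes> A)"
    and p: "p1 \<in> Hom C (A \<otimes> P) (A \<otimes> P)" "p4 \<in> Hom C (P \<otimes> A) (P \<otimes> A)"
  shows "ma.mor (Ar [Q] f [P]) (arL Q q1) (arR Q q4) (arL P p1) (arR P p4) \<longleftrightarrow>
    (Idt C A \<boxtimes> f) \<cdot> q1 = p1 \<cdot> (Idt C A \<boxtimes> f) \<and> (f \<boxtimes> Idt C A) \<cdot> q4 = p4 \<cdot> (f \<boxtimes> Idt C A)"
proof -
  have F: "Ar [Q] f [P] \<in> wd.Hm [Q] [P]" using f o by (simp add: wd.in_Hm)
  have l: "lw [A] (Ar [Q] f [P]) = Ar [A, Q] (Idt C A \<boxtimes> f) [A, P]" using lw_letter[OF F A_Obj] .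
  have r: "rw (Ar [Q] f [P]) [A] = Ar [Q, A] (f \<boxtimes> Idt C A) [P, A]" using rw_letter[OF F A_Obj] by
    simp
  have h: "Ar [A, Q] (Idt C A \<boxtimes> f) [A, P] \<in> wd.Hm [A, Q] [A, P]"
    "Ar [Q, A] (f \<boxtimes> Idt C A) [P, A] \<in> wd.Hm [Q, A] [P, A]"
    using lw_in[OF F, of "[A]"] rw_in[OF F, of "[A]"] l r A_Obj by simp_all
  have t: "arL Q q1 \<in> wd.Hm [A, Q] [A, Q]" "arR Q q4 \<in> wd.Hm [Q, A] [Q, A]"
     "arL P p1 \<in> wd.Hm [A, P] [A, P]" "arR P p4 \<in> wd.Hm [P, A] [P, A]"
    using arL_in arR_in o q p by blast+
  show ?thesis
    unfolding ma.mor_def l r cmp_Some(1)[OF h(1) t(1)] cmp_Some(1)[OF h(2) t(2)]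
      cmp_Some(1)[OF t(3) h(1)] cmp_Some(1)[OF t(4) h(2)] by simp
qed

abbreviation obj_of where "obj_of w \<equiv> ev C (tree_of w)"

definition underlying :: "('o list \<times> 'm \<times> 'o list) option \<Rightarrow> 'm" where "underlying f = fst (snd
  (the f))"

lemma underlying: "f \<in> wd.Hm x y \<Longrightarrow> Ar x (underlying f) y = f"
  by (auto elim!: wd.HmE simp: underlying_def)

section \<open>The monoidal category of modules\<close>

text \<open>
  A word is isomorphic to the one-letter word of its product, by an identity arrow of \<open>C\<close>.
\<close>

definition bracket where "bracket w = Ar w (Idt C (obj_of w)) [obj_of w]"
definition unbracket where "unbracket w = Ar [obj_of w] (Idt C (obj_of w)) w"

lemma bracket:
  assumes w: "w \<in> words"
  shows "bracket w \<in> wd.Hm w [obj_of w]" "unbracket w \<in> wd.Hm [obj_of w] w"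
    "wd.cmp (bracket w) (unbracket w) = wd.idn [obj_of w]" "wd.cmp (unbracket w) (bracket w) =
      wd.idn w"
  using w Id_in_Hom[OF wd.T_Obj[OF w]] Id_Comp[OF wd.T_Obj[OF w] wd.T_Obj[OF w] Id_in_Hom[OF
    wd.T_Obj[OF w]]]
    wd.T_Obj[OF w]
  by (auto simp: bracket_def unbracket_def wd.in_Hm wd.idn_def)

text \<open>
  The module in \<open>C\<close> obtained from a module structure on the word \<open>w\<close> by transport to its product.
\<close>

definition module_of where
  "module_of w q1 q4 = (obj_of w,
     underlying (wd.cmp (lw [A] (bracket w)) (wd.cmp q1 (lw [A] (unbracket w)))),
     underlying (wd.cmp (rw (bracket w) [A]) (wd.cmp q4 (rw (unbracket w) [A]))))"

lemma module_of:
  assumes r: "ma.regmod w q1 q4" and R: "module_of w q1 q4 = (R, r1, r4)"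
  shows "R = obj_of w" "ma.regmod [R] (arL R r1) (arR R r4)"
    "ma.mor (bracket w) q1 q4 (arL R r1) (arR R r4)"
    "ma.mor (unbracket w) (arL R r1) (arR R r4) q1 q4"
proof -
  note w = ma.regmodD(1)[OF r]
  note b = bracket[OF w]
  note tr = ma.regmod_transport[OF r b]
  show R': "R = obj_of w" using R by (simp add: module_of_def)
  have e: "wd.cmp (lw [A] (bracket w)) (wd.cmp q1 (lw [A] (unbracket w))) = arL R r1"
    "wd.cmp (rw (bracket w) [A]) (wd.cmp q4 (rw (unbracket w) [A])) = arR R r4"
    using underlying[OF ma.regmodD(2)[OF tr(1)]] underlying[OF ma.regmodD(3)[OF tr(1)]] R by
      (simp_all add: module_of_def)
  show "ma.regmod [R] (arL R r1) (arR R r4)" "ma.mor (bracket w) q1 q4 (arL R r1) (arR R r4)"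
    "ma.mor (unbracket w) (arL R r1) (arR R r4) q1 q4"
    using tr unfolding e unfolding R' by auto
qed

lemma module_of_letter:
  assumes r: "ma.regmod [Q] (arL Q q1) (arR Q q4)" shows "module_of [Q] (arL Q q1) (arR Q q4) =
    (Q, q1, q4)"
proof -
  have w: "[Q] \<in> words" using ma.regmodD(1)[OF r] .
  have "bracket [Q] = wd.idn [Q]" "unbracket [Q] = wd.idn [Q]"
    using w by (simp_all add: bracket_def unbracket_def wd.idn_def)
  then show ?thesis
    using w A_Obj ma.regmodD(2,3)[OF r]
    by (simp add: module_of_def lw_idn rw_idn wd.idn_cmp wd.cmp_idn underlying_def del:
      wd.cmp.simps)
qed

abbreviation Mod where "Mod \<equiv> module_category C A t1 t4 e"

lemma Obj_Mod: "(Q, q1, q4) \<in> Obj Mod \<longleftrightarrow> ma.regmod [Q] (arL Q q1) (arR Q q4)"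
  by (simp add: module_category_def regular_module_iff)

lemma regmod_letterD:
  assumes "ma.regmod [Q] (arL Q q1) (arR Q q4)"
  shows "Q \<in> Obj C" "q1 \<in> Hom C (A \<otimes> Q) (A \<otimes> Q)" "q4 \<in> Hom C (Q \<otimes> A) (Q \<otimes> A)"
  using ma.regmodD(1-3)[OF assms] by (auto simp: wd.in_Hm)

lemma Hom_Mod:
  assumes "ma.regmod [Q] (arL Q q1) (arR Q q4)" "ma.regmod [P] (arL P p1) (arR P p4)"
  shows "f \<in> Hom Mod (Q, q1, q4) (P, p1, p4) \<longleftrightarrow>
    Ar [Q] f [P] \<in> wd.Hm [Q] [P] \<and> ma.mor (Ar [Q] f [P]) (arL Q q1) (arR Q q4) (arL P p1) (arR P
      p4)"
  using mor_iff[OF _ regmod_letterD(1)[OF assms(1)] regmod_letterD(1)[OF assms(2)]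
      regmod_letterD(2,3)[OF assms(1)] regmod_letterD(2,3)[OF assms(2)], of f]
    regmod_letterD(1)[OF assms(1)] regmod_letterD(1)[OF assms(2)]
  by (auto simp: module_category_def wd.in_Hm)

lemma module_of_Obj: "ma.regmod w q1 q4 \<Longrightarrow> module_of w q1 q4 \<in> Obj Mod"
  by (cases "module_of w q1 q4") (simp add: Obj_Mod module_of(2))

text \<open>
  Bracketing is an identity in \<open>C\<close>, so a morphism of word modules and the induced morphism of
  modules in \<open>C\<close> have the same underlying arrow.
\<close>

lemma module_of_mor:
  assumes q: "ma.regmod w q1 q4" and p: "ma.regmod v p1 p4"
    and f: "Ar w f v \<in> wd.Hm w v" and m: "ma.mor (Ar w f v) q1 q4 p1 p4"
  shows "f \<in> Hom Mod (module_of w q1 q4) (module_of v p1 p4)"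
proof -
  obtain Q r1 r4 where Q: "module_of w q1 q4 = (Q, r1, r4)" by (cases "module_of w q1 q4")
  obtain P s1 s4 where P: "module_of v p1 p4 = (P, s1, s4)" by (cases "module_of v p1 p4")
  note rQ = module_of[OF q Q] and rP = module_of[OF p P]
  have w: "w \<in> words" "v \<in> words" using f wd.Hm_V by auto
  have O: "obj_of w \<in> Obj C" "obj_of v \<in> Obj C" using w wd.T_Obj by auto
  have F: "f \<in> Hom C (obj_of w) (obj_of v)" using f by (simp add: wd.in_Hm)
  note i = Id_in_Hom[OF O(1)] Id_in_Hom[OF O(2)]
  have fi: "Ar [obj_of w] (f \<cdot> Idt C (obj_of w)) v \<in> wd.Hm [obj_of w] v"
    "wd.cmp (Ar w f v) (unbracket w) = Ar [obj_of w] f v"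
    using cmp_Some[OF f bracket(2)[OF w(1), unfolded unbracket_def]] Comp_Id[OF O F]
    by (simp_all add: unbracket_def)
  have "wd.cmp (bracket v) (wd.cmp (Ar w f v) (unbracket w)) = Ar [obj_of w] f [obj_of v]"
    unfolding fi(2) bracket_def using cmp_Some(1)[OF bracket(1)[OF w(2), unfolded bracket_def], of
      "[obj_of w]" f]
      fi(1) Comp_Id[OF O F] Id_Comp[OF O F] by simp
  moreover have "Ar [obj_of w] f [obj_of v] \<in> wd.Hm [obj_of w] [obj_of v]" using F O by (simp add:
    wd.in_Hm)
  moreover have "ma.mor (wd.cmp (bracket v) (wd.cmp (Ar w f v) (unbracket w)))
     (arL Q r1) (arR Q r4) (arL P s1) (arR P s4)"
    using ma.mor_comp[OF ma.mor_comp[OF rQ(4) m] rP(3)] by simp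
  ultimately show ?thesis
    unfolding Q P Hom_Mod[OF rQ(2) rP(2)] using rQ(1) rP(1) by simp
qed

fun mod_tensor :: "'o \<times> 'm \<times> 'm \<Rightarrow> 'o \<times> 'm \<times> 'm \<Rightarrow> 'o \<times> 'm \<times> 'm" where
  "mod_tensor (Q, q1, q4) (P, p1, p4) = module_of [Q, P]
    (st.tens [A] [Q] (arL Q q1) [P] (arL P p1)) (st.mirror.tens [A] [P] (arR P p4) [Q] (arR Q q4))"

definition mod_unit where "mod_unit = module_of [] (wd.idn [A]) (wd.idn [A])"

definition Mods :: "('o \<times> 'm \<times> 'm, 'm) monoidal_data" where
  "Mods = \<lparr>Obj = Obj Mod, Hom = Hom Mod, Idt = Idt Mod, Comp = Comp Mod,
    Tensor = mod_tensor, TensorArr = TensorArr C, Unit = mod_unit,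
    Assoc = (\<lambda>X Y Z. Assoc C (fst X) (fst Y) (fst Z)),
    LUnit = (\<lambda>X. LUnit C (fst X)), RUnit = (\<lambda>X. RUnit C (fst X))\<rparr>"

lemma Mods_simps [simp]: "Obj Mods = Obj Mod" "Hom Mods = Hom Mod" "Idt Mods X = Idt C (fst X)"
  "Comp Mods = Comp C"
  "Tensor Mods = mod_tensor" "TensorArr Mods = TensorArr C" "Unit Mods = mod_unit"
  "Assoc Mods X Y Z = Assoc C (fst X) (fst Y) (fst Z)" "LUnit Mods X = LUnit C (fst X)"
  "RUnit Mods X = RUnit C (fst X)"
  by (cases X; simp add: Mods_def module_category_def)+

lemma fst_mod_tensor [simp]: "fst (mod_tensor X Y) = fst X \<otimes> fst Y"
  by (cases X; cases Y) (simp add: module_of_def)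

lemma fst_mod_unit [simp]: "fst mod_unit = Unit C"
  by (simp add: mod_unit_def module_of_def)

lemma Obj_Mod_C: "X \<in> Obj Mod \<Longrightarrow> fst X \<in> Obj C"
  using Obj_Mod regmod_letterD(1) by (cases X) auto

lemma Hom_Mod_C: "f \<in> Hom Mod X Y \<Longrightarrow> f \<in> Hom C (fst X) (fst Y)"
  by (cases X; cases Y) (auto simp: module_category_def)

lemma mod_tensor_regmod:
  assumes "(Q, q1, q4) \<in> Obj Mod" "(P, p1, p4) \<in> Obj Mod"
  shows "ma.regmod [Q, P] (st.tens [A] [Q] (arL Q q1) [P] (arL P p1))
    (st.mirror.tens [A] [P] (arR P p4) [Q] (arR Q q4))"
  using ma.regmod_tens[of "[Q]" "arL Q q1" "arR Q q4" "[P]" "arL P p1" "arR P p4"] assms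
  unfolding Obj_Mod by simp

lemma mod_tensor_Obj: "X \<in> Obj Mod \<Longrightarrow> Y \<in> Obj Mod \<Longrightarrow> mod_tensor X Y \<in> Obj Mod"
  using module_of_Obj[OF mod_tensor_regmod] by (cases X; cases Y) auto

lemma mod_unit_Obj: "mod_unit \<in> Obj Mod"
  unfolding mod_unit_def using module_of_Obj[OF ma.regmod_unit] .

text \<open>
  The inverse in \<open>C\<close> of a morphism of modules is one, so the forgetful functor reflects
  isomorphisms.
\<close>

lemma iso_Mod:
  assumes X: "X \<in> Obj Mod" and Y: "Y \<in> Obj Mod" and f: "f \<in> Hom Mod X Y"
    and i: "iso_arr C (fst X) (fst Y) f"
  shows "iso_arr Mods X Y f"
proof -
  obtain Q q1 q4 where XQ: "X = (Q, q1, q4)" by (cases X)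
  obtain P p1 p4 where YP: "Y = (P, p1, p4)" by (cases Y)
  obtain g where g: "f \<in> Hom C Q P" "g \<in> Hom C P Q" "g \<cdot> f = Idt C Q" "f \<cdot> g = Idt C P"
    using i XQ YP by (auto simp: iso_arr_def inverse_arrows_def)
  note q = X[unfolded XQ Obj_Mod] and p = Y[unfolded YP Obj_Mod]
  note o = regmod_letterD(1)[OF q] regmod_letterD(1)[OF p]
  have F: "Ar [Q] f [P] \<in> wd.Hm [Q] [P]" and G: "Ar [P] g [Q] \<in> wd.Hm [P] [Q]"
    using o g by (auto simp: wd.in_Hm)
  have "wd.cmp (Ar [P] g [Q]) (Ar [Q] f [P]) = wd.idn [Q]" "wd.cmp (Ar [Q] f [P]) (Ar [P] g [Q]) =
    wd.idn [P]"
    using cmp_Some(1)[OF F G] cmp_Some(1)[OF G F] g o by (auto simp: wd.idn_def)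
  from ma.mor_inverse[OF _ q p F G this] f
  have "g \<in> Hom Mod Y X" unfolding XQ YP Hom_Mod[OF q p] Hom_Mod[OF p q] using G by blast
  then show ?thesis
    using f g XQ YP unfolding iso_arr_def inverse_arrows_def by auto
qed

lemma tens_arr:
  assumes "X \<in> Obj Mod" "X' \<in> Obj Mod" "Y \<in> Obj Mod" "Y' \<in> Obj Mod"
    and "f \<in> Hom Mod X X'" "g \<in> Hom Mod Y Y'"
  shows "f \<boxtimes> g \<in> Hom Mod (mod_tensor X Y) (mod_tensor X' Y')"
proof -
  obtain Q q1 q4 where X: "X = (Q, q1, q4)" by (cases X)
  obtain Q' q1' q4' where X': "X' = (Q', q1', q4')" by (cases X')
  obtain P p1 p4 where Y: "Y = (P, p1, p4)" by (cases Y)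
  obtain P' p1' p4' where Y': "Y' = (P', p1', p4')" by (cases Y')
  note q = assms(1)[unfolded X Obj_Mod] and q' = assms(2)[unfolded X' Obj_Mod]
    and p = assms(3)[unfolded Y Obj_Mod] and p' = assms(4)[unfolded Y' Obj_Mod]
  have f: "Ar [Q] f [Q'] \<in> wd.Hm [Q] [Q']" "ma.mor (Ar [Q] f [Q']) (arL Q q1) (arR Q q4) (arL Q'
    q1') (arR Q' q4')"
    using assms(5) unfolding X X' Hom_Mod[OF q q'] by blast+
  have g: "Ar [P] g [P'] \<in> wd.Hm [P] [P']" "ma.mor (Ar [P] g [P']) (arL P p1) (arR P p4) (arL P'
    p1') (arR P' p4')"
    using assms(6) unfolding Y Y' Hom_Mod[OF p p'] by blast+
  note m = ma.mor_comp[OF ma.mor_lw[OF g q] ma.mor_rw[OF f p']]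
  have c: "wd.cmp (rw (Ar [Q] f [Q']) [P']) (lw [Q] (Ar [P] g [P'])) = Ar [Q, P] (f \<boxtimes> g) [Q', P']"
    "Ar [Q, P] (f \<boxtimes> g) [Q', P'] \<in> wd.Hm [Q, P] [Q', P']"
    using word_interchange(1)[OF f(1) g(1)] ten_letter[OF f(1) g(1)] ten_in[OF f(1) g(1)] by
      simp_all
  show ?thesis
    using module_of_mor[OF mod_tensor_regmod mod_tensor_regmod c(2)] m unfolding c(1) X X' Y Y'
    using assms(1-4) X X' Y Y' by simp
qed

text \<open>
  Between \<open>[Q \<otimes> P, R]\<close> and \<open>[Q, P \<otimes> R]\<close> lies \<open>[Q, P, R]\<close>, on which the two iterated tensor
  products of word modules are equal. Unbracketing \<open>[Q, P]\<close> and bracketing \<open>[P, R]\<close> preserve the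
  module structures, and their composite is the associator.
\<close>

lemma assoc_mor:
  assumes "X \<in> Obj Mod" "Y \<in> Obj Mod" "Z \<in> Obj Mod"
  shows "Assoc C (fst X) (fst Y) (fst Z) \<in> Hom Mod (mod_tensor (mod_tensor X Y) Z) (mod_tensor X
    (mod_tensor Y Z))"
proof -
  obtain Q q1 q4 where X: "X = (Q, q1, q4)" by (cases X)
  obtain P p1 p4 where Y: "Y = (P, p1, p4)" by (cases Y)
  obtain R r1 r4 where Z: "Z = (R, r1, r4)" by (cases Z)
  note q = assms(1)[unfolded X Obj_Mod] and p = assms(2)[unfolded Y Obj_Mod]
    and r = assms(3)[unfolded Z Obj_Mod]
  note o = regmod_letterD(1)[OF q] regmod_letterD(1)[OF p] regmod_letterD(1)[OF r]
  note O = Tensor_Obj[OF o(1,2)] Tensor_Obj[OF o(2,3)]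
  note qp = mod_tensor_regmod[OF assms(1,2)[unfolded X Y]] and pr = mod_tensor_regmod[OF
    assms(2,3)[unfolded Y Z]]
  obtain QP u1 u4 where XY: "mod_tensor X Y = (QP, u1, u4)" by (cases "mod_tensor X Y")
  obtain PR v1 v4 where YZ: "mod_tensor Y Z = (PR, v1, v4)" by (cases "mod_tensor Y Z")
  note u = module_of[OF qp XY[unfolded X Y mod_tensor.simps]] and v = module_of[OF pr YZ[unfolded
    Y Z mod_tensor.simps]]
  have QP: "QP = Q \<otimes> P" and PR: "PR = P \<otimes> R" using u(1) v(1) by simp_all
  have w: "[Q, P] \<in> words" "[P, R] \<in> words" using o by auto
  note bu = bracket(2)[OF w(1)] and bv = bracket(1)[OF w(2)]
  have bu': "unbracket [Q, P] \<in> wd.Hm [QP] [Q, P]" and bv': "bracket [P, R] \<in> wd.Hm [P, R] [PR]"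
    using bu bv QP PR by simp_all
  note m1 = ma.mor_rw[OF bu' u(4) r]
  note m2 = ma.mor_lw[OF bv' v(3) q]
  have a: "[A] \<in> words" "[Q] \<in> words" "[P] \<in> words" "[R] \<in> words" using A_Obj o by auto
  have t1: "st.tens [A] [Q, P] (st.tens [A] [Q] (arL Q q1) [P] (arL P p1)) [R] (arL R r1)
     = st.tens [A] [Q] (arL Q q1) [P, R] (st.tens [A] [P] (arL P p1) [R] (arL R r1))"
    using st.tens_assoc[OF a ma.regmodD(2)[OF q] ma.regmodD(2)[OF p] ma.regmodD(2)[OF r]] by simp
  have t4: "st.mirror.tens [A] [R] (arR R r4) [Q, P] (st.mirror.tens [A] [P] (arR P p4) [Q] (arR Q
    q4))
     = st.mirror.tens [A] [P, R] (st.mirror.tens [A] [R] (arR R r4) [P] (arR P p4)) [Q] (arR Q q4)"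
    using st.mirror.tens_assoc[OF a(1,4,3,2) ma.regmodD(3)[OF r] ma.regmodD(3)[OF p]
      ma.regmodD(3)[OF q]] by simp
  note m = ma.mor_comp[OF m1[unfolded t1 t4] m2]
  have "rw (unbracket [Q, P]) [R] = Ar [QP, R] (Idt C (Q \<otimes> P) \<boxtimes> Idt C R) [Q, P, R]"
    using rw_letter[of "[QP]" "Idt C (Q \<otimes> P)" "[Q, P]" R] bu' o by (simp add: unbracket_def QP)
  then have r1: "rw (unbracket [Q, P]) [R] = Ar [QP, R] (Idt C ((Q \<otimes> P) \<otimes> R)) [Q, P, R]"
    using TensorArr_Id[OF O(1) o(3)] by simp
  have ai: "Assoc C Q P R \<in> Hom C ((Q \<otimes> P) \<otimes> R) (Q \<otimes> (P \<otimes> R))"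
    using Assoc_inverse[OF o] by (auto simp: inverse_arrows_def)
  have "lw [Q] (bracket [P, R]) = Ar [Q, P, R] ((Idt C Q \<boxtimes> Idt C (P \<otimes> R)) \<cdot> Assoc C Q P R) [Q, PR]"
    using lw_bracket[of P R "Idt C (P \<otimes> R)" PR Q] bv' o by (simp add: bracket_def PR)
  then have l1: "lw [Q] (bracket [P, R]) = Ar [Q, P, R] (Assoc C Q P R) [Q, PR]"
    using TensorArr_Id[OF o(1) O(2)] Id_Comp[OF Tensor_Obj[OF O(1) o(3)] Tensor_Obj[OF o(1) O(2)]
      ai] by simp
  have h: "Ar [QP, R] (Idt C ((Q \<otimes> P) \<otimes> R)) [Q, P, R] \<in> wd.Hm [QP, R] [Q, P, R]"
    "Ar [Q, P, R] (Assoc C Q P R) [Q, PR] \<in> wd.Hm [Q, P, R] [Q, PR]"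
    using rw_in[OF bu', of "[R]"] lw_in[OF bv', of "[Q]"] r1 l1 o by simp_all
  have c: "wd.cmp (lw [Q] (bracket [P, R])) (rw (unbracket [Q, P]) [R]) = Ar [QP, R] (Assoc C Q P
    R) [Q, PR]"
    "Ar [QP, R] (Assoc C Q P R) [Q, PR] \<in> wd.Hm [QP, R] [Q, PR]"
    using cmp_Some[OF h(2,1)] Comp_Id[OF Tensor_Obj[OF O(1) o(3)] Tensor_Obj[OF o(1) O(2)] ai]
    unfolding r1 l1 by simp_all
  have d: "(QP, u1, u4) \<in> Obj Mod" "(PR, v1, v4) \<in> Obj Mod" using u(2) v(2) Obj_Mod by blast+
  show ?thesis
    unfolding XY YZ unfolding X Z Y
    using module_of_mor[OF mod_tensor_regmod[OF d(1)] mod_tensor_regmod[OF _ d(2)] c(2)] m assms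
    unfolding c(1) X Y Z by simp
qed

text \<open>
  The unit module comes from the empty word, which is strictly neutral; unbracketing the empty
  word next to \<open>Q\<close> is the unit isomorphism.
\<close>

lemma unit_mor:
  assumes "X \<in> Obj Mod"
  shows "LUnit C (fst X) \<in> Hom Mod (mod_tensor mod_unit X) X" "RUnit C (fst X) \<in> Hom Mod
    (mod_tensor X mod_unit) X"
proof -
  obtain Q q1 q4 where X: "X = (Q, q1, q4)" by (cases X)
  note q = assms[unfolded X Obj_Mod]
  note o = regmod_letterD(1)[OF q]
  obtain I u1 u4 where Void: "mod_unit = (I, u1, u4)" by (cases mod_unit)
  note u = module_of[OF ma.regmod_unit Void[unfolded mod_unit_def]]
  have I: "I = Unit C" using u(1) by simp
  have b: "unbracket [] = Ar [I] (Idt C I) []" "unbracket [] \<in> wd.Hm [I] []"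
    using bracket(2)[of "[]"] I by (simp_all add: unbracket_def)
  have a: "[A] \<in> words" "[Q] \<in> words" using A_Obj o by auto
  note m1 = ma.mor_rw[OF b(2) u(4) q] and m2 = ma.mor_lw[OF b(2) u(4) q]
  have ts: "st.tens [A] [] (wd.idn [A]) [Q] (arL Q q1) = arL Q q1"
    "st.mirror.tens [A] [Q] (arR Q q4) [] (wd.idn [A]) = arR Q q4"
    "st.tens [A] [Q] (arL Q q1) [] (wd.idn [A]) = arL Q q1"
    "st.mirror.tens [A] [] (wd.idn [A]) [Q] (arR Q q4) = arR Q q4"
    using st.tens_emp_l[OF a ma.regmodD(2)[OF q]] st.mirror.tens_emp_r[OF a ma.regmodD(3)[OF q]]
     st.tens_emp_r[OF a ma.regmodD(2)[OF q]] st.mirror.tens_emp_l[OF a ma.regmodD(3)[OF q]] by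
       simp_all
  have O: "Unit C \<otimes> Q \<in> Obj C" "Q \<otimes> Unit C \<in> Obj C" using o Unit_Obj Tensor_Obj by auto
  have lr: "LUnit C Q \<in> Hom C (Unit C \<otimes> Q) Q" "RUnit C Q \<in> Hom C (Q \<otimes> Unit C) Q"
    using LUnit_iso[OF o] RUnit_iso[OF o] by (auto simp: iso_arr_def inverse_arrows_def)
  have r: "rw (unbracket []) [Q] = Ar [I, Q] (LUnit C Q) [Q]"
    using rw_counit[OF b(2)[unfolded b(1)] o] TensorArr_Id[OF Unit_Obj o] Comp_Id[OF O(1) o lr(1)]
      I b(1) by simp
  have l: "lw [Q] (unbracket []) = Ar [Q, I] (RUnit C Q) [Q]"
    using lw_counit[OF b(2)[unfolded b(1)] o] TensorArr_Id[OF o Unit_Obj] Comp_Id[OF O(2) o lr(2)]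
      I b(1) by simp
  have h: "Ar [I, Q] (LUnit C Q) [Q] \<in> wd.Hm [I, Q] [Q]" "Ar [Q, I] (RUnit C Q) [Q] \<in> wd.Hm [Q, I]
    [Q]"
    using rw_in[OF b(2), of "[Q]"] lw_in[OF b(2), of "[Q]"] r l o by simp_all
  have d: "(I, u1, u4) \<in> Obj Mod" using u(2) Obj_Mod by blast
  have xs: "module_of [Q] (arL Q q1) (arR Q q4) = X" using module_of_letter[OF q] X by simp
  show "LUnit C (fst X) \<in> Hom Mod (mod_tensor mod_unit X) X"
    using module_of_mor[OF mod_tensor_regmod[OF d assms[unfolded X]] q h(1)] m1[unfolded ts r] xs
      X Void by simp
  show "RUnit C (fst X) \<in> Hom Mod (mod_tensor X mod_unit) X"
    using module_of_mor[OF mod_tensor_regmod[OF assms[unfolded X] d] q h(2)] m2[unfolded ts l] xs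
      X Void by simp
qed

lemma id_mor: assumes "X \<in> Obj Mod" shows "Idt C (fst X) \<in> Hom Mod X X"
proof -
  obtain Q q1 q4 where X: "X = (Q, q1, q4)" by (cases X)
  note q = assms[unfolded X Obj_Mod]
  have "wd.idn [Q] = Ar [Q] (Idt C Q) [Q]" using regmod_letterD(1)[OF q] by (simp add: wd.idn_def)
  then show ?thesis
    unfolding X Hom_Mod[OF q q] using ma.mor_Id[OF q] wd.idn_in[OF ma.regmodD(1)[OF q]] by simp
qed

lemma comp_mor:
  assumes "X \<in> Obj Mod" "Y \<in> Obj Mod" "Z \<in> Obj Mod" "f \<in> Hom Mod X Y" "g \<in> Hom Mod Y Z"
  shows "g \<cdot> f \<in> Hom Mod X Z"
proof -
  obtain Q q1 q4 where X: "X = (Q, q1, q4)" by (cases X)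
  obtain P p1 p4 where Y: "Y = (P, p1, p4)" by (cases Y)
  obtain R r1 r4 where Z: "Z = (R, r1, r4)" by (cases Z)
  note q = assms(1)[unfolded X Obj_Mod] and p = assms(2)[unfolded Y Obj_Mod]
    and r = assms(3)[unfolded Z Obj_Mod]
  note f = assms(4)[unfolded X Y Hom_Mod[OF q p]] and g = assms(5)[unfolded Y Z Hom_Mod[OF p r]]
  show ?thesis
    unfolding X Z Hom_Mod[OF q r]
    using cmp_Some[OF conjunct1[OF g] conjunct1[OF f]] ma.mor_comp[OF conjunct2[OF f] conjunct2[OF
      g]]
    by metis
qed

lemma monoidal_Mods: "monoidal_category Mods"
proof (unfold_locales, unfold Mods_simps)
  note o = Obj_Mod_C and h = Hom_Mod_C
  fix X assume X: "X \<in> Obj Mod"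
  show "Idt C (fst X) \<in> Hom Mod X X" using id_mor[OF X] .
  show "iso_arr Mods (mod_tensor mod_unit X) X (LUnit C (fst X))" "iso_arr Mods (mod_tensor X
    mod_unit) X (RUnit C (fst X))"
    using iso_Mod[OF mod_tensor_Obj[OF mod_unit_Obj X] X unit_mor(1)[OF X]]
      iso_Mod[OF mod_tensor_Obj[OF X mod_unit_Obj] X unit_mor(2)[OF X]] LUnit_iso RUnit_iso o[OF
        X] by simp_all
  fix Y assume Y: "Y \<in> Obj Mod"
  show "mod_tensor X Y \<in> Obj Mod" using mod_tensor_Obj[OF X Y] .
  show "Idt C (fst X) \<boxtimes> Idt C (fst Y) = Idt C (fst (mod_tensor X Y))"
    using TensorArr_Id[OF o[OF X] o[OF Y]] by simp
  show "(Idt C (fst X) \<boxtimes> LUnit C (fst Y)) \<cdot> Assoc C (fst X) (fst mod_unit) (fst Y)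
      = RUnit C (fst X) \<boxtimes> Idt C (fst Y)"
    using triangle[OF o[OF X] o[OF Y]] by simp
  fix Z assume Z: "Z \<in> Obj Mod"
  show "iso_arr Mods (mod_tensor (mod_tensor X Y) Z) (mod_tensor X (mod_tensor Y Z)) (Assoc C (fst
    X) (fst Y) (fst Z))"
    using iso_Mod[OF mod_tensor_Obj[OF mod_tensor_Obj[OF X Y] Z] mod_tensor_Obj[OF X
      mod_tensor_Obj[OF Y Z]]
      assoc_mor[OF X Y Z]] Assoc_iso[OF o[OF X] o[OF Y] o[OF Z]] by simp
  fix V assume V: "V \<in> Obj Mod"
  show "Assoc C (fst V) (fst X) (fst (mod_tensor Y Z)) \<cdot> Assoc C (fst (mod_tensor V X)) (fst Y)
    (fst Z)
    = (Idt C (fst V) \<boxtimes> Assoc C (fst X) (fst Y) (fst Z)) \<cdot> Assoc C (fst V) (fst (mod_tensor X Y))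
      (fst Z)
      \<cdot> (Assoc C (fst V) (fst X) (fst Y) \<boxtimes> Idt C (fst Z))"
    using pentagon[OF o[OF V] o[OF X] o[OF Y] o[OF Z]] by simp
next
  note o = Obj_Mod_C and h = Hom_Mod_C
  fix X Y f assume X: "X \<in> Obj Mod" and Y: "Y \<in> Obj Mod" and f: "f \<in> Hom Mod X Y"
  show "Idt C (fst Y) \<cdot> f = f" "f \<cdot> Idt C (fst X) = f"
    using Id_Comp[OF o[OF X] o[OF Y] h[OF f]] Comp_Id[OF o[OF X] o[OF Y] h[OF f]] .
  show "LUnit C (fst Y) \<cdot> (Idt C (fst mod_unit) \<boxtimes> f) = f \<cdot> LUnit C (fst X)"
    "RUnit C (fst Y) \<cdot> (f \<boxtimes> Idt C (fst mod_unit)) = f \<cdot> RUnit C (fst X)"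
    using LUnit_natural[OF o[OF X] o[OF Y] h[OF f]] RUnit_natural[OF o[OF X] o[OF Y] h[OF f]] by
      simp_all
  fix Z g assume Z: "Z \<in> Obj Mod" and g: "g \<in> Hom Mod Y Z"
  show "g \<cdot> f \<in> Hom Mod X Z" using comp_mor[OF X Y Z f g] .
next
  note o = Obj_Mod_C and h = Hom_Mod_C
  fix V X Y Z f g k
  assume O: "V \<in> Obj Mod" "X \<in> Obj Mod" "Y \<in> Obj Mod" "Z \<in> Obj Mod"
    and H: "f \<in> Hom Mod V X" "g \<in> Hom Mod X Y" "k \<in> Hom Mod Y Z"
  show "(k \<cdot> g) \<cdot> f = k \<cdot> (g \<cdot> f)"
    using Comp_assoc[OF o[OF O(1)] o[OF O(2)] o[OF O(3)] o[OF O(4)] h[OF H(1)] h[OF H(2)] h[OF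
      H(3)]] .
next
  fix X X' Y Y' f g
  assume "X \<in> Obj Mod" "X' \<in> Obj Mod" "Y \<in> Obj Mod" "Y' \<in> Obj Mod"
    "f \<in> Hom Mod X X'" "g \<in> Hom Mod Y Y'"
  then show "f \<boxtimes> g \<in> Hom Mod (mod_tensor X Y) (mod_tensor X' Y')" by (rule tens_arr)
next
  fix X X' X'' Y Y' Y'' f f' g g'
  assume "X \<in> Obj Mod" "X' \<in> Obj Mod" "X'' \<in> Obj Mod" "Y \<in> Obj Mod" "Y' \<in> Obj Mod" "Y'' \<in> Obj Mod"
    "f \<in> Hom Mod X X'" "f' \<in> Hom Mod X' X''" "g \<in> Hom Mod Y Y'" "g' \<in> Hom Mod Y' Y''"
  then show "(f' \<cdot> f) \<boxtimes> (g' \<cdot> g) = (f' \<boxtimes> g') \<cdot> (f \<boxtimes> g)"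
    by (intro TensorArr_Comp[of "fst X" "fst X'" "fst X''" "fst Y" "fst Y'" "fst Y''"] Obj_Mod_C
      Hom_Mod_C)
next
  fix X X' Y Y' Z Z' f g k
  assume "X \<in> Obj Mod" "X' \<in> Obj Mod" "Y \<in> Obj Mod" "Y' \<in> Obj Mod" "Z \<in> Obj Mod" "Z' \<in> Obj Mod"
    "f \<in> Hom Mod X X'" "g \<in> Hom Mod Y Y'" "k \<in> Hom Mod Z Z'"
  then show "Assoc C (fst X') (fst Y') (fst Z') \<cdot> ((f \<boxtimes> g) \<boxtimes> k)
      = (f \<boxtimes> (g \<boxtimes> k)) \<cdot> Assoc C (fst X) (fst Y) (fst Z)"
    by (intro Assoc_natural[of "fst X" "fst X'" "fst Y" "fst Y'" "fst Z" "fst Z'"] Obj_Mod_C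
      Hom_Mod_C)
qed (rule mod_unit_Obj)

lemma strict_Mods: "strict_monoidal_functor Mods C (\<lambda>(Q, q1, q4). Q) (\<lambda>_ _ f. f)"
proof -
  have f: "(\<lambda>(Q, q1, q4). Q) = (fst :: 'o \<times> 'm \<times> 'm \<Rightarrow> 'o)" by (simp add: fun_eq_iff)
  interpret m: monoidal_category Mods by (rule monoidal_Mods)
  show ?thesis
    unfolding f by unfold_locales (simp_all add: Obj_Mod_C Hom_Mod_C)
qed

lemma truncate_Mods: "category_data.truncate Mods = Mod"
  by (simp add: category_data.truncate_def Mods_def module_category_def)

end

theorem corollary5p9:
  fixes C :: "('o, 'm) braided_data" (structure)
    and A :: 'o and t1 t2 t3 t4 e :: 'm
  assumes "braided_monoidal_category C"
    and "regular_multiplier_bimonoid C A t1 t2 t3 t4 e"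
    and "split_epi C A (Unit C) e"
    and "split_epi C ((A \<otimes> A) \<otimes> A) (A \<otimes> A)
      ((mult C A t1 e \<boxtimes> Idt C A) \<cdot> (BraidInv C A A \<boxtimes> Idt C A) \<cdot> whisker C A A A t1)"
    and "split_epi C ((A \<otimes> A) \<otimes> A) (A \<otimes> A)
      ((Idt C A \<boxtimes> mult C A t1 e) \<cdot> Assoc C A A A \<cdot> (t4 \<boxtimes> Idt C A))"
  shows "\<exists>M :: ('o \<times> 'm \<times> 'm, 'm) monoidal_data.
    category_data.truncate M = module_category C A t1 t4 e \<and>
    monoidal_category M \<and>
    strict_monoidal_functor M C (\<lambda>(Q, q1, q4). Q) (\<lambda>_ _ f. f)"
proof -
  interpret braided_monoidal_category C by fact
  interpret regular_bimonoid C A t1 t2 t3 t4 e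
    by (intro regular_bimonoid.intro regular_bimonoid_axioms.intro) fact+
  show ?thesis using truncate_Mods monoidal_Mods strict_Mods by blast
qed

end
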